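(* Let $W_\Gamma$ and $W_\Omega$ be Coxeter groups with $\widehat{W_\Gamma}\cong\widehat{W_\Omega}$. Then $W_\Gamma$ is of FC type if and only if $W_\Omega$ is of FC type.
   Context: For a finite simplicial graph $\Gamma$ with edge labels $m\colon E(\Gamma)\to\mathbb{N}_{\ge2}$, $W_\Gamma=\langle V(\Gamma)\mid v^2,\ (vw)^{m(\{v,w\})}\text{ for }\{v,w\}\in E(\Gamma)\rangle$. For $X\subseteq V(\Gamma)$, $W_X$ denotes the subgroup generated by $X$ (a special parabolic subgroup). $W_\Gamma$ is of FC type if for every clique (complete subgraph) $\Delta\subseteq\Gamma$ the subgroup $W_{V(\Delta)}$ is finite. $\widehat{G}$ denotes profinite completion. *)

theory Defs
  imports "HOL-Algebra.Algebra"
begin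

definition labelled_graph :: "'a set \<Rightarrow> 'a set set \<Rightarrow> ('a set \<Rightarrow> nat) \<Rightarrow> bool" where
  "labelled_graph V E m \<longleftrightarrow> finite V
     \<and> E \<subseteq> {{v, w} | v w. v \<in> V \<and> w \<in> V \<and> v \<noteq> w}
     \<and> (\<forall>e\<in>E. 2 \<le> m e)"

definition clique :: "'a set \<Rightarrow> 'a set set \<Rightarrow> 'a set \<Rightarrow> bool" where
  "clique V E C \<longleftrightarrow> C \<subseteq> V \<and> (\<forall>v\<in>C. \<forall>w\<in>C. v \<noteq> w \<longrightarrow> {v, w} \<in> E)"

definition alt_word :: "'a \<Rightarrow> 'a \<Rightarrow> nat \<Rightarrow> 'a list" where
  "alt_word v w k = map (\<lambda>i. if even i then v else w) [0..<k]"

text \<open>One-step deletion of a relator v^2 or (vw)^m(v,w) from a word over V.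
Since all generators are involutions, words over V represent all group elements.\<close>
inductive_set cox_step :: "'a set \<Rightarrow> 'a set set \<Rightarrow> ('a set \<Rightarrow> nat) \<Rightarrow> ('a list \<times> 'a list) set"
  for V E m where
  sq: "\<lbrakk>u \<in> lists V; x \<in> lists V; v \<in> V\<rbrakk> \<Longrightarrow> (u @ [v, v] @ x, u @ x) \<in> cox_step V E m"
| br: "\<lbrakk>u \<in> lists V; x \<in> lists V; v \<in> V; w \<in> V; {v, w} \<in> E\<rbrakk>
       \<Longrightarrow> (u @ alt_word v w (2 * m {v, w}) @ x, u @ x) \<in> cox_step V E m"

definition cox_equiv :: "'a set \<Rightarrow> 'a set set \<Rightarrow> ('a set \<Rightarrow> nat) \<Rightarrow> ('a list \<times> 'a list) set" where
  "cox_equiv V E m = (cox_step V E m \<union> (cox_step V E m)\<inverse>)\<^sup>*"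

definition coxeter_group :: "'a set \<Rightarrow> 'a set set \<Rightarrow> ('a set \<Rightarrow> nat) \<Rightarrow> 'a list set monoid" where
  "coxeter_group V E m =
     \<lparr> carrier = lists V // cox_equiv V E m,
       monoid.mult = (\<lambda>A B. (\<Union>a\<in>A. (\<Union>b\<in>B. cox_equiv V E m `` {a @ b}))),
       monoid.one = cox_equiv V E m `` {[]} \<rparr>"

definition cox_gen :: "'a set \<Rightarrow> 'a set set \<Rightarrow> ('a set \<Rightarrow> nat) \<Rightarrow> 'a \<Rightarrow> 'a list set" where
  "cox_gen V E m v = cox_equiv V E m `` {[v]}"

definition special_parabolic :: "'a set \<Rightarrow> 'a set set \<Rightarrow> ('a set \<Rightarrow> nat) \<Rightarrow> 'a set \<Rightarrow> 'a list set set" where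
  "special_parabolic V E m S = generate (coxeter_group V E m) (cox_gen V E m ` S)"

definition FC_type :: "'a set \<Rightarrow> 'a set set \<Rightarrow> ('a set \<Rightarrow> nat) \<Rightarrow> bool" where
  "FC_type V E m \<longleftrightarrow> (\<forall>C. clique V E C \<longrightarrow> finite (special_parabolic V E m C))"

definition fin_index_normals :: "('g, 'b) monoid_scheme \<Rightarrow> 'g set set" where
  "fin_index_normals G = {N. N \<lhd> G \<and> finite (rcosets\<^bsub>G\<^esub> N)}"

definition profinite_completion :: "('g, 'b) monoid_scheme \<Rightarrow> ('g set \<Rightarrow> 'g set) monoid" where
  "profinite_completion G =
     \<lparr> carrier = {x. (\<forall>N\<in>fin_index_normals G. x N \<in> carrier (G Mod N))
                    \<and> (\<forall>N\<in>fin_index_normals G. \<forall>M\<in>fin_index_normals G. N \<subseteq> M \<longrightarrow> x N \<subseteq> x M)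
                    \<and> (\<forall>N. N \<notin> fin_index_normals G \<longrightarrow> x N = undefined)},
       monoid.mult = (\<lambda>x y N. if N \<in> fin_index_normals G then x N <#>\<^bsub>G\<^esub> y N else undefined),
       monoid.one = (\<lambda>N. if N \<in> fin_index_normals G then N else undefined) \<rparr>"

text \<open>Continuity (w.r.t. the profinite topologies) of a map between profinite completions:
each coordinate of the image depends only on some coordinate of the argument.
For homomorphisms this is exactly continuity, as the kernels of the projections
form a neighbourhood basis of the identity.\<close>
definition profinite_continuous ::
  "('g, 'b) monoid_scheme \<Rightarrow> ('h, 'c) monoid_scheme \<Rightarrow> (('g set \<Rightarrow> 'g set) \<Rightarrow> ('h set \<Rightarrow> 'h set)) \<Rightarrow> bool" where
  "profinite_continuous G H \<phi> \<longleftrightarrow>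
     (\<forall>M\<in>fin_index_normals H. \<exists>N\<in>fin_index_normals G.
        \<forall>x\<in>carrier (profinite_completion G). \<forall>y\<in>carrier (profinite_completion G).
          x N = y N \<longrightarrow> \<phi> x M = \<phi> y M)"

text \<open>Isomorphism of profinite completions as profinite (topological) groups:
a continuous group isomorphism (automatically a homeomorphism, by compactness).\<close>
definition profinite_completions_iso :: "('g, 'b) monoid_scheme \<Rightarrow> ('h, 'c) monoid_scheme \<Rightarrow> bool" where
  "profinite_completions_iso G H \<longleftrightarrow>
     (\<exists>\<phi>. \<phi> \<in> iso (profinite_completion G) (profinite_completion H) \<and> profinite_continuous G H \<phi>)"

end

(*
  Let W be of FC type and C a clique in another Coxeter graph whose group W_C embeds into the profinite
  completion of W. The generators of W_C become involutions whose pairwise products are torsion, and such a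
  family is conjugate into a finite group W_D with D a clique; hence W_C is finite.

  To see this, split W over a pair a, b of nonadjacent vertices as the amalgam of the parabolic subgroups on
  V - {a} and V - {b}. The associated profinite graph is simply connected in the sense that every cochain with
  values in Z/n is a coboundary, which gives a fixed point theorem for torsion and a Helly theorem for
  subtrees. So the family fixes a vertex, and one continues inside the closure of a smaller parabolic subgroup.
  For this one needs that finite quotients of parabolic subgroups extend to W (up to passing to finer
  quotients). This is proved by letting W act on a finite cover of its cube complex, glued along hyperplanes;
  the gluing is consistent modulo a large integer n because the geometric representation over a finitely
  generated ring separates cosets and double cosets of parabolic subgroups in the finite groups W_D.
*)
theory Submission
  imports Defs "HOL-Analysis.Product_Topology" "HOL-Number_Theory.Cong"
begin

section \<open>Words, finite quotients and finite actions\<close>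

text \<open>A profinite tree has no geodesics, so fixed points and the Helly property are obtained
  from cochains alone: modulo p^2 for the existence of a fixed vertex, modulo p for the
  connectedness of a fixed set (as in Smith theory), and modulo 2 for the Helly property. A cochain
  seen at a finite level defines a finite action of W_J only. Its potential lives on the closure of
  W_J in the completion of the whole group only if that action is detected by finite quotients of
  the whole group; this is what \<open>extend_action\<close> is for. The extended action and the
  cochain action are both twisted products, and \<open>skew_action\<close> checks the braid
  relations of both. Formal weights are adjoined to the root space because the stabiliser of
  \<omega>_t is \<open>W_{V - {t}}\<close>, and because a vanishing s-coordinate of w \<omega>_t
  puts w into the product of \<open>W_{V - {s}}\<close> and \<open>W_{V - {t}}\<close>. Membership
  thus becomes the vanishing of numbers in a ring whose additive group is finitely generated. FC
  type leaves only finitely many such numbers on the cliques, so one modulus n decides all these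
  questions.\<close>

declare in_listsD [rule del] in_listsI [rule del]

section \<open>Words, alternating words and the congruence of the presentation\<close>

lemma rev_in_lists [simp]: "rev u \<in> lists V \<longleftrightarrow> u \<in> lists V"
  by (simp add: lists_eq_set)

lemma set_alt_word: "set (alt_word v w k) \<subseteq> {v, w}"
  unfolding alt_word_def by auto

lemma alt_word_Suc: "alt_word v w (Suc k) = v # alt_word w v k"
  unfolding alt_word_def by (simp add: upt_conv_Cons map_Suc_upt[symmetric] del: upt_Suc)

lemma alt_word_0: "alt_word v w 0 = []"
  unfolding alt_word_def by simp

lemma alt_word_snoc: "alt_word v w (Suc k) = alt_word v w k @ [if even k then v else w]"
  by (simp add: alt_word_def)

lemma alt_word_add:
  "alt_word v w (k + l) = alt_word v w k @ (if even k then alt_word v w l else alt_word w v l)"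
  by (induction l) (auto simp: alt_word_snoc alt_word_0)

lemma rev_alt_word: "rev (alt_word v w k) = (if even k then alt_word w v k else alt_word v w k)"
proof (induction k arbitrary: v w)
  case (Suc k)
  have "rev (alt_word v w (Suc k)) = rev (alt_word w v k) @ [v]" by (simp add: alt_word_Suc)
  then show ?case unfolding Suc[of w v] by (cases "even k") (simp_all add: alt_word_snoc)
qed (simp add: alt_word_0)

lemma length_alt_word: "length (alt_word v w k) = k"
  unfolding alt_word_def by simp

lemma alt_word_lists: "v \<in> V \<Longrightarrow> w \<in> V \<Longrightarrow> alt_word v w k \<in> lists V"
  using set_alt_word[of v w k] by (auto simp: lists_eq_set)

lemma cox_step_lists: "(u, u') \<in> cox_step V E m \<Longrightarrow> u \<in> lists V \<and> u' \<in> lists V"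
  by (induction rule: cox_step.induct) (simp_all add: alt_word_lists del: in_lists_conv_set)

lemma cox_step_context:
  assumes "(u, u') \<in> cox_step V E m" "x \<in> lists V" "y \<in> lists V"
  shows "(x @ u @ y, x @ u' @ y) \<in> cox_step V E m"
  using assms(1)
proof (cases rule: cox_step.cases)
  case (sq u0 x0 v)
  then show ?thesis using cox_step.sq[of "x @ u0" V "x0 @ y" v E m] assms(2,3) by simp
next
  case (br u0 x0 v w)
  then show ?thesis using cox_step.br[of "x @ u0" V "x0 @ y" v w E m] assms(2,3) by simp
qed

lemma cox_step_mono:
  assumes "J \<subseteq> V" and "(u, u') \<in> cox_step J E m"
  shows "(u, u') \<in> cox_step V E m"
  using assms(2)
proof (cases rule: cox_step.cases)
  case (sq u x v)
  then show ?thesis using assms(1) lists_mono[OF assms(1)] cox_step.sq[of u V x v E m] by blast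
next
  case (br u x v w)
  then show ?thesis using assms(1) lists_mono[OF assms(1)] cox_step.br[of u V x v w E m] by blast
qed

lemma cox_equiv_refl: "(u, u) \<in> cox_equiv V E m"
  unfolding cox_equiv_def by simp

lemma cox_equiv_sym: "(u, u') \<in> cox_equiv V E m \<Longrightarrow> (u', u) \<in> cox_equiv V E m"
proof -
  have "sym (cox_step V E m \<union> (cox_step V E m)\<inverse>)" by (auto simp: sym_def)
  then show "(u, u') \<in> cox_equiv V E m \<Longrightarrow> (u', u) \<in> cox_equiv V E m"
    unfolding cox_equiv_def by (meson sym_rtrancl symD)
qed

lemma cox_equiv_trans:
  "(u, u') \<in> cox_equiv V E m \<Longrightarrow> (u', u'') \<in> cox_equiv V E m \<Longrightarrow> (u, u'') \<in> cox_equiv V E m"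
  unfolding cox_equiv_def by (rule rtrancl_trans)

lemma cox_equiv_step: "(u, u') \<in> cox_step V E m \<Longrightarrow> (u, u') \<in> cox_equiv V E m"
  unfolding cox_equiv_def by auto

lemma cox_equiv_induct [consumes 1, case_names step]:
  assumes "(u, u') \<in> cox_equiv V E m" and "\<And>u u'. (u, u') \<in> cox_step V E m \<Longrightarrow> F u = F u'"
  shows "F u = F u'"
  using assms(1) unfolding cox_equiv_def
  by (induction rule: rtrancl_induct) (use assms(2) in auto)

lemma cox_equiv_lists: "(u, u') \<in> cox_equiv V E m \<Longrightarrow> u \<in> lists V \<longleftrightarrow> u' \<in> lists V"
  by (induction rule: cox_equiv_induct) (simp add: cox_step_lists)

lemma cox_equiv_context:
  assumes "(u, u') \<in> cox_equiv V E m" "x \<in> lists V" "y \<in> lists V"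
  shows "(x @ u @ y, x @ u' @ y) \<in> cox_equiv V E m"
  using assms(1) unfolding cox_equiv_def
proof (induction rule: rtrancl_induct)
  case (step u' u'')
  then have "(x @ u' @ y, x @ u'' @ y) \<in> cox_step V E m \<union> (cox_step V E m)\<inverse>"
    using cox_step_context assms(2,3) by blast
  with step.IH show ?case by (rule rtrancl_into_rtrancl)
qed simp

lemma cox_equiv_append:
  assumes "(u, u') \<in> cox_equiv V E m" "(x, x') \<in> cox_equiv V E m" "u' \<in> lists V" "x \<in> lists V"
  shows "(u @ x, u' @ x') \<in> cox_equiv V E m"
proof -
  have "(u @ x, u' @ x) \<in> cox_equiv V E m"
    using cox_equiv_context[OF assms(1) _ assms(4), of "[]"] by simp
  moreover have "(u' @ x, u' @ x') \<in> cox_equiv V E m"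
    using cox_equiv_context[OF assms(2,3), of "[]"] by simp
  ultimately show ?thesis by (rule cox_equiv_trans)
qed

lemma cox_equiv_mono:
  assumes "J \<subseteq> V" and "(u, u') \<in> cox_equiv J E m"
  shows "(u, u') \<in> cox_equiv V E m"
proof -
  have "cox_step J E m \<union> (cox_step J E m)\<inverse> \<subseteq> cox_step V E m \<union> (cox_step V E m)\<inverse>"
    using cox_step_mono[OF assms(1)] by auto
  from rtrancl_mono[OF this] show ?thesis using assms(2) unfolding cox_equiv_def by blast
qed

lemma cox_equiv_rev_cong:
  assumes "(u, u') \<in> cox_equiv V E m" shows "(rev u, rev u') \<in> cox_equiv V E m"
proof -
  have "(rev u, rev u') \<in> cox_step V E m" if "(u, u') \<in> cox_step V E m" for u u'
    using that
  proof (cases rule: cox_step.cases)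
    case (sq u0 x v)
    then show ?thesis using cox_step.sq[of "rev x" V "rev u0" v E m] by simp
  next
    case (br u0 x v w)
    then show ?thesis
      using cox_step.br[of "rev x" V "rev u0" w v E m] by (simp add: rev_alt_word insert_commute)
  qed
  then have "(cox_step V E m \<union> (cox_step V E m)\<inverse>) \<subseteq> inv_image (cox_step V E m \<union> (cox_step V E m)\<inverse>) rev"
    by (auto simp: inv_image_def)
  with assms show ?thesis
    unfolding cox_equiv_def
    by (induction rule: rtrancl_induct) (auto intro: rtrancl_into_rtrancl simp: inv_image_def)
qed

lemma cox_equiv_square: "v \<in> V \<Longrightarrow> ([v, v], []) \<in> cox_equiv V E m"
  using cox_equiv_step[OF cox_step.sq[of "[]" V "[]" v E m]] by simp

lemma cox_equiv_rev: "u \<in> lists V \<Longrightarrow> (u @ rev u, []) \<in> cox_equiv V E m"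
proof (induction u)
  case (Cons v u)
  then have v: "v \<in> V" and u: "u \<in> lists V" by auto
  have "([v] @ (u @ rev u) @ [v], [v] @ [] @ [v]) \<in> cox_equiv V E m"
    using Cons.IH[OF u] v by (intro cox_equiv_context) auto
  with cox_equiv_square[OF v] show ?case by (auto intro: cox_equiv_trans)
qed (simp add: cox_equiv_refl)

lemma cox_equiv_rev': "u \<in> lists V \<Longrightarrow> (rev u @ u, []) \<in> cox_equiv V E m"
  using cox_equiv_rev[of "rev u" V E m] by (simp add: lists_eq_set)

section \<open>The Coxeter group as classes of words, and its special parabolic subgroups\<close>

definition cls :: "'a set \<Rightarrow> 'a set set \<Rightarrow> ('a set \<Rightarrow> nat) \<Rightarrow> 'a list \<Rightarrow> 'a list set" where
  "cls V E m u = cox_equiv V E m `` {u}"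

lemma cls_eq_iff: "cls V E m u = cls V E m u' \<longleftrightarrow> (u, u') \<in> cox_equiv V E m"
  unfolding cls_def using cox_equiv_refl cox_equiv_sym cox_equiv_trans by blast

lemma mem_cls: "u' \<in> cls V E m u \<longleftrightarrow> (u, u') \<in> cox_equiv V E m"
  unfolding cls_def by simp

lemma carrier_coxeter: "carrier (coxeter_group V E m) = cls V E m ` lists V"
  unfolding coxeter_group_def quotient_def cls_def by auto

lemma one_coxeter: "\<one>\<^bsub>coxeter_group V E m\<^esub> = cls V E m []"
  unfolding coxeter_group_def cls_def by simp

lemma mult_coxeter:
  assumes u: "u \<in> lists V" and x: "x \<in> lists V"
  shows "cls V E m u \<otimes>\<^bsub>coxeter_group V E m\<^esub> cls V E m x = cls V E m (u @ x)"
proof -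
  have "cls V E m (a @ b) = cls V E m (u @ x)" if "a \<in> cls V E m u" "b \<in> cls V E m x" for a b
  proof -
    have "(u, a) \<in> cox_equiv V E m" "(x, b) \<in> cox_equiv V E m" using that by (auto simp: mem_cls)
    then have "(u @ x, a @ b) \<in> cox_equiv V E m"
      using u x cox_equiv_lists by (intro cox_equiv_append) blast+
    then show ?thesis by (metis cls_eq_iff)
  qed
  then have "(\<Union>a\<in>cls V E m u. \<Union>b\<in>cls V E m x. cls V E m (a @ b)) = cls V E m (u @ x)"
    using cox_equiv_refl[of u V E m] cox_equiv_refl[of x V E m] unfolding mem_cls[symmetric] by blast
  then show ?thesis unfolding coxeter_group_def by (simp add: cls_def)
qed

lemma group_coxeter: "group (coxeter_group V E m)"
proof (rule groupI)
  fix x assume "x \<in> carrier (coxeter_group V E m)"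
  then obtain u where u: "u \<in> lists V" "x = cls V E m u" by (auto simp: carrier_coxeter)
  show "\<one>\<^bsub>coxeter_group V E m\<^esub> \<otimes>\<^bsub>coxeter_group V E m\<^esub> x = x"
    using u mult_coxeter[of "[]" V u E m] by (simp add: one_coxeter)
  have "cls V E m (rev u) \<otimes>\<^bsub>coxeter_group V E m\<^esub> x = \<one>\<^bsub>coxeter_group V E m\<^esub>"
    using u mult_coxeter[of "rev u" V u E m] cox_equiv_rev'[OF u(1), of E m]
    by (simp add: one_coxeter cls_eq_iff lists_eq_set)
  then show "\<exists>y\<in>carrier (coxeter_group V E m). y \<otimes>\<^bsub>coxeter_group V E m\<^esub> x = \<one>\<^bsub>coxeter_group V E m\<^esub>"
    using u by (intro bexI[of _ "cls V E m (rev u)"]) (auto simp: carrier_coxeter)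
qed (auto simp: carrier_coxeter one_coxeter mult_coxeter simp flip: append_assoc)

lemma inv_coxeter:
  assumes "u \<in> lists V"
  shows "inv\<^bsub>coxeter_group V E m\<^esub> (cls V E m u) = cls V E m (rev u)"
proof -
  interpret group "coxeter_group V E m" by (rule group_coxeter)
  show ?thesis
    by (rule inv_equality)
      (use assms cox_equiv_rev'[OF assms] in \<open>auto simp: carrier_coxeter mult_coxeter one_coxeter cls_eq_iff\<close>)
qed

lemma special_parabolic_eq:
  assumes "J \<subseteq> V"
  shows "special_parabolic V E m J = cls V E m ` lists J"
proof
  interpret group "coxeter_group V E m" by (rule group_coxeter)
  have gen: "cox_gen V E m v = cls V E m [v]" for v by (simp add: cox_gen_def cls_def)
  have XV: "u \<in> lists V" if "u \<in> lists J" for u using that assms by (auto simp: lists_eq_set)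
  show "special_parabolic V E m J \<subseteq> cls V E m ` lists J"
    unfolding special_parabolic_def
  proof
    fix x assume "x \<in> generate (coxeter_group V E m) (cox_gen V E m ` J)"
    then show "x \<in> cls V E m ` lists J"
    proof (induction rule: generate.induct)
      case (incl h)
      then show ?case by (auto simp: gen)
    next
      case (inv h)
      then obtain v where "v \<in> J" "h = cls V E m [v]" by (auto simp: gen)
      then show ?case using inv_coxeter[of "[v]" V E m] assms by auto
    next
      case (eng h1 h2)
      then obtain u1 u2 where "u1 \<in> lists J" "h1 = cls V E m u1" "u2 \<in> lists J" "h2 = cls V E m u2" by blast
      then show ?case using mult_coxeter[OF XV XV, of u1 u2 E m] by auto
    qed (auto simp: one_coxeter)
  qed
  show "cls V E m ` lists J \<subseteq> special_parabolic V E m J"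
  proof
    fix x assume "x \<in> cls V E m ` lists J"
    then obtain u where u: "u \<in> lists J" "x = cls V E m u" by blast
    from u(1) have "cls V E m u \<in> special_parabolic V E m J"
    proof (induction u)
      case Nil
      show ?case using generate.one[of "coxeter_group V E m" "cox_gen V E m ` J"]
        unfolding special_parabolic_def one_coxeter .
    next
      case (Cons v u)
      then have "v \<in> J" "u \<in> lists J" by auto
      have "cls V E m [v] \<otimes>\<^bsub>coxeter_group V E m\<^esub> cls V E m u \<in> special_parabolic V E m J"
        unfolding special_parabolic_def
      proof (rule generate.eng)
        show "cls V E m [v] \<in> generate (coxeter_group V E m) (cox_gen V E m ` J)"
          using \<open>v \<in> J\<close> by (intro generate.incl) (auto simp: gen)
        show "cls V E m u \<in> generate (coxeter_group V E m) (cox_gen V E m ` J)"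
          using Cons.IH unfolding special_parabolic_def .
      qed
      then show ?case using mult_coxeter[of "[v]" V u E m] \<open>v \<in> J\<close> XV[OF \<open>u \<in> lists J\<close>] assms by auto
    qed
    then show "x \<in> special_parabolic V E m J" using u by simp
  qed
qed

text \<open>A finite quotient of the Coxeter group, given by any map on words: the values carry no
  structure, only their equality counts. Reversal inverts words up to \<open>cox_equiv\<close>, so
  the quotient monoid is a group.\<close>

definition finite_congruence ::
  "'a set \<Rightarrow> 'a set set \<Rightarrow> ('a set \<Rightarrow> nat) \<Rightarrow> ('a list \<Rightarrow> 'c) \<Rightarrow> bool" where
  "finite_congruence V E m F \<longleftrightarrow> finite (F ` lists V)
     \<and> (\<forall>u u'. (u, u') \<in> cox_step V E m \<longrightarrow> F u = F u')
     \<and> (\<forall>u\<in>lists V. \<forall>u'\<in>lists V. \<forall>x\<in>lists V. \<forall>y\<in>lists V. F u = F u' \<longrightarrow> F (x @ u @ y) = F (x @ u' @ y))"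

lemma finite_congruence_equiv:
  "finite_congruence V E m F \<Longrightarrow> (u, u') \<in> cox_equiv V E m \<Longrightarrow> F u = F u'"
  by (erule cox_equiv_induct) (auto simp: finite_congruence_def)

lemma finite_congruenceD:
  "\<lbrakk>finite_congruence V E m F; u \<in> lists V; u' \<in> lists V; x \<in> lists V; y \<in> lists V; F u = F u'\<rbrakk>
    \<Longrightarrow> F (x @ u @ y) = F (x @ u' @ y)"
  unfolding finite_congruence_def by blast

lemma finite_congruence_pair:
  assumes "finite_congruence V E m F" "finite_congruence V E m H"
  shows "finite_congruence V E m (\<lambda>u. (F u, H u))"
proof -
  have "(\<lambda>u. (F u, H u)) ` lists V \<subseteq> F ` lists V \<times> H ` lists V" by auto
  then have "finite ((\<lambda>u. (F u, H u)) ` lists V)"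
    using assms finite_subset unfolding finite_congruence_def by blast
  then show ?thesis
    using assms unfolding finite_congruence_def prod.inject by (intro conjI) blast+
qed

text \<open>The cosets of the kernel are the fibres of \<open>F\<close>, whence the finite index.
  Membership of a class can be read off from any representative because \<open>F\<close> is constant
  on classes.\<close>

lemma kernel_fin_index_normal:
  assumes F: "finite_congruence V E m F"
  shows "cls V E m ` {u \<in> lists V. F u = F []} \<in> fin_index_normals (coxeter_group V E m)" (is "?N \<in> _")
    and "u \<in> lists V \<Longrightarrow> cls V E m u \<in> cls V E m ` {u \<in> lists V. F u = F []} \<longleftrightarrow> F u = F []"
proof -
  let ?G = "coxeter_group V E m"
  interpret group ?G by (rule group_coxeter)
  note eq = finite_congruence_equiv[OF F]
  show mem: "cls V E m u \<in> ?N \<longleftrightarrow> F u = F []" if "u \<in> lists V" for u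
    using that eq unfolding image_iff cls_eq_iff by (auto intro: cox_equiv_refl)
  have app: "F (u @ x) = F (u' @ x)" "F (x @ u) = F (x @ u')"
    if "u \<in> lists V" "u' \<in> lists V" "x \<in> lists V" "F u = F u'" for u u' x
    using finite_congruenceD[OF F that(1,2) _ that(3) that(4), of "[]"]
      finite_congruenceD[OF F that(1,2) that(3) _ that(4), of "[]"] by auto
  have sub: "subgroup ?N ?G"
  proof (rule subgroupI)
    show "?N \<subseteq> carrier ?G" by (auto simp: carrier_coxeter)
    show "?N \<noteq> {}" by auto
    fix a assume "a \<in> ?N"
    then obtain u where u: "u \<in> lists V" "F u = F []" "a = cls V E m u" by blast
    have "F (rev u) = F (u @ rev u)" using app(1)[OF u(1) _ _ u(2), of "rev u"] u(1) by simp
    also have "\<dots> = F []" using eq[OF cox_equiv_rev[OF u(1)]] .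
    finally show "inv\<^bsub>?G\<^esub> a \<in> ?N" using u by (auto simp: inv_coxeter)
    fix b assume "b \<in> ?N"
    then obtain x where x: "x \<in> lists V" "F x = F []" "b = cls V E m x" by blast
    have "F (u @ x) = F []" using app(1)[OF u(1) _ x(1) u(2)] x(2) by simp
    then show "a \<otimes>\<^bsub>?G\<^esub> b \<in> ?N" using u x by (auto simp: mult_coxeter)
  qed
  have nrm: "?N \<lhd> ?G"
    unfolding normal_inv_iff
  proof (intro conjI ballI sub)
    fix x h assume "x \<in> carrier ?G" "h \<in> ?N"
    then obtain y u where y: "y \<in> lists V" "x = cls V E m y" and u: "u \<in> lists V" "F u = F []" "h = cls V E m u"
      by (auto simp: carrier_coxeter)
    have "F (y @ u @ rev y) = F (y @ [] @ rev y)"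
      using finite_congruenceD[OF F u(1) _ y(1) _ u(2), of "rev y"] y(1) by simp
    also have "\<dots> = F []" using eq[OF cox_equiv_rev[OF y(1)]] by simp
    finally show "x \<otimes>\<^bsub>?G\<^esub> h \<otimes>\<^bsub>?G\<^esub> inv\<^bsub>?G\<^esub> x \<in> ?N"
      using y u by (auto simp: inv_coxeter mult_coxeter)
  qed
  have "rcosets\<^bsub>?G\<^esub> ?N \<subseteq> (\<lambda>c. cls V E m ` {u \<in> lists V. F u = c}) ` F ` lists V"
  proof
    fix A assume "A \<in> rcosets\<^bsub>?G\<^esub> ?N"
    then obtain y where y: "y \<in> lists V" and A: "A = ?N #>\<^bsub>?G\<^esub> cls V E m y"
      by (auto simp: RCOSETS_def carrier_coxeter)
    have "A = cls V E m ` {u \<in> lists V. F u = F y}"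
    proof (intro equalityI subsetI)
      fix a assume "a \<in> A"
      then obtain u where u: "u \<in> lists V" "F u = F []" "a = cls V E m (u @ y)"
        using y by (auto simp: A r_coset_def mult_coxeter)
      have "F (u @ y) = F y" using app(1)[OF u(1) _ y u(2)] by simp
      then show "a \<in> cls V E m ` {u \<in> lists V. F u = F y}" using u y by auto
    next
      fix a assume "a \<in> cls V E m ` {u \<in> lists V. F u = F y}"
      then obtain u where u: "u \<in> lists V" "F u = F y" "a = cls V E m u" by blast
      have "F (u @ rev y) = F (y @ rev y)" using app(1)[OF u(1) y _ u(2), of "rev y"] y by simp
      also have "\<dots> = F []" using eq[OF cox_equiv_rev[OF y(1)]] by simp
      finally have "cls V E m (u @ rev y) \<in> ?N" using u y by auto
      moreover have "cls V E m (u @ rev y) \<otimes>\<^bsub>?G\<^esub> cls V E m y = a"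
      proof -
        have "(u @ (rev y @ y) @ [], u @ [] @ []) \<in> cox_equiv V E m"
          using cox_equiv_context[OF cox_equiv_rev'[OF y], of u "[]"] u by auto
        then show ?thesis using u y by (auto simp: mult_coxeter cls_eq_iff)
      qed
      ultimately show "a \<in> A" unfolding A r_coset_def by blast
    qed
    then show "A \<in> (\<lambda>c. cls V E m ` {u \<in> lists V. F u = c}) ` F ` lists V" using y by blast
  qed
  moreover have "finite (F ` lists V)" using F by (simp add: finite_congruence_def)
  ultimately have "finite (rcosets\<^bsub>?G\<^esub> ?N)" using finite_surj by blast
  with nrm show "?N \<in> fin_index_normals ?G" by (simp add: fin_index_normals_def)
qed

text \<open>The converse passage, from a normal subgroup to a congruence, combined with restriction
  to words over \<open>J\<close>.\<close>

lemma coset_finite_congruence: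
  assumes N: "N \<in> fin_index_normals (coxeter_group V E m)" and J: "J \<subseteq> V"
  shows "finite_congruence J E m (\<lambda>u. N #>\<^bsub>coxeter_group V E m\<^esub> cls V E m u)"
  unfolding finite_congruence_def
proof (intro conjI allI ballI impI)
  let ?G = "coxeter_group V E m"
  interpret group ?G by (rule group_coxeter)
  interpret normal N ?G using N by (simp add: fin_index_normals_def)
  have XV: "u \<in> lists V" if "u \<in> lists J" for u using that J by (auto simp: lists_eq_set)
  have car: "cls V E m u \<in> carrier ?G" if "u \<in> lists V" for u using that by (simp add: carrier_coxeter)
  show "finite ((\<lambda>u. N #>\<^bsub>?G\<^esub> cls V E m u) ` lists J)"
  proof (rule finite_subset)
    show "(\<lambda>u. N #>\<^bsub>?G\<^esub> cls V E m u) ` lists J \<subseteq> rcosets\<^bsub>?G\<^esub> N"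
      using XV car by (auto simp: RCOSETS_def)
    show "finite (rcosets\<^bsub>?G\<^esub> N)" using N by (simp add: fin_index_normals_def)
  qed
  show "N #>\<^bsub>?G\<^esub> cls V E m u = N #>\<^bsub>?G\<^esub> cls V E m u'" if "(u, u') \<in> cox_step J E m" for u u'
    using cox_equiv_step[OF cox_step_mono[OF J that]] by (simp add: cls_eq_iff[symmetric])
  fix u u' x y assume h: "u \<in> lists J" "u' \<in> lists J" "x \<in> lists J" "y \<in> lists J"
    "N #>\<^bsub>?G\<^esub> cls V E m u = N #>\<^bsub>?G\<^esub> cls V E m u'"
  have *: "N #>\<^bsub>?G\<^esub> cls V E m (x @ w @ y) = (N #>\<^bsub>?G\<^esub> cls V E m x) <#>\<^bsub>?G\<^esub> (N #>\<^bsub>?G\<^esub> cls V E m w) <#>\<^bsub>?G\<^esub> (N #>\<^bsub>?G\<^esub> cls V E m y)"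
    if "w \<in> lists J" for w
    using rcos_sum car XV h that by (simp add: mult_coxeter del: in_lists_conv_set)
  show "N #>\<^bsub>?G\<^esub> cls V E m (x @ u @ y) = N #>\<^bsub>?G\<^esub> cls V E m (x @ u' @ y)"
    unfolding *[OF h(1)] *[OF h(2)] h(5) ..
qed

text \<open>Words act from the right, so that they are read from left to right by \<^const>\<open>fold\<close>.\<close>
definition cox_action ::
  "'a set \<Rightarrow> 'a set set \<Rightarrow> ('a set \<Rightarrow> nat) \<Rightarrow> 's set \<Rightarrow> ('a \<Rightarrow> 's \<Rightarrow> 's) \<Rightarrow> bool" where
  "cox_action V E m S \<rho> \<longleftrightarrow> (\<forall>v\<in>V. \<forall>z\<in>S. \<rho> v z \<in> S \<and> \<rho> v (\<rho> v z) = z)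
     \<and> (\<forall>v\<in>V. \<forall>w\<in>V. {v, w} \<in> E \<longrightarrow> (\<forall>z\<in>S. fold \<rho> (alt_word v w (2 * m {v, w})) z = z))"

lemma cox_action_closed:
  "cox_action V E m S \<rho> \<Longrightarrow> u \<in> lists V \<Longrightarrow> z \<in> S \<Longrightarrow> fold \<rho> u z \<in> S"
  by (induction u arbitrary: z) (auto simp: cox_action_def)

lemma cox_action_equiv:
  assumes \<rho>: "cox_action V E m S \<rho>" and "(u, u') \<in> cox_equiv V E m" "z \<in> S"
  shows "fold \<rho> u z = fold \<rho> u' z"
  using assms(2)
proof (induction rule: cox_equiv_induct)
  case (step u u')
  then show ?case
  proof (cases rule: cox_step.cases)
    case (sq u0 x v)
    then show ?thesis using \<rho> cox_action_closed[OF \<rho> sq(3) \<open>z \<in> S\<close>] by (simp add: cox_action_def)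
  next
    case (br u0 x v w)
    then show ?thesis using \<rho> cox_action_closed[OF \<rho> br(3) \<open>z \<in> S\<close>] by (simp add: cox_action_def)
  qed
qed

lemma action_finite_congruence:
  assumes \<rho>: "cox_action V E m S \<rho>" and S: "finite S"
  shows "finite_congruence V E m (\<lambda>u. restrict (fold \<rho> u) S)"
  unfolding finite_congruence_def
proof (intro conjI allI ballI impI)
  have "(\<lambda>u. restrict (fold \<rho> u) S) ` lists V \<subseteq> S \<rightarrow>\<^sub>E S"
    using cox_action_closed[OF \<rho>] by auto
  then show "finite ((\<lambda>u. restrict (fold \<rho> u) S) ` lists V)"
    using finite_subset finite_PiE[OF S, of "\<lambda>_. S"] S by blast
  show "restrict (fold \<rho> u) S = restrict (fold \<rho> u') S" if "(u, u') \<in> cox_step V E m" for u u'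
    using cox_action_equiv[OF \<rho> cox_equiv_step[OF that]] by (simp cong: restrict_cong)
  fix u u' x y assume h: "u \<in> lists V" "u' \<in> lists V" "x \<in> lists V" "y \<in> lists V"
    "restrict (fold \<rho> u) S = restrict (fold \<rho> u') S"
  have "fold \<rho> u z = fold \<rho> u' z" if "z \<in> S" for z
    using fun_cong[OF h(5), of z] that by simp
  then show "restrict (fold \<rho> (x @ u @ y)) S = restrict (fold \<rho> (x @ u' @ y)) S"
    using cox_action_closed[OF \<rho> h(3)] by (auto simp: restrict_def)
qed

text \<open>The right regular action of the finite quotient: a letter acts by being appended,
  whatever representative is chosen in \<open>r\<close>.\<close>

lemma congruence_action:
  assumes F: "finite_congruence V E m F"
  obtains r where "cox_action V E m (F ` lists V) r"
    "\<And>u x. u \<in> lists V \<Longrightarrow> x \<in> lists V \<Longrightarrow> fold r x (F u) = F (u @ x)"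
proof -
  define r where "r s q = F ((SOME u. u \<in> lists V \<and> F u = q) @ [s])" for s q
  have r: "r s (F u) = F (u @ [s])" if "u \<in> lists V" "s \<in> V" for s u
  proof -
    have "\<exists>u'. u' \<in> lists V \<and> F u' = F u" using that(1) by blast
    from someI_ex[OF this] have u': "(SOME u'. u' \<in> lists V \<and> F u' = F u) \<in> lists V"
      "F (SOME u'. u' \<in> lists V \<and> F u' = F u) = F u" by blast+
    from finite_congruenceD[OF F u'(1) that(1) _ _ u'(2), of "[]" "[s]"] that(2)
    show ?thesis unfolding r_def by simp
  qed
  have fr: "fold r x (F u) = F (u @ x)" if "u \<in> lists V" "x \<in> lists V" for u x
    using that
  proof (induction x arbitrary: u)
    case (Cons s x)
    then show ?case using r[of u s] Cons.IH[of "u @ [s]"] by simp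
  qed simp
  have "cox_action V E m (F ` lists V) r"
    unfolding cox_action_def
  proof (intro conjI ballI impI)
    fix v z assume v: "v \<in> V" and "z \<in> F ` lists V"
    then obtain u where u: "u \<in> lists V" "z = F u" by blast
    show "r v z \<in> F ` lists V" using r[OF u(1) v] u v by auto
    have "F (u @ [v, v]) = F u"
      using F cox_step.sq[OF u(1), of "[]" v E m] v unfolding finite_congruence_def by simp
    then show "r v (r v z) = z" using r[OF u(1) v] r[of "u @ [v]" v] u v by simp
  next
    fix v w z assume v: "v \<in> V" "w \<in> V" "{v, w} \<in> E" and "z \<in> F ` lists V"
    then obtain u where u: "u \<in> lists V" "z = F u" by blast
    have "F (u @ alt_word v w (2 * m {v, w})) = F u"
      using F cox_step.br[OF u(1), of "[]" v w E m] v unfolding finite_congruence_def by simp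
    then show "fold r (alt_word v w (2 * m {v, w})) z = z"
      using fr[OF u(1) alt_word_lists[OF v(1,2)]] u by simp
  qed
  then show ?thesis using fr by (rule that)
qed

text \<open>Along an alternating path in \<open>v, w\<close> the product of the twists telescopes, because
  \<open>\<theta> v q \<circ> \<theta> w q\<close> is a potential for it. Hence the braid relations hold.\<close>
lemma skew_action:
  assumes r: "cox_action V E m T r"
    and cl: "\<And>v q z. \<lbrakk>v \<in> V; q \<in> T; z \<in> S\<rbrakk> \<Longrightarrow> \<theta> v q z \<in> S"
    and invol: "\<And>v q z. \<lbrakk>v \<in> V; q \<in> T; z \<in> S\<rbrakk> \<Longrightarrow> \<theta> v q (\<theta> v q z) = z"
    and inv: "\<And>v w q z. \<lbrakk>v \<in> V; w \<in> V; {v, w} \<in> E; q \<in> T; z \<in> S\<rbrakk> \<Longrightarrow> \<theta> w (r v q) z = \<theta> w q z"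
    and comm: "\<And>v w q z. \<lbrakk>v \<in> V; w \<in> V; {v, w} \<in> E; q \<in> T; z \<in> S\<rbrakk>
      \<Longrightarrow> \<theta> v q (\<theta> w q z) = \<theta> w q (\<theta> v q z)"
  shows "cox_action V E m (S \<times> T) (\<lambda>v (z, q). (\<theta> v (r v q) (\<theta> v q z), r v q))"
    (is "cox_action V E m _ ?\<rho>")
  unfolding cox_action_def
proof (intro conjI ballI impI)
  have rT: "r v q \<in> T" "r v (r v q) = q" if "v \<in> V" "q \<in> T" for v q
    using r that unfolding cox_action_def by blast+
  fix v z assume v: "v \<in> V" and z: "z \<in> S \<times> T"
  then show "?\<rho> v z \<in> S \<times> T" using cl rT by auto
  show "?\<rho> v (?\<rho> v z) = z" using v z cl invol rT by auto
next
  have rT: "r v q \<in> T" if "v \<in> V" "q \<in> T" for v q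
    using r that unfolding cox_action_def by blast
  fix v w z assume v: "v \<in> V" and w: "w \<in> V" and e: "{v, w} \<in> E" and "z \<in> S \<times> T"
  then obtain s q where z: "z = (s, q)" "s \<in> S" "q \<in> T" by blast
  have e': "{w, v} \<in> E" using e by (simp add: insert_commute)
  have path: "fold ?\<rho> u (s, q) = (\<theta> w (fold r u q) (\<theta> v (fold r u q) (\<theta> v q (\<theta> w q s))), fold r u q)"
    if "u \<in> lists {v, w}" "s \<in> S" "q \<in> T" for u s q
    using that
  proof (induction u arbitrary: s q rule: list.induct)
    case Nil
    then show ?case using v w invol cl by simp
  next
    case (Cons t u)
    define q' where "q' = r t q"
    define s' where "s' = \<theta> t q' (\<theta> t q s)"
    have t: "t = v \<or> t = w" using Cons.prems(1) by simp
    then have "t \<in> V" using v w by blast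
    have q': "q' \<in> T" unfolding q'_def using rT \<open>t \<in> V\<close> Cons.prems by blast
    have s': "s' \<in> S" unfolding s'_def using cl \<open>t \<in> V\<close> q' Cons.prems by blast
    \<comment> \<open>The potential is constant along a letter \<open>t\<close>: its own twist
      cancels because it is involutive, and by \<open>inv\<close> the other twist does not notice
      the move.\<close>
    have "\<theta> v q' (\<theta> w q' s') = \<theta> v q (\<theta> w q s)"
    proof (cases "t = v")
      case True
      have "\<theta> v q' (\<theta> w q' s') = \<theta> w q' (\<theta> v q' s')" using comm v w e q' s' by blast
      also have "\<theta> v q' s' = \<theta> v q s" unfolding s'_def True using invol v q' cl Cons.prems by auto
      also have "\<theta> w q' (\<theta> v q s) = \<theta> w q (\<theta> v q s)"
        unfolding q'_def True using inv[OF v w e] cl v Cons.prems by blast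
      also have "\<dots> = \<theta> v q (\<theta> w q s)" using comm v w e Cons.prems by metis
      finally show ?thesis .
    next
      case False
      then have t: "t = w" using t by blast
      have "\<theta> w q' s' = \<theta> w q s" unfolding s'_def t using invol w q' cl Cons.prems by auto
      moreover have "\<theta> v q' (\<theta> w q s) = \<theta> v q (\<theta> w q s)"
        unfolding q'_def t using inv[OF w v e'] cl w Cons.prems by blast
      ultimately show ?thesis by simp
    qed
    moreover have "fold ?\<rho> (t # u) (s, q) = fold ?\<rho> u (s', q')" by (simp add: s'_def q'_def)
    moreover have "fold r (t # u) q = fold r u q'" by (simp add: q'_def)
    ultimately show ?case using Cons.IH[OF _ s' q'] Cons.prems(1) by simp
  qed
  let ?u = "alt_word v w (2 * m {v, w})"
  \<comment> \<open>The relator is a closed path over \<open>T\<close>, so the potentials at its two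
    ends coincide and cancel.\<close>
  have "fold r ?u q = q" using r v w e z(3) unfolding cox_action_def by blast
  moreover have "?u \<in> lists {v, w}" using set_alt_word[of v w] by (auto simp: lists_eq_set)
  ultimately show "fold ?\<rho> ?u z = z" using path[OF _ z(2,3)] v w invol cl z by simp
qed

lemma fin_index_normals_Int:
  assumes G: "group G" and N: "N \<in> fin_index_normals G" and M: "M \<in> fin_index_normals G"
  shows "N \<inter> M \<in> fin_index_normals G"
proof -
  interpret group G by (rule G)
  interpret N: normal N G using N by (simp add: fin_index_normals_def)
  interpret M: normal M G using M by (simp add: fin_index_normals_def)
  have "N \<inter> M \<lhd> G"
    unfolding normal_inv_iff
    using subgroups_Inter_pair[OF N.subgroup_axioms M.subgroup_axioms] N.inv_op_closed2 M.inv_op_closed2 by auto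
  moreover have "rcosets\<^bsub>G\<^esub> (N \<inter> M) \<subseteq> (\<lambda>(A, B). A \<inter> B) ` ((rcosets\<^bsub>G\<^esub> N) \<times> (rcosets\<^bsub>G\<^esub> M))"
  proof
    fix A assume "A \<in> rcosets\<^bsub>G\<^esub> (N \<inter> M)"
    then obtain x where x: "x \<in> carrier G" "A = (N \<inter> M) #>\<^bsub>G\<^esub> x" by (auto simp: RCOSETS_def)
    have "A = (N #>\<^bsub>G\<^esub> x) \<inter> (M #>\<^bsub>G\<^esub> x)"
    proof
      show "(N #>\<^bsub>G\<^esub> x) \<inter> (M #>\<^bsub>G\<^esub> x) \<subseteq> A"
      proof
        fix y assume "y \<in> (N #>\<^bsub>G\<^esub> x) \<inter> (M #>\<^bsub>G\<^esub> x)"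
        then obtain n k where "n \<in> N" "k \<in> M" "y = n \<otimes>\<^bsub>G\<^esub> x" "y = k \<otimes>\<^bsub>G\<^esub> x" by (auto simp: r_coset_def)
        moreover then have "n = k" using x(1) N.subset M.subset by (metis r_cancel subsetD)
        ultimately show "y \<in> A" unfolding x r_coset_def by blast
      qed
    qed (auto simp: x r_coset_def)
    then show "A \<in> (\<lambda>(A, B). A \<inter> B) ` ((rcosets\<^bsub>G\<^esub> N) \<times> (rcosets\<^bsub>G\<^esub> M))"
      using x(1) by (auto simp: RCOSETS_def)
  qed
  moreover have "finite ((rcosets\<^bsub>G\<^esub> N) \<times> (rcosets\<^bsub>G\<^esub> M))"
    using N M by (simp add: fin_index_normals_def)
  ultimately show ?thesis using finite_surj unfolding fin_index_normals_def by blast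
qed

section \<open>The geometric representation\<close>

text \<open>Twice the matrix of the Tits form. A missing edge stands for the label infinity, at
  which the cosine becomes 1.\<close>

definition cartan :: "'a set set \<Rightarrow> ('a set \<Rightarrow> nat) \<Rightarrow> 'a \<Rightarrow> 'a \<Rightarrow> real" where
  "cartan E m v w = (if v = w then 2 else if {v, w} \<in> E then - 2 * cos (pi / real (m {v, w})) else - 2)"

lemma cartan_sym: "cartan E m v w = cartan E m w v"
  by (simp add: cartan_def insert_commute)

text \<open>The space is spanned by the simple roots \<open>e_v\<close> and formal weights \<open>\<omega>_t\<close> dual to them.
  The reflections do not change the weight part, so a vector is given by its root coordinates \<open>x\<close>,
  while the weight coordinates \<open>y\<close> are a parameter of the action.\<close>
definition pairing :: "'a set \<Rightarrow> 'a set set \<Rightarrow> ('a set \<Rightarrow> nat) \<Rightarrow> ('a \<Rightarrow> real) \<Rightarrow> 'a \<Rightarrow> ('a \<Rightarrow> real) \<Rightarrow> real" where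
  "pairing V E m y v x = (\<Sum>u\<in>V. cartan E m v u * x u) + y v"

definition reflect :: "'a set \<Rightarrow> 'a set set \<Rightarrow> ('a set \<Rightarrow> nat) \<Rightarrow> ('a \<Rightarrow> real) \<Rightarrow> 'a \<Rightarrow> ('a \<Rightarrow> real) \<Rightarrow> 'a \<Rightarrow> real" where
  "reflect V E m y v x = x(v := x v - pairing V E m y v x)"

definition wact :: "'a set \<Rightarrow> 'a set set \<Rightarrow> ('a set \<Rightarrow> nat) \<Rightarrow> ('a \<Rightarrow> real) \<Rightarrow> 'a list \<Rightarrow> ('a \<Rightarrow> real) \<Rightarrow> 'a \<Rightarrow> real" where
  "wact V E m y u x = foldr (reflect V E m y) u x"

text \<open>Used in two roles: as argument \<open>x\<close> it is the root e_v, as parameter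
  \<open>y\<close> the weight \<omega>_v. Thus \<open>wact V E m (simple_root t) u origin\<close> is
  u \<omega>_t - \<omega>_t in root coordinates.\<close>

definition simple_root :: "'a \<Rightarrow> 'a \<Rightarrow> real" where
  "simple_root v = (\<lambda>k. if k = v then 1 else 0)"

abbreviation origin :: "'a \<Rightarrow> real" where "origin \<equiv> (\<lambda>_. 0)"

lemma wact_append: "wact V E m y (u @ w) x = wact V E m y u (wact V E m y w x)"
  by (simp add: wact_def)

lemma wact_Nil [simp]: "wact V E m y [] x = x"
  by (simp add: wact_def)

lemma wact_Cons: "wact V E m y (v # u) x = reflect V E m y v (wact V E m y u x)"
  by (simp add: wact_def)

lemma reflect_other: "k \<noteq> v \<Longrightarrow> reflect V E m y v x k = x k"
  by (simp add: reflect_def)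

lemma wact_other: "k \<notin> set u \<Longrightarrow> wact V E m y u x k = x k"
  by (induction u) (auto simp: wact_Cons reflect_other)

text \<open>The recurrence of the root coordinates along an alternating product of two reflections
  with Cartan entry \<open>- a\<close>. For start values 0, 1 and a = 2 cos \<theta> the solution is
  sin(n \<theta>)/sin \<theta>.\<close>

fun chebyshev :: "real \<Rightarrow> real \<Rightarrow> real \<Rightarrow> nat \<Rightarrow> real" where
  "chebyshev a c d 0 = c"
| "chebyshev a c d (Suc 0) = d"
| "chebyshev a c d (Suc (Suc n)) = a * chebyshev a c d (Suc n) - chebyshev a c d n"

lemma chebyshev_sin:
  "chebyshev (2 * cos \<theta>) c d n * sin \<theta> = sin (real n * \<theta>) * d - sin ((real n - 1) * \<theta>) * c"
proof (induction "2 * cos \<theta>" c d n rule: chebyshev.induct)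
  case (3 c d n)
  have add: "sin (s + \<theta>) = 2 * cos \<theta> * sin s - sin (s - \<theta>)" for s
    by (simp add: sin_add sin_diff)
  have 1: "sin (real (Suc (Suc n)) * \<theta>) = 2 * cos \<theta> * sin (real (Suc n) * \<theta>) - sin (real n * \<theta>)"
    using add[of "real (Suc n) * \<theta>"] by (simp add: algebra_simps)
  have 2: "sin ((real (Suc (Suc n)) - 1) * \<theta>) = 2 * cos \<theta> * sin ((real (Suc n) - 1) * \<theta>) - sin ((real n - 1) * \<theta>)"
    using add[of "real n * \<theta>"] by (simp add: algebra_simps)
  have "chebyshev (2 * cos \<theta>) c d (Suc (Suc n)) * sin \<theta>
     = 2 * cos \<theta> * (chebyshev (2 * cos \<theta>) c d (Suc n) * sin \<theta>) - chebyshev (2 * cos \<theta>) c d n * sin \<theta>"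
    by (simp add: algebra_simps)
  then show ?case unfolding 3 1 2 by (simp add: algebra_simps)
qed auto

lemma chebyshev_two: "chebyshev 2 0 1 n = real n"
  by (induction "2::real" "0::real" "1::real" n rule: chebyshev.induct) auto

text \<open>Only pairs inside \<open>V\<close> are constrained, so the same \<open>E\<close> and
  \<open>m\<close> serve for every subset of \<open>V\<close>, and special parabolic subgroups are
  again instances.\<close>

locale coxeter =
  fixes V :: "'a set" and E :: "'a set set" and m :: "'a set \<Rightarrow> nat"
  assumes finite_V: "finite V"
    and edge: "\<And>v w. \<lbrakk>v \<in> V; w \<in> V; {v, w} \<in> E\<rbrakk> \<Longrightarrow> v \<noteq> w \<and> 2 \<le> m {v, w}"
begin

abbreviation "A \<equiv> cartan E m"
abbreviation "pr \<equiv> pairing V E m"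
abbreviation "rfl \<equiv> reflect V E m"
abbreviation "act \<equiv> wact V E m"
abbreviation "ce \<equiv> cox_equiv V E m"

lemma angle:
  assumes "v \<in> V" "w \<in> V" "{v, w} \<in> E"
  shows "0 < pi / real (m {v, w})" "pi / real (m {v, w}) \<le> pi / 2" "sin (pi / real (m {v, w})) > 0"
proof -
  have "2 \<le> real (m {v, w})" using edge[OF assms] by simp
  then show 1: "0 < pi / real (m {v, w})" and 2: "pi / real (m {v, w}) \<le> pi / 2"
    by (simp, intro divide_left_mono) auto
  then show "sin (pi / real (m {v, w})) > 0" using pi_gt_zero by (intro sin_gt_zero) linarith+
qed

lemma pr_reflect:
  assumes "v \<in> V" shows "pr y w (rfl y v x) = pr y w x - A w v * pr y v x"
proof -
  have "(\<Sum>u\<in>V. A w u * rfl y v x u) = (\<Sum>u\<in>V. A w u * x u - (if u = v then A w v * pr y v x else 0))"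
    by (rule sum.cong) (auto simp: reflect_def algebra_simps)
  also have "\<dots> = (\<Sum>u\<in>V. A w u * x u) - A w v * pr y v x"
    using assms finite_V by (simp add: sum_subtractf)
  finally show ?thesis by (simp add: pairing_def)
qed

lemma reflect_reflect: assumes "v \<in> V" shows "rfl y v (rfl y v x) = x"
proof -
  have "pr y v (rfl y v x) = - pr y v x" using pr_reflect[OF assms, of y v x] by (simp add: cartan_def)
  then show ?thesis unfolding reflect_def[of V E m y v "rfl y v x"]
    by (auto simp: reflect_def)
qed

text \<open>An arbitrary vector with a weight part need not lie in the plane of the two roots, so
  its displacement is computed. The pairings along the orbit form a sequence \<open>d\<close> of
  period 2M. Summing its recurrence over a period gives 2 S2 = a S1 and 2 S1 = a S2, and both
  displacements vanish since a^2 is not 4.\<close>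

lemma reflect_braid:
  assumes v: "v \<in> V" and w: "w \<in> V" and e: "{v, w} \<in> E"
  shows "foldr (rfl y) (alt_word v w (2 * m {v, w})) x = x"
proof -
  define M where "M = m {v, w}"
  define \<theta> where "\<theta> = pi / real M"
  define a where "a = 2 * cos \<theta>"
  have vw: "v \<noteq> w" and M: "2 \<le> M" using edge[OF v w e] by (auto simp: M_def)
  have A: "A v w = - a" "A w v = - a" "A v v = 2" "A w w = 2"
    using vw e by (auto simp: cartan_def a_def \<theta>_def M_def insert_commute)
  have s: "sin \<theta> > 0" using angle[OF v w e] by (simp add: \<theta>_def M_def)
  define d where "d = chebyshev a (- pr y v x) (pr y w x)"
  have d2: "d (Suc (Suc n)) = a * d (Suc n) - d n" for n by (simp add: d_def)
  define S1 where "S1 k = (\<Sum>j<k. d (2 * j + 1))" for k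
  define S2 where "S2 k = (\<Sum>j<k. d (2 * j + 2))" for k
  define T where "T = rfl y v \<circ> rfl y w"
  have T: "(T ^^ k) x = x(v := x v - S2 k, w := x w - S1 k)
      \<and> pr y v ((T ^^ k) x) = - d (2 * k) \<and> pr y w ((T ^^ k) x) = d (2 * k + 1)" for k
  proof (induction k)
    case 0
    then show ?case by (simp add: S1_def S2_def d_def)
  next
    case (Suc k)
    define z where "z = (T ^^ k) x"
    have z: "z = x(v := x v - S2 k, w := x w - S1 k)" "pr y v z = - d (2 * k)" "pr y w z = d (2 * k + 1)"
      using Suc unfolding z_def by auto
    define z' where "z' = rfl y w z"
    have z': "pr y w z' = - d (2 * k + 1)" "pr y v z' = d (2 * k + 2)"
      using pr_reflect[OF w, of y w z] pr_reflect[OF w, of y v z] z A d2[of "2 * k"] by (simp_all add: z'_def)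
    have Tz: "(T ^^ Suc k) x = rfl y v z'" by (simp add: T_def z_def z'_def)
    have "rfl y v z' = x(v := x v - S2 (Suc k), w := x w - S1 (Suc k))"
      unfolding reflect_def[of V E m y v z'] z'(2)
      unfolding z'_def reflect_def z(3) unfolding z(1) using vw by (auto simp: S1_def S2_def)
    moreover have "pr y v (rfl y v z') = - d (2 * Suc k)" "pr y w (rfl y v z') = d (2 * Suc k + 1)"
      using pr_reflect[OF v, of y v z'] pr_reflect[OF v, of y w z'] z' A d2[of "2 * k + 1"] by simp_all
    ultimately show ?case unfolding Tz by blast
  qed
  have "d (n + 2 * M) = d n" for n
  proof -
    have r: "(real (n + 2 * M) - c) * \<theta> = (real n - c) * \<theta> + 2 * pi" for c
      using M by (simp add: \<theta>_def field_simps)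
    have "sin ((real (n + 2 * M) - c) * \<theta>) = sin ((real n - c) * \<theta>)" for c
      unfolding r by (simp add: sin_add)
    from this[of 0] this[of 1] have "d (n + 2 * M) * sin \<theta> = d n * sin \<theta>"
      unfolding d_def a_def chebyshev_sin by simp
    then show ?thesis using s by simp
  qed
  note per = this
  have S1': "S1 M = (\<Sum>j<M. d (2 * j + 3))"
  proof -
    have "(\<Sum>j<M. d (2 * j + 3)) = (\<Sum>j<M. d (2 * Suc j + 1))" by (simp add: numeral_3_eq_3)
    also have "\<dots> = S1 (Suc M) - d 1"
      unfolding S1_def by (subst sum.lessThan_Suc_shift[of _ M]) simp
    also have "\<dots> = S1 M" using per[of 1] by (simp add: S1_def add.commute)
    finally show ?thesis by simp
  qed
  have S2': "S2 M = (\<Sum>j<M. d (2 * j))"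
  proof -
    have "S2 M = (\<Sum>j<M. d (2 * Suc j))" by (simp add: S2_def)
    also have "\<dots> = (\<Sum>j<Suc M. d (2 * j)) - d 0" by (subst sum.lessThan_Suc_shift[of _ M]) simp
    also have "\<dots> = (\<Sum>j<M. d (2 * j))" using per[of 0] by simp
    finally show ?thesis .
  qed
  have "2 * S2 M = a * S1 M"
  proof -
    have "2 * S2 M = (\<Sum>j<M. d (2 * j) + d (2 * j + 2))"
      unfolding sum.distrib S2'[symmetric] by (simp add: S2_def)
    also have "\<dots> = (\<Sum>j<M. a * d (2 * j + 1))" using d2 by simp
    finally show ?thesis by (simp add: S1_def sum_distrib_left)
  qed
  moreover have "2 * S1 M = a * S2 M"
  proof -
    have "2 * S1 M = (\<Sum>j<M. d (2 * j + 1) + d (2 * j + 3))"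
      unfolding sum.distrib S1'[symmetric] by (simp add: S1_def)
    also have "\<dots> = (\<Sum>j<M. a * d (2 * j + 2))" using d2 by (simp add: numeral_3_eq_3)
    finally show ?thesis by (simp add: S2_def sum_distrib_left)
  qed
  moreover have "a^2 \<noteq> 4"
  proof -
    have "a^2 = 4 - 4 * (sin \<theta>)^2" unfolding a_def by (simp add: power_mult_distrib cos_squared_eq)
    then show ?thesis using s by simp
  qed
  ultimately have "S1 M = 0 \<and> S2 M = 0"
  proof -
    assume h: "2 * S2 M = a * S1 M" "2 * S1 M = a * S2 M" "a^2 \<noteq> 4"
    have "(4 - a^2) * S1 M = 2 * (2 * S1 M) - a * (a * S1 M)" by (simp add: algebra_simps power2_eq_square)
    also have "\<dots> = 0" unfolding h(1)[symmetric] h(2) by (simp add: algebra_simps)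
    finally have "S1 M = 0" using h(3) by simp
    then show ?thesis using h(1) by simp
  qed
  then have "(T ^^ M) x = x" using T[of M] by simp
  moreover have "foldr (rfl y) (alt_word v w (2 * k)) x = (T ^^ k) x" for k
    by (induction k) (simp_all add: alt_word_0 alt_word_Suc T_def)
  ultimately show ?thesis by (simp add: M_def)
qed

section \<open>Words acting on vectors: linearity and the invariant form\<close>

lemma act_equiv:
  assumes "(u, u') \<in> ce" shows "act y u x = act y u' x"
proof -
  have "act y u = act y u'"
    using assms
  proof (induction rule: cox_equiv_induct)
    case (step u u')
    then show ?case
    proof (cases rule: cox_step.cases)
      case (sq u0 x v)
      then show ?thesis by (auto simp: wact_def reflect_reflect)
    next
      case (br u0 x v w)
      then show ?thesis by (auto simp: wact_def reflect_braid)
    qed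
  qed
  then show ?thesis by simp
qed

lemma pr_lin: "pr y v (\<lambda>k. x k + c * x' k) = pr y v x + c * pr origin v x'"
  by (simp add: pairing_def algebra_simps sum.distrib sum_distrib_left)

text \<open>For a fixed weight part the action is affine in \<open>x\<close>; its linear part is the
  action with weight part zero.\<close>

lemma act_lin: "act y u (\<lambda>k. x k + c * x' k) = (\<lambda>k. act y u x k + c * act origin u x' k)"
proof (induction u)
  case (Cons v u)
  show ?case unfolding wact_Cons Cons
    by (rule ext) (auto simp: reflect_def pr_lin algebra_simps)
qed simp

lemma act_zero_zero: "act origin u origin = origin"
  by (induction u) (auto simp: wact_Cons reflect_def pairing_def)

lemma act_sum:
  assumes "finite S"
  shows "act y u (\<lambda>k. \<Sum>s\<in>S. c s * simple_root s k) = (\<lambda>k. act y u origin k + (\<Sum>s\<in>S. c s * act origin u (simple_root s) k))"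
  using assms
proof (induction S rule: finite_induct)
  case (insert s S)
  have "(\<lambda>k. \<Sum>s\<in>insert s S. c s * simple_root s k) = (\<lambda>k. (\<Sum>s\<in>S. c s * simple_root s k) + c s * simple_root s k)"
    using insert by (simp add: add.commute)
  then show ?case using act_lin[of y u "\<lambda>k. \<Sum>s\<in>S. c s * simple_root s k" "c s" "simple_root s"] insert
    by (simp add: algebra_simps)
qed simp

lemma simple_root_expand:
  assumes "\<And>k. k \<notin> V \<Longrightarrow> x k = 0"
  shows "x = (\<lambda>k. \<Sum>s\<in>V. x s * simple_root s k)"
proof
  fix k
  have "(\<Sum>s\<in>V. x s * simple_root s k) = (\<Sum>s\<in>V. if s = k then x k else 0)"
    by (rule sum.cong) (auto simp: simple_root_def)
  then show "x k = (\<Sum>s\<in>V. x s * simple_root s k)" using assms finite_V by auto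
qed

lemma act_expand:
  assumes "\<And>k. k \<notin> V \<Longrightarrow> x k = 0"
  shows "act y u x = (\<lambda>k. act y u origin k + (\<Sum>s\<in>V. x s * act origin u (simple_root s) k))"
  using act_sum[OF finite_V, of y u x] simple_root_expand[OF assms] by simp

lemma act_rev: "u \<in> lists V \<Longrightarrow> act y (rev u) (act y u x) = x"
  using act_equiv[OF cox_equiv_rev'] by (simp add: wact_append[symmetric])

text \<open>The invariant symmetric form on vectors \<open>(y, x)\<close>: twice the Tits form on
  roots, the dual pairing between roots and weights, zero on weights.\<close>

definition form :: "('a \<Rightarrow> real) \<Rightarrow> ('a \<Rightarrow> real) \<Rightarrow> ('a \<Rightarrow> real) \<Rightarrow> ('a \<Rightarrow> real) \<Rightarrow> real" where
  "form y x y' x' = (\<Sum>w\<in>V. x w * pr y' w x') + (\<Sum>w\<in>V. y w * x' w)"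

lemma form_sym: "form y x y' x' = form y' x' y x"
proof -
  have "(\<Sum>w\<in>V. \<Sum>u\<in>V. x w * (A w u * x' u)) = (\<Sum>u\<in>V. \<Sum>w\<in>V. x' u * (A u w * x w))"
    by (subst sum.swap) (simp add: cartan_sym[of E m] mult.left_commute mult.commute)
  then show ?thesis
    by (simp add: form_def pairing_def algebra_simps sum.distrib sum_distrib_left)
qed

lemma form_reflect_left:
  assumes "v \<in> V" shows "form y (rfl y v x) y' x' = form y x y' x' - pr y v x * pr y' v x'"
proof -
  have "(\<Sum>w\<in>V. rfl y v x w * pr y' w x') = (\<Sum>w\<in>V. x w * pr y' w x' - (if w = v then pr y v x * pr y' v x' else 0))"
    by (rule sum.cong) (auto simp: reflect_def algebra_simps)
  then show ?thesis using assms finite_V by (simp add: form_def sum_subtractf)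
qed

lemma form_reflect:
  assumes "v \<in> V" shows "form y (rfl y v x) y' (rfl y' v x') = form y x y' x'"
proof -
  have "pr y' v (rfl y' v x') = - pr y' v x'" using pr_reflect[OF assms, of y' v x'] by (simp add: cartan_def)
  moreover have "form y x y' (rfl y' v x') = form y x y' x' - pr y' v x' * pr y v x"
    unfolding form_sym[of y x] by (rule form_reflect_left[OF assms])
  ultimately show ?thesis unfolding form_reflect_left[OF assms] by simp
qed

lemma form_act:
  assumes "u \<in> lists V" shows "form y (act y u x) y' (act y' u x') = form y x y' x'"
  using assms by (induction u rule: list.induct) (auto simp: wact_Cons form_reflect)

text \<open>Both sides are values of \<open>form\<close>: the s-coordinate of u \<omega>_t -
  \<omega>_t is the product of \<omega>_s with u \<omega>_t, and by invariance \<open>u\<close>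
  moves to the other factor as its inverse.\<close>

lemma weight_symmetry:
  assumes "s \<in> V" "t \<in> V" "u \<in> lists V"
  shows "act (simple_root t) u origin s = act (simple_root s) (rev u) origin t"
proof -
  have "form (simple_root s) origin (simple_root t) (act (simple_root t) u origin) = act (simple_root t) u origin s"
  proof -
    have "(\<Sum>w\<in>V. simple_root s w * act (simple_root t) u origin w) = (\<Sum>w\<in>V. if w = s then act (simple_root t) u origin s else 0)"
      by (rule sum.cong) (auto simp: simple_root_def)
    then show ?thesis using assms finite_V by (simp add: form_def)
  qed
  moreover have "form (simple_root s) (act (simple_root s) (rev u) origin) (simple_root t) origin = act (simple_root s) (rev u) origin t"
  proof -
    have "(\<Sum>w\<in>V. act (simple_root s) (rev u) origin w * pr (simple_root t) w origin) = (\<Sum>w\<in>V. if w = t then act (simple_root s) (rev u) origin t else 0)"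
      by (rule sum.cong) (auto simp: simple_root_def pairing_def)
    then show ?thesis using assms finite_V by (simp add: form_def)
  qed
  moreover have "form (simple_root s) origin (simple_root t) (act (simple_root t) u origin)
      = form (simple_root s) (act (simple_root s) (rev u) origin) (simple_root t) origin"
    using form_act[of "rev u" "simple_root s" origin "simple_root t" "act (simple_root t) u origin"] act_rev[OF assms(3)] assms(3) by simp
  ultimately show ?thesis by simp
qed

section \<open>Length, positivity of roots and stabilisers of weights\<close>

definition ell :: "'a list \<Rightarrow> nat" where
  "ell u = (LEAST n. \<exists>u'. (u, u') \<in> ce \<and> length u' = n)"

lemma ell_le: "(u, u') \<in> ce \<Longrightarrow> ell u \<le> length u'"
  unfolding ell_def by (rule Least_le) blast

lemma ell_witness: obtains u' where "(u, u') \<in> ce" "length u' = ell u"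
proof -
  have "\<exists>n u'. (u, u') \<in> ce \<and> length u' = n" using cox_equiv_refl by blast
  from LeastI_ex[OF this] show ?thesis using that unfolding ell_def by blast
qed

text \<open>The relator of length 2m is cut in the middle. The halves are reversed because they are
  needed as suffixes with prescribed last letter.\<close>

lemma alt_word_swap:
  assumes v: "v \<in> V" and w: "w \<in> V" and e: "{v, w} \<in> E"
  shows "(rev (alt_word v w (m {v, w})), rev (alt_word w v (m {v, w}))) \<in> ce"
proof -
  define M where "M = m {v, w}"
  define Z where "Z = (if even M then alt_word v w M else alt_word w v M)"
  have rZ: "rev Z = alt_word w v M" by (simp add: Z_def rev_alt_word)
  have Z: "Z \<in> lists V" and l: "alt_word v w M \<in> lists V" "alt_word w v M \<in> lists V"
    using v w by (auto simp: Z_def alt_word_lists)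
  have "alt_word v w (2 * M) = alt_word v w M @ Z" by (simp add: mult_2 alt_word_add Z_def)
  then have "(alt_word v w M @ Z, []) \<in> ce"
    using cox_equiv_step[OF cox_step.br[of "[]" V "[]" v w E m]] v w e by (simp add: M_def)
  from cox_equiv_context[OF this, of "rev (alt_word v w M)" "rev Z"]
  have "(rev (alt_word v w M) @ alt_word v w M @ Z @ rev Z, rev (alt_word v w M) @ rev Z) \<in> ce"
    using l Z by simp
  moreover have "(rev (alt_word v w M) @ alt_word v w M @ Z @ rev Z, []) \<in> ce"
    using cox_equiv_append[OF cox_equiv_rev'[OF l(1)] cox_equiv_rev[OF Z]] l Z by simp
  ultimately have "(rev (alt_word v w M) @ rev Z, []) \<in> ce"
    using cox_equiv_sym cox_equiv_trans by blast
  from cox_equiv_append[OF this cox_equiv_refl, of Z]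
  have "(rev (alt_word v w M) @ rev Z @ Z, Z) \<in> ce" using Z by simp
  moreover have "(rev (alt_word v w M) @ (rev Z @ Z), rev (alt_word v w M) @ []) \<in> ce"
    using cox_equiv_append[OF cox_equiv_refl cox_equiv_rev'[OF Z]] l Z by simp
  ultimately have "(rev (alt_word v w M), Z) \<in> ce"
    using cox_equiv_sym cox_equiv_trans by (metis append_Nil2)
  moreover have "Z = rev (alt_word w v M)" using rZ by (metis rev_rev_ident)
  ultimately show ?thesis by (simp add: M_def)
qed

text \<open>Each further letter on the left replaces the older of two consecutive Chebyshev values
  by the next one.\<close>

lemma act_alt_word:
  assumes s: "s \<in> V" and t: "t \<in> V" and st: "s \<noteq> t"
  shows "act origin (rev (alt_word t s k)) (simple_root s)
    = (\<lambda>j. if j = (if even k then s else t) then chebyshev (- A s t) 0 1 (Suc k)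
           else if j = (if even k then t else s) then chebyshev (- A s t) 0 1 k else 0)"
proof (induction k)
  case 0
  then show ?case using st by (auto simp: alt_word_0 simple_root_def fun_eq_iff)
next
  case (Suc k)
  define z where "z = act origin (rev (alt_word t s k)) (simple_root s)"
  define r where "r = (if even k then t else s)"
  define r' where "r' = (if even k then s else t)"
  define a where "a = - A s t"
  have rr: "r \<in> V" "r' \<in> V" "r \<noteq> r'" "A r r' = - a" "A r r = 2"
  proof -
    show "r \<in> V" "r' \<in> V" "r \<noteq> r'" using s t st by (auto simp: r_def r'_def)
    show "A r r' = - a" by (simp add: r_def r'_def a_def cartan_sym[of E m t s])
    show "A r r = 2" by (simp add: cartan_def)
  qed
  have z: "z = (\<lambda>j. if j = r' then chebyshev a 0 1 (Suc k) else if j = r then chebyshev a 0 1 k else 0)"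
    unfolding z_def Suc r_def r'_def a_def by simp
  have "(\<Sum>u\<in>V. A r u * z u) = (\<Sum>u\<in>{r, r'}. A r u * z u)"
    using finite_V rr by (intro sum.mono_neutral_right) (auto simp: z)
  then have "pr origin r z = 2 * chebyshev a 0 1 k - a * chebyshev a 0 1 (Suc k)"
    using rr by (simp add: pairing_def z)
  then have "rfl origin r z r = chebyshev a 0 1 (Suc (Suc k))"
    using rr by (simp add: reflect_def z)
  moreover have "rfl origin r z j = z j" if "j \<noteq> r" for j using that by (rule reflect_other)
  moreover have "act origin (rev (alt_word t s (Suc k))) (simple_root s) = rfl origin r z"
    by (simp add: alt_word_snoc wact_Cons z_def r_def)
  ultimately show ?case
    unfolding a_def[symmetric] using rr(3) by (auto simp: fun_eq_iff z r_def r'_def simp del: chebyshev.simps)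
qed

text \<open>For an edge the value is sin(k pi/m)/sin(pi/m), nonnegative up to k = m; without an edge
  it is k.\<close>

lemma chebyshev_nonneg:
  assumes s: "s \<in> V" and t: "t \<in> V" and st: "s \<noteq> t" and k: "{s, t} \<in> E \<Longrightarrow> k \<le> m {s, t}"
  shows "chebyshev (- A s t) 0 1 k \<ge> 0"
proof (cases "{s, t} \<in> E")
  case True
  define \<theta> where "\<theta> = pi / real (m {s, t})"
  have sin: "sin \<theta> > 0" and M: "m {s, t} \<ge> 2"
    using angle[OF s t True] edge[OF s t True] by (auto simp: \<theta>_def)
  have "real k * \<theta> \<le> real (m {s, t}) * \<theta>"
    using k[OF True] angle(1)[OF s t True] by (intro mult_right_mono) (auto simp: \<theta>_def)
  also have "\<dots> = pi" using M by (simp add: \<theta>_def)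
  finally have "sin (real k * \<theta>) \<ge> 0"
    using angle(1)[OF s t True] by (intro sin_ge_zero) (auto simp: \<theta>_def)
  moreover have "chebyshev (2 * cos \<theta>) 0 1 k * sin \<theta> = sin (real k * \<theta>)"
    using chebyshev_sin[of \<theta> 0 1 k] by simp
  ultimately have "chebyshev (2 * cos \<theta>) 0 1 k \<ge> 0" using sin by (metis zero_le_mult_iff not_less)
  then show ?thesis using True st by (simp add: cartan_def \<theta>_def)
next
  case False
  then show ?thesis using st chebyshev_two[of k] by (simp add: cartan_def)
qed

lemma ell_equiv:
  assumes "(u, u') \<in> ce" shows "ell u = ell u'"
proof -
  have "(u, x) \<in> ce \<longleftrightarrow> (u', x) \<in> ce" for x
    using cox_equiv_trans[OF assms] cox_equiv_trans[OF cox_equiv_sym[OF assms]] by blast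
  then show ?thesis by (simp add: ell_def)
qed

text \<open>Tits' argument: split off the longest alternating suffix in \<open>s, t\<close>, where \<open>t\<close> is the last letter
  of \<open>u\<close>. The rest is shorter, and the suffix is a computation in a dihedral group.\<close>
lemma root_nonneg:
  assumes "u \<in> lists V" "length u \<le> ell u" "s \<in> V" "length u \<le> ell (u @ [s])"
  shows "act origin u (simple_root s) j \<ge> 0"
  using assms
proof (induction "length u" arbitrary: u s j rule: less_induct)
  case less
  note u = less.prems(1) and red = less.prems(2) and s = less.prems(3) and up = less.prems(4)
  show ?case
  proof (cases u rule: rev_cases)
    case Nil
    then show ?thesis by (simp add: simple_root_def)
  next
    case (snoc u1 t)
    have u1: "u1 \<in> lists V" and t: "t \<in> V" using u snoc by auto
    have st: "s \<noteq> t"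
    proof
      assume "s = t"
      then have "(u @ [s], u1) \<in> ce"
        using cox_equiv_append[OF cox_equiv_refl cox_equiv_square[OF t, of E m], of u1] u1 t snoc \<open>s = t\<close> by simp
      then show False using ell_le[of "u @ [s]" u1] up snoc by simp
    qed
    define K where "K = {k. \<exists>v\<in>lists V. (u, v @ rev (alt_word t s k)) \<in> ce \<and> length v + k = length u}"
    have "1 \<in> K"
      unfolding K_def using u1 snoc cox_equiv_refl by (auto simp: alt_word_Suc alt_word_0 intro!: bexI[of _ u1])
    moreover have K: "k \<le> length u" if "k \<in> K" for k using that by (auto simp: K_def)
    ultimately obtain k where k: "k \<in> K" "\<And>k'. k' \<in> K \<Longrightarrow> k' \<le> k"
      using Nat.ex_has_greatest_nat[of "\<lambda>k. k \<in> K" 1 "length u"] by blast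
    have k1: "1 \<le> k" using k(2) \<open>1 \<in> K\<close> by blast
    obtain v where v: "v \<in> lists V" "(u, v @ rev (alt_word t s k)) \<in> ce" "length v + k = length u"
      using k(1) unfolding K_def by blast
    have altV: "rev (alt_word t s n) \<in> lists V" for n using s t by (simp add: alt_word_lists)
    have short: "length u \<le> length x" if "(u, x) \<in> ce" for x using ell_le[OF that] red by simp
    have vred: "length v \<le> ell v"
    proof -
      obtain v' where v': "(v, v') \<in> ce" "length v' = ell v" using ell_witness .
      have "(v @ rev (alt_word t s k), v' @ rev (alt_word t s k)) \<in> ce"
        using cox_equiv_context[OF v'(1), of "[]"] altV by simp
      from short[OF cox_equiv_trans[OF v(2) this]] show ?thesis using v' v(3) by (simp add: length_alt_word)
    qed
    \<comment> \<open>\<open>f n\<close> is the letter that prolongs the suffix of length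
      \<open>n\<close> on its left.\<close>
    define f where "f n = (if even n then t else s)" for n :: nat
    have fV: "f n \<in> V" for n using s t by (simp add: f_def)
    have alt: "rev (alt_word t s (Suc n)) = f n # rev (alt_word t s n)" for n
      by (simp add: f_def alt_word_snoc)
    \<comment> \<open>If appending \<open>f n\<close> shortened \<open>v\<close>, then
      \<open>v\<close> could be rewritten to end in \<open>f n\<close>. That letter either prolongs
      the suffix, against the choice of \<open>k\<close>, or cancels its first letter, against
      \<open>u\<close> being reduced.\<close>
    have strip: "length v \<le> ell (v @ [f n])" for n
    proof (rule ccontr)
      assume "\<not> ?thesis"
      moreover obtain v' where v': "(v @ [f n], v') \<in> ce" "length v' = ell (v @ [f n])" using ell_witness .
      ultimately have lv': "length v' < length v" by simp
      have v'V: "v' \<in> lists V" using cox_equiv_lists[OF v'(1)] v(1) fV by simp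
      have "(v @ [f n, f n], v) \<in> ce"
        using cox_equiv_append[OF cox_equiv_refl cox_equiv_square[OF fV[of n], of E m], of v] v(1) fV by simp
      moreover have "(v @ [f n, f n], v' @ [f n]) \<in> ce"
        using cox_equiv_append[OF v'(1) cox_equiv_refl, of "[f n]"] v'V fV by simp
      ultimately have vv': "(v, v' @ [f n]) \<in> ce" using cox_equiv_sym cox_equiv_trans by blast
      have e: "(u, v' @ [f n] @ rev (alt_word t s k)) \<in> ce"
        using cox_equiv_trans[OF v(2)] cox_equiv_context[OF vv', of "[]" "rev (alt_word t s k)"] altV by simp
      show False
      proof (cases "f n = f k")
        case True
        then have e': "(u, v' @ rev (alt_word t s (Suc k))) \<in> ce" using e unfolding alt by simp
        from short[OF this] have "length v' + Suc k = length u" using lv' v(3) by (simp add: length_alt_word)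
        then have "Suc k \<in> K" unfolding K_def using e' v'V by blast
        then show False using k(2)[of "Suc k"] by simp
      next
        case False
        obtain k' where k': "k = Suc k'" using k1 by (cases k) auto
        then have "f n = f k'" using False by (auto simp: f_def split: if_splits)
        then have "(u, v' @ [f n, f n] @ rev (alt_word t s k')) \<in> ce" using e unfolding k' alt by simp
        moreover have "(v' @ [f n, f n] @ rev (alt_word t s k'), v' @ [] @ rev (alt_word t s k')) \<in> ce"
          using cox_equiv_context[OF cox_equiv_square[OF fV[of n], of E m] v'V altV] .
        ultimately have "(u, v' @ rev (alt_word t s k')) \<in> ce" using cox_equiv_trans by fastforce
        from short[OF this] show False using lv' v(3) k' by (simp add: length_alt_word)
      qed
    qed
    \<comment> \<open>A suffix of length m could be replaced by the alternating word ending in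
      \<open>s\<close>, and then \<open>u @ [s]\<close> would be too short.\<close>
    have k_lt: "Suc k \<le> m {s, t}" if st_edge: "{s, t} \<in> E"
    proof (rule ccontr)
      assume long: "\<not> Suc k \<le> m {s, t}"
      define M where "M = m {s, t}"
      have M: "M \<le> k" "2 \<le> M" using long edge[OF s t st_edge] by (auto simp: M_def)
      have "alt_word t s k = alt_word t s M @ (if even M then alt_word t s (k - M) else alt_word s t (k - M))"
        using alt_word_add[of t s M "k - M"] M by simp
      then obtain w1 where w1: "rev (alt_word t s k) = w1 @ rev (alt_word t s M)" "w1 \<in> lists V" "length w1 = k - M"
        using s t by (auto simp: alt_word_lists length_alt_word)
      obtain M' where M': "M = Suc M'" using M by (cases M) auto
      have w2: "rev (alt_word s t M) = rev (alt_word t s M') @ [s]" unfolding M' alt_word_Suc by simp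
      have sw: "(rev (alt_word t s M), rev (alt_word s t M)) \<in> ce"
        using alt_word_swap[OF t s] st_edge by (simp add: M_def insert_commute)
      have "(v @ w1 @ rev (alt_word t s M), v @ w1 @ rev (alt_word s t M)) \<in> ce"
        using cox_equiv_context[OF sw, of "v @ w1" "[]"] v(1) w1(2) by simp
      then have uw: "(u, v @ w1 @ rev (alt_word t s M') @ [s]) \<in> ce"
        using cox_equiv_trans[OF v(2)] unfolding w1(1) w2 by simp
      have "(u @ [s], (v @ w1 @ rev (alt_word t s M')) @ [s, s]) \<in> ce"
        using cox_equiv_context[OF uw, of "[]" "[s]"] s by simp
      moreover have "((v @ w1 @ rev (alt_word t s M')) @ [s, s], v @ w1 @ rev (alt_word t s M')) \<in> ce"
        using cox_equiv_append[OF cox_equiv_refl cox_equiv_square[OF s, of E m], of "v @ w1 @ rev (alt_word t s M')"]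
          v(1) w1(2) altV s by simp
      ultimately have "(u @ [s], v @ w1 @ rev (alt_word t s M')) \<in> ce" by (rule cox_equiv_trans)
      from ell_le[OF this] up show False using v(3) w1(3) M M' by (simp add: length_alt_word)
    qed
    have lt: "length v < length u" using v(3) k1 by simp
    have pos: "act origin v (simple_root (f n)) j \<ge> 0" for n
      by (rule less.hyps[OF lt v(1) vred fV strip])
    have pos': "act origin v (simple_root s) j \<ge> 0" "act origin v (simple_root t) j \<ge> 0"
      using pos[of 1] pos[of 0] by (simp_all add: f_def)
    define cs where "cs = act origin (rev (alt_word t s k)) (simple_root s) s"
    define ct where "ct = act origin (rev (alt_word t s k)) (simple_root s) t"
    have nn: "chebyshev (- A s t) 0 1 n \<ge> 0" if "n \<le> Suc k" for n
      by (rule chebyshev_nonneg[OF s t st]) (use k_lt that in fastforce)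
    have nn: "chebyshev (- A s t) 0 1 (Suc k) \<ge> 0" "chebyshev (- A s t) 0 1 k \<ge> 0"
      using nn[of "Suc k"] nn[of k] by simp_all
    have c0: "cs \<ge> 0" "ct \<ge> 0" unfolding cs_def ct_def act_alt_word[OF s t st] using nn st by auto
    have "act origin (rev (alt_word t s k)) (simple_root s) = (\<lambda>j. cs * simple_root s j + ct * simple_root t j)"
      unfolding cs_def ct_def act_alt_word[OF s t st] using st by (auto simp: fun_eq_iff simple_root_def)
    then have "act origin u (simple_root s) = act origin v (\<lambda>j. cs * simple_root s j + ct * simple_root t j)"
      using act_equiv[OF v(2)] by (simp add: wact_append)
    also have "\<dots> = (\<lambda>j. cs * act origin v (simple_root s) j + ct * act origin v (simple_root t) j)"
      using act_lin[of origin v "\<lambda>j. cs * simple_root s j" ct "simple_root t"] act_lin[of origin v origin cs "simple_root s"]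
      by (simp add: act_zero_zero)
    finally show ?thesis using c0 pos' by simp
  qed
qed

lemma act_nonzero:
  assumes "u \<in> lists V" shows "act origin u (simple_root s) \<noteq> origin"
proof
  assume "act origin u (simple_root s) = origin"
  then have "simple_root s = origin" using act_rev[OF assms, of origin "simple_root s"] act_zero_zero by simp
  from fun_cong[OF this, of s] show False by (simp add: simple_root_def)
qed

lemma act_weight_snoc:
  "act (simple_root t) (u @ [s]) origin = (if s = t then (\<lambda>k. act (simple_root t) u origin k - act origin u (simple_root t) k) else act (simple_root t) u origin)"
proof -
  have "rfl (simple_root t) s origin = (if s = t then (\<lambda>k. 0 + (- 1) * simple_root t k) else origin)"
    by (auto simp: reflect_def pairing_def simple_root_def fun_eq_iff)
  then show ?thesis using act_lin[of "simple_root t" u origin "- 1" "simple_root t"] by (simp add: wact_append wact_Cons)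
qed

lemma reduced_snoc:
  assumes "u \<in> lists V" "s \<in> V" "length (u @ [s]) \<le> ell (u @ [s])"
  shows "length u \<le> ell u" "length u \<le> ell (u @ [s])"
proof -
  obtain u' where u': "(u, u') \<in> ce" "length u' = ell u" using ell_witness .
  have "(u @ [s], u' @ [s]) \<in> ce" using cox_equiv_context[OF u'(1), of "[]" "[s]"] assms by simp
  from ell_le[OF this] show "length u \<le> ell u" using assms(3) u' by simp
qed (use assms in simp)

text \<open>Along a reduced word each letter \<open>t\<close> subtracts a root that is nonnegative
  by \<open>root_nonneg\<close>; the other letters change nothing.\<close>

lemma weight_nonpos:
  assumes "u \<in> lists V" "length u \<le> ell u" "t \<in> V"
  shows "act (simple_root t) u origin j \<le> 0"
  using assms
proof (induction u arbitrary: j rule: rev_induct)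
  case (snoc s u)
  note r = reduced_snoc[of u s]
  have u: "u \<in> lists V" "s \<in> V" using snoc.prems by auto
  have "act origin u (simple_root s) j \<ge> 0" using root_nonneg[OF u(1) _ u(2)] r[OF u snoc.prems(2)] by blast
  then show ?case using snoc.IH[OF u(1) r(1)[OF u snoc.prems(2)] snoc.prems(3), of j] unfolding act_weight_snoc by auto
qed simp

text \<open>If \<omega>_t were fixed, the nonnegative root u e_t would equal the nonpositive vector
  u \<omega>_t - \<omega>_t, so both would vanish.\<close>

lemma weight_moved:
  assumes "u \<in> lists V" "t \<in> V" "length (u @ [t]) \<le> ell (u @ [t])"
  shows "act (simple_root t) (u @ [t]) origin \<noteq> origin"
proof
  assume z: "act (simple_root t) (u @ [t]) origin = origin"
  note r = reduced_snoc[OF assms]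
  have "act origin u (simple_root t) j = 0" for j
  proof -
    have "act origin u (simple_root t) j = act (simple_root t) u origin j"
      using fun_cong[OF z, of j] unfolding act_weight_snoc by simp
    then show ?thesis
      using weight_nonpos[OF assms(1) r(1) assms(2), of j] root_nonneg[OF assms(1) r(1) assms(2) r(2), of j] by simp
  qed
  then show False using act_nonzero[OF assms(1)] by blast
qed

lemma faithful:
  assumes u: "u \<in> lists V" and z: "\<And>t. t \<in> V \<Longrightarrow> act (simple_root t) u origin = origin"
  shows "(u, []) \<in> ce"
proof -
  obtain u' where u': "(u, u') \<in> ce" "length u' = ell u" using ell_witness .
  have u'V: "u' \<in> lists V" using cox_equiv_lists[OF u'(1)] u by blast
  have red: "length u' \<le> ell u'" using u' ell_equiv by simp
  show ?thesis
  proof (cases u' rule: rev_cases)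
    case (snoc u1 t)
    then show ?thesis using weight_moved[of u1 t] z[of t] act_equiv[OF u'(1)] u'V red by simp
  qed (use u' in simp)
qed

lemma weight_fixed_word: "z \<in> lists (V - {t}) \<Longrightarrow> act (simple_root t) z origin = origin"
proof (induction z rule: rev_induct)
  case (snoc s z)
  then show ?case unfolding act_weight_snoc by auto
qed simp

text \<open>Move as many letters as possible into a tail \<open>z\<close> avoiding \<open>t\<close>.
  A nonempty remaining head is reduced and ends in \<open>t\<close>, so it moves \<omega>_t by
  \<open>weight_moved\<close>.\<close>

lemma weight_stabilizer:
  assumes u: "u \<in> lists V" and t: "t \<in> V" and z: "act (simple_root t) u origin = origin"
  shows "\<exists>u'\<in>lists (V - {t}). (u, u') \<in> ce"
proof -
  define P where "P n \<longleftrightarrow> (\<exists>x\<in>lists V. \<exists>z\<in>lists (V - {t}). (u, x @ z) \<in> ce \<and> length x = n)" for n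
  have "P (length u)" unfolding P_def using u cox_equiv_refl by (metis append_Nil2 lists.Nil)
  then obtain n where n: "P n" "\<And>k. k < n \<Longrightarrow> \<not> P k" by (meson exists_least_iff)
  obtain x z where x: "x \<in> lists V" "z \<in> lists (V - {t})" "(u, x @ z) \<in> ce" "length x = n"
    using n(1) unfolding P_def by blast
  have zV: "z \<in> lists V" using x(2) by (auto simp: lists_eq_set)
  have red: "length x \<le> ell x"
  proof (rule ccontr)
    assume "\<not> ?thesis"
    moreover obtain x' where x': "(x, x') \<in> ce" "length x' = ell x" using ell_witness .
    moreover have "(u, x' @ z) \<in> ce"
      using cox_equiv_trans[OF x(3)] cox_equiv_context[OF x'(1), of "[]" z] zV by simp
    ultimately show False using n(2)[of "length x'"] x cox_equiv_lists[OF x'(1)] unfolding P_def by auto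
  qed
  show ?thesis
  proof (cases x rule: rev_cases)
    case Nil
    then show ?thesis using x by auto
  next
    case (snoc x1 l)
    have l: "l \<in> V" "x1 \<in> lists V" using x(1) snoc by auto
    have "l = t"
    proof (rule ccontr)
      assume "l \<noteq> t"
      then have "P (length x1)" unfolding P_def using x l snoc
        by (intro bexI[of _ x1] bexI[of _ "l # z"]) auto
      then show False using n(2)[of "length x1"] x(4) snoc by simp
    qed
    then have "act (simple_root t) (x1 @ [t]) origin = origin"
      using z act_equiv[OF x(3), of "simple_root t" origin] weight_fixed_word[OF x(2)] snoc
      by (simp only: wact_append)
    then show ?thesis using weight_moved[of x1 t] l red snoc \<open>l = t\<close> by simp
  qed
qed

text \<open>The hypothesis says that \<omega>_s is orthogonal to w \<omega>_t. A nontrivial shortest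
  representative \<open>x\<close> of the double coset ends in \<open>t\<close>; let \<beta> be the
  nonnegative root subtracted by this last letter. Its s-coordinate is 0, and by minimality the
  inverse of \<open>x\<close> sends every e_k with k \<noteq> s to a nonnegative vector, hence also
  \<beta>. But it sends \<beta> to -e_t.\<close>

lemma double_coset:
  assumes w: "w \<in> lists V" and s: "s \<in> V" and t: "t \<in> V" and z: "act (simple_root t) w origin s = 0"
  shows "\<exists>w1\<in>lists (V - {s}). \<exists>w2\<in>lists (V - {t}). (w, w1 @ w2) \<in> ce"
proof -
  define P where "P n \<longleftrightarrow> (\<exists>x\<in>lists V. \<exists>w1\<in>lists (V - {s}). \<exists>w2\<in>lists (V - {t}).
    (w, w1 @ x @ w2) \<in> ce \<and> length x = n)" for n
  have "P (length w)" unfolding P_def using w cox_equiv_refl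
    by (intro bexI[of _ w] bexI[of _ "[]"]) auto
  then obtain n where n: "P n" "\<And>k. k < n \<Longrightarrow> \<not> P k" by (meson exists_least_iff)
  obtain x w1 w2 where x: "x \<in> lists V" "w1 \<in> lists (V - {s})" "w2 \<in> lists (V - {t})"
    "(w, w1 @ x @ w2) \<in> ce" "length x = n"
    using n(1) unfolding P_def by blast
  have wV: "w1 \<in> lists V" "w2 \<in> lists V" using x(2,3) by (auto simp: lists_eq_set)
  have short: "length x \<le> length x'" if "(x, x') \<in> ce" for x'
  proof (rule ccontr)
    assume "\<not> ?thesis"
    moreover have "(w, w1 @ x' @ w2) \<in> ce"
      using cox_equiv_trans[OF x(4) cox_equiv_context[OF that wV]] .
    ultimately show False using n(2)[of "length x'"] x cox_equiv_lists[OF that] unfolding P_def by auto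
  qed
  have red: "length x \<le> ell x"
    using short ell_witness[of x] by metis
  show ?thesis
  proof (cases x rule: rev_cases)
    case Nil
    then show ?thesis using x by auto
  next
    case (snoc x1 l)
    have l: "l \<in> V" "x1 \<in> lists V" using x(1) snoc by auto
    have "l = t"
    proof (rule ccontr)
      assume "l \<noteq> t"
      then have "P (length x1)" unfolding P_def using x l snoc
        by (intro bexI[of _ x1] bexI[of _ w1] bexI[of _ "l # w2"]) auto
      then show False using n(2)[of "length x1"] x(5) snoc by simp
    qed
    then have xt: "x = x1 @ [t]" using snoc by simp
    note r = reduced_snoc[OF l(2) t red[unfolded xt]]
    define \<beta> where "\<beta> = act origin x1 (simple_root t)"
    have \<beta>0: "\<beta> k \<ge> 0" for k unfolding \<beta>_def by (rule root_nonneg[OF l(2) r(1) t r(2)])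
    \<comment> \<open>A head avoiding \<open>s\<close> leaves the s-coordinate alone and a tail
      avoiding \<open>t\<close> fixes \<omega>_t, so \<open>x\<close> inherits the hypothesis on
      \<open>w\<close>.\<close>
    have "s \<notin> set w1" using x(2) by (auto simp: lists_eq_set)
    then have "act (simple_root t) x origin s = 0"
      using z act_equiv[OF x(4)] weight_fixed_word[OF x(3)] by (simp add: wact_append wact_other)
    then have "\<beta> s = act (simple_root t) x1 origin s" unfolding xt act_weight_snoc \<beta>_def by simp
    then have \<beta>s: "\<beta> s = 0" using \<beta>0[of s] weight_nonpos[OF l(2) r(1) t, of s] by simp
    have \<beta>V: "\<beta> k = 0" if "k \<notin> V" for k
    proof -
      have "k \<notin> set x1" using l(2) that by (auto simp: lists_eq_set)
      then show ?thesis unfolding \<beta>_def using that t by (auto simp: wact_other simple_root_def)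
    qed
    have up: "act origin (rev x) (simple_root k) j \<ge> 0" if k: "k \<in> V" "k \<noteq> s" for k j
    proof (rule root_nonneg)
      have rv: "length x \<le> length y" if "(rev x, y) \<in> ce" for y
      proof -
        have "(x, rev y) \<in> ce" using cox_equiv_rev_cong[OF that] by simp
        from short[OF this] show ?thesis by simp
      qed
      show "length (rev x) \<le> ell (rev x)" using rv ell_witness[of "rev x"] by (metis length_rev)
      show "length (rev x) \<le> ell (rev x @ [k])"
      proof -
        obtain y where y: "(rev x @ [k], y) \<in> ce" "length y = ell (rev x @ [k])" using ell_witness .
        have yV: "y \<in> lists V" using cox_equiv_lists[OF y(1)] x(1) k by simp
        show ?thesis
        proof (rule ccontr)
          assume "\<not> ?thesis"
          then have ly: "length y < length x" using y by simp
          have "(rev x @ [k, k], y @ [k]) \<in> ce"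
            using cox_equiv_context[OF y(1), of "[]" "[k]"] k by simp
          moreover have "(rev x @ [k, k], rev x) \<in> ce"
            using cox_equiv_context[OF cox_equiv_square[OF k(1)], of "rev x" "[]"] x(1) by simp
          ultimately have "(rev x, y @ [k]) \<in> ce" using cox_equiv_sym cox_equiv_trans by metis
          then have "(x, k # rev y) \<in> ce" using cox_equiv_rev_cong by fastforce
          from cox_equiv_context[OF this wV]
          have "(w1 @ x @ w2, w1 @ (k # rev y) @ w2) \<in> ce" .
          then have "(w, (w1 @ [k]) @ rev y @ w2) \<in> ce" using cox_equiv_trans[OF x(4)] by simp
          then have "P (length y)" unfolding P_def using x(2,3) k yV
            by (intro bexI[of _ "rev y"] bexI[of _ "w1 @ [k]"] bexI[of _ w2]) auto
          then show False using n(2)[of "length y"] ly x(5) by simp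
        qed
      qed
    qed (use x(1) k in auto)
    have "act origin (rev x) \<beta> = rfl origin t (simple_root t)"
      unfolding xt \<beta>_def using act_rev[OF l(2), of origin "simple_root t"] by (simp add: wact_Cons)
    moreover have "rfl origin t (simple_root t) t = - 1"
    proof -
      have "(\<Sum>u\<in>V. A t u * simple_root t u) = (\<Sum>u\<in>V. if u = t then 2 else 0)"
        by (rule sum.cong) (auto simp: simple_root_def cartan_def)
      then show ?thesis using t finite_V by (simp add: reflect_def pairing_def) (simp add: simple_root_def)
    qed
    moreover have "act origin (rev x) \<beta> t = (\<Sum>k\<in>V. \<beta> k * act origin (rev x) (simple_root k) t)"
      using act_expand[OF \<beta>V, where y = origin and u = "rev x"] by (simp add: act_zero_zero)
    moreover have "(\<Sum>k\<in>V. \<beta> k * act origin (rev x) (simple_root k) t) \<ge> 0"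
      using up \<beta>0 \<beta>s by (intro sum_nonneg) (metis mult_nonneg_nonneg mult_zero_left order_refl)
    ultimately have False by simp
    then show ?thesis ..
  qed
qed

end

section \<open>Reduction of the geometric representation modulo an integer\<close>

definition zspan :: "real set \<Rightarrow> real set" where
  "zspan B = range (\<lambda>c :: real \<Rightarrow> int. \<Sum>g\<in>B. of_int (c g) * g)"

lemma zspanI: "(\<Sum>g\<in>B. of_int (c g) * g) \<in> zspan B" for c :: "real \<Rightarrow> int"
  unfolding zspan_def by blast

lemma zspan_add: "r \<in> zspan B \<Longrightarrow> s \<in> zspan B \<Longrightarrow> r + s \<in> zspan B"
proof -
  assume "r \<in> zspan B" "s \<in> zspan B"
  then obtain c d :: "real \<Rightarrow> int" where "r = (\<Sum>g\<in>B. of_int (c g) * g)" "s = (\<Sum>g\<in>B. of_int (d g) * g)"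
    unfolding zspan_def by blast
  then have "r + s = (\<Sum>g\<in>B. of_int (c g + d g) * g)"
    by (simp add: sum.distrib algebra_simps)
  then show "r + s \<in> zspan B" using zspanI[of "\<lambda>g. c g + d g"] by simp
qed

lemma zspan_int_mult: "r \<in> zspan B \<Longrightarrow> of_int k * r \<in> zspan B"
proof -
  assume "r \<in> zspan B"
  then obtain c :: "real \<Rightarrow> int" where "r = (\<Sum>g\<in>B. of_int (c g) * g)"
    unfolding zspan_def by blast
  then have "of_int k * r = (\<Sum>g\<in>B. of_int (k * c g) * g)"
    by (simp add: sum_distrib_left algebra_simps)
  then show "of_int k * r \<in> zspan B" using zspanI[of "\<lambda>g. k * c g"] by simp
qed

lemma zspan_zero: "0 \<in> zspan B"
  using zspanI[of "\<lambda>_. 0" B] by simp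

lemma zspan_neg: "r \<in> zspan B \<Longrightarrow> - r \<in> zspan B"
  using zspan_int_mult[of r B "- 1"] by simp

lemma zspan_diff: "r \<in> zspan B \<Longrightarrow> s \<in> zspan B \<Longrightarrow> r - s \<in> zspan B"
  using zspan_add[of r B "- s"] zspan_neg by simp

lemma zspan_sum: "(\<And>i. i \<in> I \<Longrightarrow> f i \<in> zspan B) \<Longrightarrow> (\<Sum>i\<in>I. f i) \<in> zspan B"
  by (induction I rule: infinite_finite_induct) (auto simp: zspan_zero zspan_add)

lemma zspan_gen: "finite B \<Longrightarrow> g \<in> B \<Longrightarrow> g \<in> zspan B"
  using zspanI[of "\<lambda>h. if h = g then 1 else 0" B]
  by (simp add: if_distrib[of of_int] if_distrib[of "\<lambda>x. x * _"] cong: if_cong)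

lemma zspan_mult:
  assumes "r \<in> zspan B" "\<And>g. g \<in> B \<Longrightarrow> a * g \<in> zspan B"
  shows "a * r \<in> zspan B"
proof -
  obtain c :: "real \<Rightarrow> int" where "r = (\<Sum>g\<in>B. of_int (c g) * g)"
    using assms(1) unfolding zspan_def by blast
  then have "a * r = (\<Sum>g\<in>B. of_int (c g) * (a * g))"
    by (simp add: sum_distrib_left algebra_simps)
  then show ?thesis using assms(2) zspan_int_mult by (auto intro!: zspan_sum)
qed

definition nspan :: "real set \<Rightarrow> int \<Rightarrow> real set" where
  "nspan B n = (\<lambda>r. of_int n * r) ` zspan B"

lemma nspan_zero: "0 \<in> nspan B n"
  unfolding nspan_def using zspan_zero[of B] by force

lemma nspan_add: "r \<in> nspan B n \<Longrightarrow> s \<in> nspan B n \<Longrightarrow> r + s \<in> nspan B n"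
  unfolding nspan_def using zspan_add[of _ B] by (auto simp: distrib_left[symmetric])

lemma nspan_neg: "r \<in> nspan B n \<Longrightarrow> - r \<in> nspan B n"
  unfolding nspan_def using zspan_neg[of _ B] by (auto simp: image_iff intro!: bexI[of _ "- _"])

lemma nspan_diff: "r \<in> nspan B n \<Longrightarrow> s \<in> nspan B n \<Longrightarrow> r - s \<in> nspan B n"
  using nspan_add[of r B n "- s"] nspan_neg by simp

lemma nspan_sum: "(\<And>i. i \<in> I \<Longrightarrow> f i \<in> nspan B n) \<Longrightarrow> (\<Sum>i\<in>I. f i) \<in> nspan B n"
  by (induction I rule: infinite_finite_induct) (auto simp: nspan_zero nspan_add)

lemma nspan_mult:
  assumes "r \<in> nspan B n" "\<And>s. s \<in> zspan B \<Longrightarrow> a * s \<in> zspan B"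
  shows "a * r \<in> nspan B n"
  using assms unfolding nspan_def by (auto simp: mult.left_commute)

lemma nspan_dvd: "k dvd n \<Longrightarrow> nspan B n \<subseteq> nspan B k"
  unfolding nspan_def using zspan_int_mult[of _ B] by (auto simp: mult.assoc elim!: dvdE)

text \<open>A \<open>\<rat>\<close>-linear functional on \<open>\<real>\<close> that does not vanish at \<open>r\<close> takes values with bounded
  denominators on a finitely generated subgroup.\<close>
lemma rational_functional:
  assumes "(r::real) \<noteq> 0"
  obtains f :: "real \<Rightarrow> rat" where "\<And>x y. f (x + y) = f x + f y"
    "\<And>k x. f (of_int k * x) = of_int k * f x" "f r \<noteq> 0"
proof -
  interpret V: vector_space "\<lambda>(q::rat) (x::real). of_rat q * x"
    by unfold_locales (auto simp: algebra_simps of_rat_add of_rat_mult)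
  interpret Q: vector_space "\<lambda>(q::rat) (x::rat). q * x"
    by unfold_locales (auto simp: algebra_simps)
  interpret P: vector_space_pair "\<lambda>(q::rat) (x::real). of_rat q * x" "\<lambda>(q::rat) (x::rat). q * x" ..
  have "V.independent {r}" using assms by simp
  from P.linear_independent_extend[OF this, of "\<lambda>_. 1"]
  obtain g where g: "Vector_Spaces.linear (\<lambda>(q::rat) (x::real). of_rat q * x) (\<lambda>(q::rat) (x::rat). q * x) g" "g r = 1"
    by auto
  interpret Vector_Spaces.linear "\<lambda>(q::rat) (x::real). of_rat q * x" "\<lambda>(q::rat) (x::rat). q * x" g by (rule g)
  show ?thesis
  proof (rule that[of g])
    show "g (x + y) = g x + g y" for x y by (rule add)
    show "g (of_int k * x) = of_int k * g x" for k x using scale[of "of_int k" x] by simp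
  qed (use g in simp)
qed

text \<open>After multiplication by some \<open>d\<close>, a functional that is nonzero at
  \<open>r\<close> is integral on the span and at \<open>r\<close>. If \<open>r\<close> were n times
  an element of the span, n would divide the nonzero integer d f(r).\<close>

lemma zspan_separate_one:
  assumes B: "finite B" and r: "r \<noteq> 0"
  shows "\<exists>n>0. r \<notin> nspan B n"
proof -
  obtain f :: "real \<Rightarrow> rat" where f: "\<And>x y. f (x + y) = f x + f y"
    "\<And>k x. f (of_int k * x) = of_int k * f x" "f r \<noteq> 0"
    using rational_functional[OF r] by blast
  have f0: "f 0 = 0" using f(1)[of 0 0] by simp
  have den: "\<exists>d::int. d > 0 \<and> (\<forall>g\<in>S. of_int d * f g \<in> \<int>)" if "finite S" for S
    using that
  proof (induction S rule: finite_induct)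
    case empty
    show ?case by (intro exI[of _ 1]) simp
  next
    case (insert g S)
    then obtain d :: int where d: "d > 0" "\<forall>g\<in>S. of_int d * f g \<in> \<int>" by blast
    obtain a b :: int where ab: "f g = of_int a / of_int b" "b > 0"
      by (metis Fract_of_int_quotient quotient_of_denom_pos' quotient_of_div surj_pair quotient_of_denom_pos)
    have "of_int (d * b) * f h \<in> \<int>" if "h \<in> insert g S" for h
    proof (cases "h = g")
      case True
      then have "of_int (d * b) * f h = of_int (d * a)" using ab by simp
      then show ?thesis by (simp only: Ints_of_int)
    next
      case False
      then have "of_int d * f h \<in> \<int>" using that d(2) by blast
      then have "of_int b * (of_int d * f h) \<in> \<int>" by (rule Ints_mult[OF Ints_of_int])
      moreover have "of_int (d * b) * f h = of_int b * (of_int d * f h)" by simp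
      ultimately show ?thesis by (simp only:)
    qed
    then show ?case using d(1) ab(2) by (intro exI[of _ "d * b"]) auto
  qed
  obtain d :: int where d: "d > 0" "\<And>g. g \<in> insert r B \<Longrightarrow> of_int d * f g \<in> \<int>"
    using den[of "insert r B"] B by blast
  have fs: "of_int d * f s \<in> \<int>" if "s \<in> zspan B" for s
  proof -
    from that obtain c :: "real \<Rightarrow> int" where s: "s = (\<Sum>g\<in>B. of_int (c g) * g)" unfolding zspan_def by blast
    have sum: "f (\<Sum>g\<in>S. h g) = (\<Sum>g\<in>S. f (h g))" if "finite S" for S and h :: "real \<Rightarrow> real"
      using that by (induction S rule: finite_induct) (auto simp: f0 f(1))
    have "of_int d * f s = (\<Sum>g\<in>B. of_int (c g) * (of_int d * f g))"
      unfolding s sum[OF B] f(2) by (simp add: sum_distrib_left mult.left_commute)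
    moreover have "(\<Sum>g\<in>B. of_int (c g) * (of_int d * f g)) \<in> \<int>"
      by (rule Ints_sum, rule Ints_mult[OF Ints_of_int]) (use d(2) in blast)
    ultimately show ?thesis by simp
  qed
  obtain a where a: "of_int d * f r = of_int a" using d(2)[of r] by (auto elim: Ints_cases)
  have a0: "a \<noteq> 0" using a f(3) d(1) by auto
  define n where "n = \<bar>a\<bar> + 1"
  have "r \<notin> nspan B n"
  proof
    assume "r \<in> nspan B n"
    then obtain s where s: "s \<in> zspan B" "r = of_int n * s" unfolding nspan_def by blast
    obtain b where b: "of_int d * f s = of_int b" using fs[OF s(1)] by (auto elim: Ints_cases)
    have "(of_int a :: rat) = of_int n * (of_int d * f s)" unfolding a[symmetric] s(2) f(2) by simp
    then have "a = n * b" unfolding b by (metis of_int_eq_iff of_int_mult)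
    then have "n dvd a" by simp
    then show False using a0 dvd_imp_le_int[of a n] by (simp add: n_def)
  qed
  then show ?thesis by (intro exI[of _ n]) (auto simp: n_def)
qed

text \<open>The product of the moduli for the single numbers works, since \<open>nspan\<close>
  shrinks along divisibility.\<close>

lemma zspan_separate:
  assumes B: "finite B" and F: "finite F"
  obtains n where "n > 0" "\<And>r. r \<in> F \<Longrightarrow> r \<in> nspan B n \<Longrightarrow> r = 0"
proof -
  have "\<exists>n>0. \<forall>r\<in>F. r \<in> nspan B n \<longrightarrow> r = 0"
    using F
  proof (induction F rule: finite_induct)
    case empty
    show ?case by (intro exI[of _ 1]) simp
  next
    case (insert r F)
    then obtain n where n: "n > 0" "\<forall>r\<in>F. r \<in> nspan B n \<longrightarrow> r = 0" by blast
    obtain k where k: "k > 0" "r \<in> nspan B k \<longrightarrow> r = 0"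
    proof (cases "r = 0")
      case True
      then show ?thesis using that[of 1] by simp
    next
      case False
      then show ?thesis using zspan_separate_one[OF B] that by blast
    qed
    have "nspan B (n * k) \<subseteq> nspan B n" "nspan B (n * k) \<subseteq> nspan B k" by (auto intro!: nspan_dvd)
    then show ?case using n k by (intro exI[of _ "n * k"]) auto
  qed
  then show ?thesis using that by blast
qed

lemma finite_zspan_mod:
  assumes B: "finite B" and n: "n > 0"
  shows "finite ((\<lambda>r. {s \<in> zspan B. r - s \<in> nspan B n}) ` zspan B)"
proof -
  define R where "R = (\<lambda>c :: real \<Rightarrow> int. \<Sum>g\<in>B. of_int (c g) * g) ` (B \<rightarrow>\<^sub>E {0..<n})"
  have "finite R" unfolding R_def using B by (intro finite_imageI finite_PiE) auto
  moreover have "(\<lambda>r. {s \<in> zspan B. r - s \<in> nspan B n}) ` zspan B \<subseteq> (\<lambda>r. {s \<in> zspan B. r - s \<in> nspan B n}) ` R"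
  proof
    fix C assume "C \<in> (\<lambda>r. {s \<in> zspan B. r - s \<in> nspan B n}) ` zspan B"
    then obtain c :: "real \<Rightarrow> int" where C: "C = {s \<in> zspan B. (\<Sum>g\<in>B. of_int (c g) * g) - s \<in> nspan B n}"
      unfolding zspan_def by blast
    define c' where "c' = restrict (\<lambda>g. c g mod n) B"
    have "(\<Sum>g\<in>B. of_int (c g) * g) - (\<Sum>g\<in>B. of_int (c' g) * g) = (\<Sum>g\<in>B. (of_int (c g) - of_int (c' g)) * g)"
      by (simp add: sum_subtractf algebra_simps)
    also have "\<dots> = (\<Sum>g\<in>B. of_int n * (of_int (c g div n) * g))"
    proof (rule sum.cong[OF refl])
      fix g assume "g \<in> B"
      have "c g - c g mod n = n * (c g div n)" by (simp add: minus_mod_eq_mult_div)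
      then have "(of_int (c g) - of_int (c g mod n) :: real) = of_int n * of_int (c g div n)"
        by (metis of_int_diff of_int_mult)
      then show "(of_int (c g) - of_int (c' g)) * g = of_int n * (of_int (c g div n) * g)"
        using \<open>g \<in> B\<close> by (simp add: c'_def)
    qed
    also have "\<dots> = of_int n * (\<Sum>g\<in>B. of_int (c g div n) * g)" by (simp add: sum_distrib_left)
    finally have d: "(\<Sum>g\<in>B. of_int (c g) * g) - (\<Sum>g\<in>B. of_int (c' g) * g) \<in> nspan B n"
      unfolding nspan_def using zspanI[of "\<lambda>g. c g div n" B] by blast
    have "(\<Sum>g\<in>B. of_int (c g) * g) - s \<in> nspan B n \<longleftrightarrow> (\<Sum>g\<in>B. of_int (c' g) * g) - s \<in> nspan B n" for s
      using nspan_add[OF d, of "(\<Sum>g\<in>B. of_int (c' g) * g) - s"]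
        nspan_diff[OF _ d, of "(\<Sum>g\<in>B. of_int (c g) * g) - s"] by (auto simp: algebra_simps)
    then have "C = {s \<in> zspan B. (\<Sum>g\<in>B. of_int (c' g) * g) - s \<in> nspan B n}" unfolding C by simp
    moreover have "(\<Sum>g\<in>B. of_int (c' g) * g) \<in> R"
      unfolding R_def c'_def using n by (intro imageI) auto
    ultimately show "C \<in> (\<lambda>r. {s \<in> zspan B. r - s \<in> nspan B n}) ` R" by blast
  qed
  ultimately show ?thesis using finite_subset by blast
qed

text \<open>For positive \<open>M\<close>, additive generators of the ring Z[2 cos(pi/M)]: products
  of the cosine terms are sums of such terms. The number 1 is added separately because k = 0 gives
  2.\<close>

definition cos_gens :: "nat \<Rightarrow> real set" where
  "cos_gens M = insert 1 (range (\<lambda>k::int. 2 * cos (pi * of_int k / real M)))"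

lemma finite_cos_gens: assumes "M > 0" shows "finite (cos_gens M)"
proof -
  have "range (\<lambda>k::int. 2 * cos (pi * of_int k / real M)) \<subseteq> (\<lambda>k::int. 2 * cos (pi * of_int k / real M)) ` {0..<2 * int M}"
  proof
    fix r assume "r \<in> range (\<lambda>k::int. 2 * cos (pi * of_int k / real M))"
    then obtain k :: int where r: "r = 2 * cos (pi * of_int k / real M)" by blast
    define j where "j = k mod (2 * int M)"
    define q where "q = k div (2 * int M)"
    have k: "k = j + 2 * int M * q" by (simp add: j_def q_def)
    have "pi * of_int k / real M = pi * of_int j / real M + 2 * pi * of_int q"
      unfolding k using assms by (simp add: field_simps)
    then have "cos (pi * of_int k / real M) = cos (pi * of_int j / real M)"
      by (simp only: cos_add cos_int_2pin sin_int_2pin mult_1_right mult_zero_right diff_0_right)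
    then show "r \<in> (\<lambda>k::int. 2 * cos (pi * of_int k / real M)) ` {0..<2 * int M}"
      unfolding r using assms by (intro image_eqI[of _ _ j]) (auto simp: j_def)
  qed
  from finite_subset[OF this] show ?thesis by (simp add: cos_gens_def)
qed

lemma cos_gens_mult:
  assumes "M > 0" "r \<in> zspan (cos_gens M)"
  shows "2 * cos (pi * of_int k / real M) * r \<in> zspan (cos_gens M)"
proof (rule zspan_mult[OF assms(2)])
  have gen: "2 * cos (pi * of_int k / real M) \<in> zspan (cos_gens M)" for k :: int
    by (rule zspan_gen[OF finite_cos_gens[OF assms(1)]]) (auto simp: cos_gens_def)
  fix g assume "g \<in> cos_gens M"
  then consider "g = 1" | j :: int where "g = 2 * cos (pi * of_int j / real M)" unfolding cos_gens_def by blast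
  then show "2 * cos (pi * of_int k / real M) * g \<in> zspan (cos_gens M)"
  proof cases
    case 1
    then show ?thesis using gen by simp
  next
    case 2
    have "2 * cos (pi * of_int k / real M) * g
        = 2 * cos (pi * of_int (k - j) / real M) + 2 * cos (pi * of_int (k + j) / real M)"
      unfolding 2 by (simp add: diff_divide_distrib add_divide_distrib algebra_simps cos_add cos_diff)
    then show ?thesis using zspan_add[OF gen[of "k - j"] gen[of "k + j"]] by simp
  qed
qed

context coxeter
begin

text \<open>A common multiple of the labels, which puts all angles pi/m over one
  denominator.\<close>

definition exponent :: nat where
  "exponent = (\<Prod>v\<in>V. \<Prod>w\<in>V. if {v, w} \<in> E then m {v, w} else 1)"

abbreviation "gens \<equiv> cos_gens exponent"

lemma exponent_pos: "exponent > 0"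
  unfolding exponent_def
proof (intro prod_pos ballI)
  fix v w assume "v \<in> V" "w \<in> V"
  then show "0 < (if {v, w} \<in> E then m {v, w} else 1)" using edge[of v w] by auto
qed

lemma finite_gens: "finite gens"
  by (rule finite_cos_gens[OF exponent_pos])

lemma m_dvd_exponent:
  assumes "v \<in> V" "w \<in> V" "{v, w} \<in> E" shows "m {v, w} dvd exponent"
proof -
  have "m {v, w} dvd (\<Prod>w\<in>V. if {v, w} \<in> E then m {v, w} else 1)"
    using dvd_prodI[OF finite_V assms(2), of "\<lambda>w. if {v, w} \<in> E then m {v, w} else 1"] assms(3) by simp
  also have "\<dots> dvd exponent"
    unfolding exponent_def using dvd_prodI[OF finite_V assms(1)] by fast
  finally show ?thesis .
qed

lemma cartan_mult:
  assumes v: "v \<in> V" and w: "w \<in> V" and r: "r \<in> zspan gens"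
  shows "A v w * r \<in> zspan gens"
proof -
  obtain k :: int and c :: int where "A v w = of_int c * (2 * cos (pi * of_int k / real exponent))"
  proof -
    consider "v = w" | "v \<noteq> w" "{v, w} \<in> E" | "v \<noteq> w" "{v, w} \<notin> E" by blast
    then show ?thesis
    proof cases
      case 1
      then show ?thesis using that[of 1 0] by (simp add: cartan_def)
    next
      case 2
      obtain q where q: "exponent = m {v, w} * q" using m_dvd_exponent[OF v w 2(2)] by blast
      have "pi * real q / real exponent = pi / real (m {v, w})"
        using exponent_pos unfolding q by (auto simp: field_simps)
      then show ?thesis using that[of "- 1" "int q"] 2 by (simp add: cartan_def)
    next
      case 3
      then show ?thesis using that[of "- 1" 0] by (simp add: cartan_def)
    qed
  qed
  then show ?thesis
    using zspan_int_mult[OF cos_gens_mult[OF exponent_pos r]] by (simp add: mult.assoc)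
qed

section \<open>Integral vectors, congruence of vectors and the finite matrix quotient\<close>

definition integral_vec :: "('a \<Rightarrow> real) \<Rightarrow> bool" where
  "integral_vec x \<longleftrightarrow> (\<forall>k. x k \<in> zspan gens)"

definition vcong :: "int \<Rightarrow> ('a \<Rightarrow> real) \<Rightarrow> ('a \<Rightarrow> real) \<Rightarrow> bool" where
  "vcong n x x' \<longleftrightarrow> (\<forall>k. x k - x' k \<in> nspan gens n)"

lemma vcong_refl: "vcong n x x"
  by (simp add: vcong_def nspan_zero)

lemma vcong_sym: "vcong n x x' \<Longrightarrow> vcong n x' x"
  unfolding vcong_def using nspan_neg by fastforce

lemma vcong_trans: "vcong n x x' \<Longrightarrow> vcong n x' x'' \<Longrightarrow> vcong n x x''"
  unfolding vcong_def
proof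
  fix k assume "\<forall>k. x k - x' k \<in> nspan gens n" "\<forall>k. x' k - x'' k \<in> nspan gens n"
  then have "(x k - x' k) + (x' k - x'' k) \<in> nspan gens n" by (intro nspan_add) auto
  then show "x k - x'' k \<in> nspan gens n" by simp
qed

lemma simple_root_integral: "integral_vec (simple_root v)"
proof -
  have "1 \<in> zspan gens" by (rule zspan_gen[OF finite_gens]) (simp add: cos_gens_def)
  then show ?thesis by (simp add: integral_vec_def simple_root_def zspan_zero)
qed

lemma zero_integral: "integral_vec origin"
  by (simp add: integral_vec_def zspan_zero)

lemma act_integral:
  assumes "u \<in> lists V" "integral_vec y" "integral_vec x" shows "integral_vec (act y u x)"
  using assms(1)
proof (induction u rule: list.induct)
  case (Cons v u)
  define z where "z = act y u x"
  have v: "v \<in> V" and z: "\<And>k. z k \<in> zspan gens" using Cons by (auto simp: z_def integral_vec_def)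
  have "pr y v z \<in> zspan gens"
    unfolding pairing_def using v z assms(2) by (intro zspan_add zspan_sum cartan_mult) (auto simp: integral_vec_def)
  then show ?case unfolding wact_Cons z_def[symmetric] integral_vec_def reflect_def
    using z zspan_diff by auto
qed (use assms(3) in simp)

lemma act_vcong:
  assumes "u \<in> lists V" "vcong n x x'" shows "vcong n (act y u x) (act y u x')"
  using assms(1)
proof (induction u rule: list.induct)
  case (Cons v u)
  define z where "z = act y u x"
  define z' where "z' = act y u x'"
  have v: "v \<in> V" and z: "\<And>k. z k - z' k \<in> nspan gens n"
    using Cons by (auto simp: z_def z'_def vcong_def)
  have "pr y v z - pr y v z' = (\<Sum>u\<in>V. A v u * (z u - z' u))"
    by (simp add: pairing_def sum_subtractf algebra_simps)
  moreover have "(\<Sum>u\<in>V. A v u * (z u - z' u)) \<in> nspan gens n"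
    using v z by (intro nspan_sum nspan_mult cartan_mult)
  ultimately have p: "pr y v z - pr y v z' \<in> nspan gens n" by simp
  have "(z v - z' v) - (pr y v z - pr y v z') \<in> nspan gens n" using nspan_diff[OF z p] .
  then have "rfl y v z k - rfl y v z' k \<in> nspan gens n" for k
    using z by (auto simp: reflect_def algebra_simps)
  then show ?case unfolding wact_Cons z_def[symmetric] z'_def[symmetric] vcong_def by blast
qed (use assms(2) in simp)

definition residue :: "int \<Rightarrow> real \<Rightarrow> real set" where
  "residue n r = {s \<in> zspan gens. r - s \<in> nspan gens n}"

lemma residue_eq_iff:
  assumes "r \<in> zspan gens" "s \<in> zspan gens"
  shows "residue n r = residue n s \<longleftrightarrow> r - s \<in> nspan gens n"
proof
  assume "residue n r = residue n s"
  moreover have "s \<in> residue n s" using assms by (simp add: residue_def nspan_zero)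
  ultimately show "r - s \<in> nspan gens n" unfolding residue_def by blast
next
  assume d: "r - s \<in> nspan gens n"
  have "r - t \<in> nspan gens n \<longleftrightarrow> s - t \<in> nspan gens n" for t
    using nspan_add[OF d, of "s - t"] nspan_diff[OF _ d, of "r - t"] by (auto simp: algebra_simps)
  then show "residue n r = residue n s" unfolding residue_def by simp
qed

text \<open>The matrix of a word modulo \<open>n\<close>; for \<open>b\<close> the entries describe the image of the weight
  \<open>\<omega>_v\<close>, otherwise that of the root \<open>e_v\<close>.\<close>
definition table :: "int \<Rightarrow> 'a list \<Rightarrow> bool \<times> 'a \<times> 'a \<Rightarrow> real set" where
  "table n u = restrict (\<lambda>(b, v, k). residue n (if b then act (simple_root v) u origin k else act origin u (simple_root v) k)) (UNIV \<times> V \<times> V)"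

lemma act_outside: "u \<in> lists V \<Longrightarrow> k \<notin> V \<Longrightarrow> act y u x k = x k"
  by (rule wact_other) (auto simp: lists_eq_set)

lemma table_eqD:
  assumes t: "table n u = table n u'" and u: "u \<in> lists V" "u' \<in> lists V" and v: "v \<in> V"
  shows "vcong n (act (simple_root v) u origin) (act (simple_root v) u' origin)"
    and "vcong n (act origin u (simple_root v)) (act origin u' (simple_root v))"
proof -
  have "act (simple_root v) u origin k - act (simple_root v) u' origin k \<in> nspan gens n" for k
  proof (cases "k \<in> V")
    case True
    have "residue n (act (simple_root v) u origin k) = residue n (act (simple_root v) u' origin k)"
      using fun_cong[OF t, of "(True, v, k)"] v True by (simp add: table_def)
    then show ?thesis
      using residue_eq_iff act_integral[OF u(1) simple_root_integral zero_integral] act_integral[OF u(2) simple_root_integral zero_integral]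
      unfolding integral_vec_def by blast
  next
    case False
    then show ?thesis using act_outside u by (simp add: nspan_zero)
  qed
  then show "vcong n (act (simple_root v) u origin) (act (simple_root v) u' origin)" unfolding vcong_def by blast
  have "act origin u (simple_root v) k - act origin u' (simple_root v) k \<in> nspan gens n" for k
  proof (cases "k \<in> V")
    case True
    have "residue n (act origin u (simple_root v) k) = residue n (act origin u' (simple_root v) k)"
      using fun_cong[OF t, of "(False, v, k)"] v True by (simp add: table_def)
    then show ?thesis
      using residue_eq_iff act_integral[OF u(1) zero_integral simple_root_integral] act_integral[OF u(2) zero_integral simple_root_integral]
      unfolding integral_vec_def by blast
  next
    case False
    then show ?thesis using act_outside u by (simp add: nspan_zero)
  qed
  then show "vcong n (act origin u (simple_root v)) (act origin u' (simple_root v))" unfolding vcong_def by blast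
qed

text \<open>The table records the images of basis vectors only. An integral vector has coefficients
  in the span, and these preserve \<open>nspan\<close> because the span is a ring.\<close>

lemma table_eq_act:
  assumes t: "table n u = table n u'" and u: "u \<in> lists V" "u' \<in> lists V"
    and y: "y = origin \<or> (\<exists>v\<in>V. y = simple_root v)" and z: "integral_vec z" "\<And>k. k \<notin> V \<Longrightarrow> z k = 0"
  shows "vcong n (act y u z) (act y u' z)"
  unfolding vcong_def
proof
  fix k
  have 1: "act y u origin k - act y u' origin k \<in> nspan gens n"
    using y table_eqD(1)[OF t u] act_zero_zero unfolding vcong_def by (auto simp: nspan_zero)
  have "(\<Sum>s\<in>V. z s * (act origin u (simple_root s) k - act origin u' (simple_root s) k)) \<in> nspan gens n"
  proof (rule nspan_sum)
    fix s assume s: "s \<in> V"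
    have d: "act origin u (simple_root s) k - act origin u' (simple_root s) k \<in> nspan gens n"
      using table_eqD(2)[OF t u s] unfolding vcong_def by blast
    show "z s * (act origin u (simple_root s) k - act origin u' (simple_root s) k) \<in> nspan gens n"
    proof (rule nspan_mult[OF d])
      fix r assume "r \<in> zspan gens"
      have "r * z s \<in> zspan gens"
      proof (rule zspan_mult)
        fix g assume g: "g \<in> gens"
        then consider "g = 1" | j :: int where "g = 2 * cos (pi * of_int j / real exponent)" unfolding cos_gens_def by blast
        then show "r * g \<in> zspan gens"
          using \<open>r \<in> zspan gens\<close> cos_gens_mult[OF exponent_pos] by cases (simp_all add: mult.commute)
      qed (use z(1) in \<open>simp add: integral_vec_def\<close>)
      then show "z s * r \<in> zspan gens" by (simp add: mult.commute)
    qed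
  qed
  note 2 = this
  have e: "act y w z k = act y w origin k + (\<Sum>s\<in>V. z s * act origin w (simple_root s) k)" for w
    by (rule fun_cong[OF act_expand]) (rule z(2))
  from nspan_add[OF 1 2] show "act y u z k - act y u' z k \<in> nspan gens n"
    unfolding e[of u] e[of u'] by (simp add: sum_subtractf algebra_simps)
qed

text \<open>A factor on the right is absorbed into the vector acted upon, and a factor on the left
  preserves congruence of vectors.\<close>

lemma table_congruence:
  assumes n: "n > 0" shows "finite_congruence V E m (table n)"
  unfolding finite_congruence_def
proof (intro conjI allI ballI impI)
  have "table n ` lists V \<subseteq> (UNIV \<times> V \<times> V) \<rightarrow>\<^sub>E residue n ` zspan gens"
  proof
    fix T assume "T \<in> table n ` lists V"
    then obtain u where u: "u \<in> lists V" "T = table n u" by blast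
    have "act (simple_root v) u origin k \<in> zspan gens" "act origin u (simple_root v) k \<in> zspan gens" for v k
      using act_integral[OF u(1) simple_root_integral zero_integral] act_integral[OF u(1) zero_integral simple_root_integral]
      by (simp_all only: integral_vec_def)
    then show "T \<in> (UNIV \<times> V \<times> V) \<rightarrow>\<^sub>E residue n ` zspan gens"
      unfolding u(2) table_def by auto
  qed
  moreover have "finite (residue n ` zspan gens)"
    using finite_zspan_mod[OF finite_gens n] unfolding residue_def .
  then have "finite (((UNIV :: bool set) \<times> V \<times> V) \<rightarrow>\<^sub>E residue n ` zspan gens)"
    using finite_V by (intro finite_PiE) auto
  ultimately show "finite (table n ` lists V)" using finite_subset by blast
  show "table n u = table n u'" if "(u, u') \<in> cox_step V E m" for u u'
  proof -
    have "(\<lambda>y. act y u) = (\<lambda>y. act y u')" using act_equiv[OF cox_equiv_step[OF that]] by blast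
    from arg_cong[OF this, of "\<lambda>f. restrict (\<lambda>(b, v, k). residue n (if b then f (simple_root v) origin k else f origin (simple_root v) k)) (UNIV \<times> V \<times> V)"]
    show ?thesis unfolding table_def .
  qed
  fix u u' x w assume h: "u \<in> lists V" "u' \<in> lists V" "x \<in> lists V" "w \<in> lists V" "table n u = table n u'"
  have c: "vcong n (act y (x @ u @ w) z) (act y (x @ u' @ w) z)"
    if "y = origin \<or> (\<exists>v\<in>V. y = simple_root v)" "integral_vec z" "\<And>k. k \<notin> V \<Longrightarrow> z k = 0" for y z
  proof -
    have yi: "integral_vec y" using that(1) simple_root_integral zero_integral by auto
    have "act y w z k = 0" if "k \<notin> V" for k
      using act_outside[OF h(4) that] \<open>k \<notin> V \<Longrightarrow> z k = 0\<close> that by simp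
    from table_eq_act[OF h(5,1,2) that(1) act_integral[OF h(4) yi that(2)] this]
    show ?thesis using act_vcong[OF h(3)] by (simp add: wact_append)
  qed
  have l: "x @ u @ w \<in> lists V" "x @ u' @ w \<in> lists V" using h by simp_all
  have "residue n (act y (x @ u @ w) z k) = residue n (act y (x @ u' @ w) z k)"
    if "y = origin \<or> (\<exists>v\<in>V. y = simple_root v)" "integral_vec z" "\<And>k. k \<notin> V \<Longrightarrow> z k = 0" for y z k
  proof -
    have yi: "integral_vec y" using that(1) simple_root_integral zero_integral by auto
    show ?thesis
      using residue_eq_iff act_integral[OF l(1) yi that(2)] act_integral[OF l(2) yi that(2)] c[OF that]
      unfolding integral_vec_def vcong_def by blast
  qed
  note res = this
  show "table n (x @ u @ w) = table n (x @ u' @ w)"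
    unfolding table_def
  proof (rule restrict_ext, clarsimp, intro conjI impI)
    fix v k assume v: "v \<in> V"
    show "residue n (act (simple_root v) (x @ u @ w) origin k) = residue n (act (simple_root v) (x @ u' @ w) origin k)"
      by (rule res) (use v zero_integral in auto)
    show "residue n (act origin (x @ u @ w) (simple_root v) k) = residue n (act origin (x @ u' @ w) (simple_root v) k)"
      by (rule res) (use v simple_root_integral in \<open>auto simp: simple_root_def\<close>)
  qed
qed

text \<open>\<open>weight_cong n v u q\<close> says that \<open>u\<close> and \<open>q\<close> map the weight \<open>\<omega>_v\<close> to the same vector modulo \<open>n\<close>.\<close>
definition weight_cong :: "int \<Rightarrow> 'a \<Rightarrow> 'a list \<Rightarrow> 'a list \<Rightarrow> bool" where
  "weight_cong n v u q \<longleftrightarrow> vcong n (act (simple_root v) u origin) (act (simple_root v) q origin)"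

lemma weight_cong_equivp:
  "weight_cong n v u u" "weight_cong n v u q \<Longrightarrow> weight_cong n v q u"
  "weight_cong n v u q \<Longrightarrow> weight_cong n v q r \<Longrightarrow> weight_cong n v u r"
  unfolding weight_cong_def using vcong_refl vcong_sym vcong_trans by blast+

lemma weight_cong_snoc: "s \<noteq> v \<Longrightarrow> weight_cong n v (u @ [s]) u"
  unfolding weight_cong_def act_weight_snoc by (simp add: vcong_refl)

lemma weight_cong_left: "x \<in> lists V \<Longrightarrow> weight_cong n v u q \<Longrightarrow> weight_cong n v (x @ u) (x @ q)"
  unfolding weight_cong_def by (simp add: wact_append act_vcong)

lemma weight_cong_equiv: "(u, q) \<in> ce \<Longrightarrow> weight_cong n v u q"
  unfolding weight_cong_def by (simp add: act_equiv vcong_refl)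

lemma weight_cong_table:
  "\<lbrakk>table n u = table n q; u \<in> lists V; q \<in> lists V; v \<in> V\<rbrakk> \<Longrightarrow> weight_cong n v u q"
  unfolding weight_cong_def by (rule table_eqD(1))

text \<open>By \<open>faithful\<close>, inequivalent words differ on some weight. Pairs from
  \<open>U\<close> produce finitely many coordinates, and one modulus keeps all nonzero ones
  nonzero.\<close>

lemma residually_finite:
  assumes U: "finite U" "U \<subseteq> lists V"
  obtains F :: "'a list \<Rightarrow> bool \<times> 'a \<times> 'a \<Rightarrow> real set" where "finite_congruence V E m F"
    "\<And>u u'. u \<in> U \<Longrightarrow> u' \<in> U \<Longrightarrow> F u = F u' \<Longrightarrow> (u, u') \<in> ce"
proof -
  define D where "D = (\<lambda>(u, u', v, k). act (simple_root v) (rev u' @ u) origin k) ` (U \<times> U \<times> V \<times> V)"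
  have "finite D" unfolding D_def using U finite_V by blast
  then obtain n where n: "n > 0" "\<And>r. r \<in> D \<Longrightarrow> r \<in> nspan gens n \<Longrightarrow> r = 0"
    using zspan_separate[OF finite_gens] by metis
  note cong = table_congruence[OF n(1)]
  show ?thesis
  proof (rule that[OF cong])
    fix u u' assume u: "u \<in> U" "u' \<in> U" "table n u = table n u'"
    have l: "u \<in> lists V" "u' \<in> lists V" using u U by blast+
    have "table n (rev u' @ u) = table n (rev u' @ u')"
      using finite_congruenceD[OF cong l _ _ u(3), of "rev u'" "[]"] l by simp
    also have "\<dots> = table n []" using finite_congruence_equiv[OF cong cox_equiv_rev'[OF l(2)]] .
    finally have t: "table n (rev u' @ u) = table n []" .
    have "(rev u' @ u, []) \<in> ce"
    proof (rule faithful)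
      fix v assume v: "v \<in> V"
      have "act (simple_root v) (rev u' @ u) origin k = 0" for k
      proof (cases "k \<in> V")
        case True
        then have "act (simple_root v) (rev u' @ u) origin k \<in> D" unfolding D_def using u v by force
        moreover have "act (simple_root v) (rev u' @ u) origin k \<in> nspan gens n"
          using table_eqD(1)[OF t _ _ v] l unfolding vcong_def by simp
        ultimately show ?thesis using n(2) by blast
      next
        case False
        then show ?thesis using act_outside[of "rev u' @ u" k] l by simp
      qed
      then show "act (simple_root v) (rev u' @ u) origin = origin" by blast
    qed (use l in simp)
    then have "(u' @ rev u' @ u, u') \<in> ce" using cox_equiv_context[of "rev u' @ u" "[]" V E m u' "[]"] l by simp
    moreover have "((u' @ rev u') @ u, u) \<in> ce"
      using cox_equiv_context[OF cox_equiv_rev[OF l(2)], of "[]" u] l by simp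
    ultimately show "(u, u') \<in> ce" using cox_equiv_sym cox_equiv_trans by (metis append.assoc)
  qed
qed

end

text \<open>Lets the results on weights be applied inside the parabolic subgroup, where the words
  they produce use letters of \<open>J\<close> only.\<close>

lemma wact_restrict:
  assumes "finite V" "J \<subseteq> V" "u \<in> lists J" "\<And>k. k \<notin> J \<Longrightarrow> x k = 0"
  shows "wact V E m y u x = wact J E m y u x"
  using assms(3)
proof (induction u rule: list.induct)
  case (Cons v u)
  define z where "z = wact J E m y u x"
  have "z k = 0" if "k \<notin> J" for k
    using Cons.prems that assms(4) unfolding z_def by (subst wact_other) (auto simp: lists_eq_set)
  then have "(\<Sum>w\<in>V. cartan E m v w * z w) = (\<Sum>w\<in>J. cartan E m v w * z w)"
    using assms(1,2) by (intro sum.mono_neutral_right) auto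
  then show ?case using Cons unfolding wact_Cons by (simp add: z_def[symmetric] reflect_def pairing_def)
qed simp

context coxeter
begin

lemma coxeter_subset: "J \<subseteq> V \<Longrightarrow> coxeter J E m"
  using finite_V edge finite_subset by unfold_locales blast+

text \<open>Double cosets are detected by the pairing of \<open>\<omega>_s\<close> with the image of \<open>\<omega>_t\<close>, which is invariant
  and takes only finitely many values on the finite groups generated by cliques.\<close>
lemma weight_cong_cliques:
  assumes FC: "FC_type V E m"
  obtains n where "n > 0"
    "\<And>D v w. \<lbrakk>clique V E D; v \<in> D; w \<in> lists D; weight_cong n v w []\<rbrakk>
      \<Longrightarrow> \<exists>w'\<in>lists (D - {v}). (w, w') \<in> cox_equiv D E m"
    "\<And>D s t w q. \<lbrakk>clique V E D; s \<in> D; t \<in> D; w \<in> lists D; q \<in> lists V; weight_cong n s q []; weight_cong n t q w\<rbrakk>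
      \<Longrightarrow> \<exists>w1\<in>lists (D - {s}). \<exists>w2\<in>lists (D - {t}). (w, w1 @ w2) \<in> cox_equiv D E m"
proof -
  define W where "W D = {act (simple_root v) w origin k |v w k. v \<in> V \<and> k \<in> V \<and> w \<in> lists D}" for D
  have finW: "finite (W D)" if D: "clique V E D" for D
  proof -
    have DV: "D \<subseteq> V" using D by (simp add: clique_def)
    have "finite (cls V E m ` lists D)" using FC D special_parabolic_eq[OF DV] unfolding FC_type_def by metis
    then obtain T where T: "finite T" "T \<subseteq> lists D" "cls V E m ` lists D = cls V E m ` T"
      by (meson finite_subset_image order_refl)
    have "W D \<subseteq> (\<lambda>(v, w, k). act (simple_root v) w origin k) ` (V \<times> T \<times> V)"
    proof
      fix r assume "r \<in> W D"
      then obtain v w k where r: "v \<in> V" "k \<in> V" "w \<in> lists D" "r = act (simple_root v) w origin k" unfolding W_def by blast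
      then obtain w' where w': "w' \<in> T" "cls V E m w = cls V E m w'" using T(3) by blast
      then have "r = act (simple_root v) w' origin k" using r act_equiv[of w w'] by (simp add: cls_eq_iff)
      then show "r \<in> (\<lambda>(v, w, k). act (simple_root v) w origin k) ` (V \<times> T \<times> V)"
        using r w' by (intro image_eqI[of _ _ "(v, w', k)"]) auto
    qed
    then show ?thesis using T(1) finite_V finite_subset by blast
  qed
  have "finite (\<Union>D\<in>{D. clique V E D}. W D)"
  proof (rule finite_UN_I)
    show "finite {D. clique V E D}" using finite_V by (rule rev_finite_subset[OF finite_Pow_iff[THEN iffD2]]) (auto simp: clique_def)
  qed (use finW in auto)
  then obtain n where n: "n > 0" "\<And>r. r \<in> (\<Union>D\<in>{D. clique V E D}. W D) \<Longrightarrow> r \<in> nspan gens n \<Longrightarrow> r = 0"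
    using zspan_separate[OF finite_gens] by metis
  have van: "act (simple_root v) w origin k = 0"
    if "clique V E D" "v \<in> D" "w \<in> lists D" "k \<in> V" "act (simple_root v) w origin k \<in> nspan gens n" for D v w k
    using n(2)[of "act (simple_root v) w origin k"] that unfolding W_def clique_def by blast
  have small: "act (simple_root v) w origin = wact D E m (simple_root v) w origin" if "clique V E D" "w \<in> lists D" for D v w
    using that by (intro wact_restrict[OF finite_V]) (auto simp: clique_def)
  show ?thesis
  proof (rule that[OF n(1)])
    fix D v w assume h: "clique V E D" "v \<in> D" "w \<in> lists D" "weight_cong n v w []"
    then interpret D: coxeter D E m using coxeter_subset by (simp add: clique_def)
    have wV: "w \<in> lists V" using h lists_mono unfolding clique_def by blast
    have "act (simple_root v) w origin k = 0" for k
    proof (cases "k \<in> V")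
      case True
      then show ?thesis using van[OF h(1-3) True] h(4) unfolding weight_cong_def vcong_def by simp
    next
      case False
      then show ?thesis using act_outside[OF wV] by simp
    qed
    then have "wact D E m (simple_root v) w origin = origin" using small[OF h(1,3)] by (metis ext)
    then show "\<exists>w'\<in>lists (D - {v}). (w, w') \<in> cox_equiv D E m"
      using D.weight_stabilizer[OF h(3,2)] by blast
  next
    fix D s t w q assume h: "clique V E D" "s \<in> D" "t \<in> D" "w \<in> lists D" "q \<in> lists V"
      "weight_cong n s q []" "weight_cong n t q w"
    then interpret D: coxeter D E m using coxeter_subset by (simp add: clique_def)
    have st: "s \<in> V" "t \<in> V" using h by (auto simp: clique_def)
    \<comment> \<open>With \<open>q\<close> also its inverse fixes \<omega>_s modulo n. By
      \<open>weight_symmetry\<close> the s-coordinate of q \<omega>_t, and so that of w \<omega>_t,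
      is 0 modulo n; by the choice of n the latter is 0.\<close>
    have "weight_cong n s (rev q @ q) (rev q @ [])" using weight_cong_left[OF _ h(6), of "rev q"] h(5) by simp
    then have "weight_cong n s [] (rev q)"
      using weight_cong_equiv[OF cox_equiv_rev'[OF h(5)]] weight_cong_equivp by (metis append_Nil2)
    then have "act (simple_root s) (rev q) origin t \<in> nspan gens n"
      using nspan_neg unfolding weight_cong_def vcong_def by fastforce
    then have "act (simple_root t) q origin s \<in> nspan gens n" using weight_symmetry[OF st h(5)] by simp
    moreover have "act (simple_root t) q origin s - act (simple_root t) w origin s \<in> nspan gens n"
      using h(7) unfolding weight_cong_def vcong_def by blast
    ultimately have "act (simple_root t) w origin s \<in> nspan gens n" using nspan_diff by fastforce
    then have "wact D E m (simple_root t) w origin s = 0" using van[OF h(1,3,4) st(1)] small[OF h(1,4)] by metis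
    then show "\<exists>w1\<in>lists (D - {s}). \<exists>w2\<in>lists (D - {t}). (w, w1 @ w2) \<in> cox_equiv D E m"
      using D.double_coset[OF h(4,2,3)] by blast
  qed
qed

end

section \<open>Extending finite actions from special parabolic subgroups\<close>

lemma finite_congruence_mono:
  assumes "finite_congruence V E m F" "J \<subseteq> V" shows "finite_congruence J E m F"
  unfolding finite_congruence_def
proof (intro conjI allI ballI impI)
  have l: "lists J \<subseteq> lists V" by (rule lists_mono[OF assms(2)])
  show "finite (F ` lists J)"
    using assms(1) finite_subset[OF image_mono[OF l]] unfolding finite_congruence_def by blast
  show "F u = F u'" if "(u, u') \<in> cox_step J E m" for u u'
    using assms(1) cox_step_mono[OF assms(2) that] unfolding finite_congruence_def by blast
  show "F (x @ u @ y) = F (x @ u' @ y)"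
    if "u \<in> lists J" "u' \<in> lists J" "x \<in> lists J" "y \<in> lists J" "F u = F u'" for u u' x y
    using finite_congruenceD[OF assms(1)] that l by blast
qed

section \<open>Adding and removing a vertex of a clique\<close>

definition toggle :: "'a \<Rightarrow> 'a set \<Rightarrow> 'a set" where
  "toggle v D = (if v \<in> D then D - {v} else insert v D)"

lemma toggle_toggle [simp]: "toggle v (toggle v D) = D"
  by (auto simp: toggle_def)

lemma toggle_commute: "s \<noteq> t \<Longrightarrow> toggle s (toggle t D) = toggle t (toggle s D)"
  by (auto simp: toggle_def)

lemma toggle_subset: "toggle v D \<subseteq> insert v D"
  by (auto simp: toggle_def)

lemma insert_toggle [simp]: "insert v (toggle v D) = insert v D"
  by (auto simp: toggle_def)

lemma clique_subset: "clique V E D \<Longrightarrow> D' \<subseteq> D \<Longrightarrow> clique V E D'"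
  unfolding clique_def by blast

text \<open>The combinatorial half of the commutation of crossings: a neighbour \<open>s\<close>
  that can itself be added never obstructs \<open>t\<close>.\<close>

lemma clique_insert_toggle:
  assumes "clique V E D" "clique V E (insert s D)" "{s, t} \<in> E"
  shows "clique V E (insert t (toggle s D)) \<longleftrightarrow> clique V E (insert t D)"
proof
  assume h: "clique V E (insert t (toggle s D))"
  show "clique V E (insert t D)"
    unfolding clique_def
  proof (intro conjI ballI impI)
    show "insert t D \<subseteq> V" using h assms(1) unfolding clique_def by blast
    fix v w assume vw: "v \<in> insert t D" "w \<in> insert t D" "v \<noteq> w"
    have "v \<in> D \<or> v = t" "w \<in> D \<or> w = t" using vw by auto
    moreover have "{v, w} \<in> E" if "v \<in> D" "w \<in> D" using assms(1) vw(3) that unfolding clique_def by blast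
    moreover have td: "{t, d} \<in> E" if "d \<in> D" "d \<noteq> t" for d
    proof (cases "d = s")
      case True
      then show ?thesis using assms(3) by (simp add: insert_commute)
    next
      case False
      then have "d \<in> insert t (toggle s D)" using that by (simp add: toggle_def)
      then show ?thesis using h that(2) unfolding clique_def by (metis insertI1)
    qed
    moreover have "{v, w} \<in> E" if "v = t" "w \<in> D" using td[of w] that vw(3) by blast
    moreover have "{v, w} \<in> E" if "w = t" "v \<in> D" using td[of v] that vw(3) by (simp add: insert_commute)
    ultimately show "{v, w} \<in> E" using vw(3) by blast
  qed
next
  assume h: "clique V E (insert t D)"
  have "clique V E (insert t (insert s D))"
    unfolding clique_def
  proof (intro conjI ballI impI)
    show "insert t (insert s D) \<subseteq> V" using h assms(2) unfolding clique_def by blast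
    fix v w assume vw: "v \<in> insert t (insert s D)" "w \<in> insert t (insert s D)" "v \<noteq> w"
    then consider "v \<in> insert t D" "w \<in> insert t D" | "v \<in> insert s D" "w \<in> insert s D"
      | "v = s" "w = t" | "v = t" "w = s" by blast
    then show "{v, w} \<in> E"
    proof cases
      case 1
      then show ?thesis using h vw(3) unfolding clique_def by blast
    next
      case 2
      then show ?thesis using assms(2) vw(3) unfolding clique_def by blast
    qed (use assms(3) in \<open>simp_all add: insert_commute\<close>)
  qed
  then show "clique V E (insert t (toggle s D))"
    by (rule clique_subset) (use toggle_subset[of s D] in blast)
qed

context coxeter
begin

lemma weight_cong_append: "v \<notin> set w \<Longrightarrow> weight_cong n v (u @ w) u"
proof (induction w rule: rev_induct)
  case (snoc s w)
  then have "weight_cong n v (u @ w) u" and "s \<noteq> v" by auto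
  from weight_cong_equivp(3)[OF weight_cong_snoc[OF this(2), of n "u @ w"] this(1)]
  show ?case by simp
qed (simp add: weight_cong_equivp(1))

lemma weight_cong_cancel:
  assumes "u \<in> lists V" "w \<in> lists V" "weight_cong n v q (u @ w)"
  shows "weight_cong n v (rev u @ q) w"
proof -
  have "weight_cong n v (rev u @ q) (rev u @ u @ w)" using weight_cong_left[OF _ assms(3), of "rev u"] assms(1) by simp
  moreover have "((rev u @ u) @ w, w) \<in> ce" using cox_equiv_context[OF cox_equiv_rev'[OF assms(1)], of "[]" w] assms(2) by simp
  ultimately show ?thesis using weight_cong_equiv[of "rev u @ u @ w" w n v] weight_cong_equivp(3) by simp
qed

text \<open>The extension of \<open>\<rho>\<close> from \<open>J\<close> to \<open>V\<close> lives on the vertices \<open>(D, u W_D)\<close>, for cliques \<open>D \<subseteq> J\<close>,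
  of a finite quotient of the cube complex of \<open>W_J\<close>. Crossing the hyperplane of type \<open>v\<close> dual to
  \<open>u W_D\<close> toggles \<open>v\<close> in \<open>D\<close>; hyperplanes are labelled by the images of the weight \<open>\<omega>_v\<close> modulo \<open>n\<close>,
  which makes the crossings of adjacent types commute.\<close>
theorem extend_action:
  assumes FC: "FC_type V E m" and JV: "J \<subseteq> V" and \<rho>: "cox_action J E m S \<rho>" and finS: "finite S"
  obtains N where "N \<in> fin_index_normals (coxeter_group V E m)"
    "\<And>u z. u \<in> lists J \<Longrightarrow> cls V E m u \<in> N \<Longrightarrow> z \<in> S \<Longrightarrow> fold \<rho> u z = z"
proof -
  obtain n where n: "n > 0" and
    S1: "\<And>D v w. \<lbrakk>clique V E D; v \<in> D; w \<in> lists D; weight_cong n v w []\<rbrakk>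
      \<Longrightarrow> \<exists>w'\<in>lists (D - {v}). (w, w') \<in> cox_equiv D E m" and
    S2: "\<And>D s t w q. \<lbrakk>clique V E D; s \<in> D; t \<in> D; w \<in> lists D; q \<in> lists V; weight_cong n s q []; weight_cong n t q w\<rbrakk>
      \<Longrightarrow> \<exists>w1\<in>lists (D - {s}). \<exists>w2\<in>lists (D - {t}). (w, w1 @ w2) \<in> cox_equiv D E m"
    using weight_cong_cliques[OF FC] by metis
  have lJV: "u \<in> lists V" if "u \<in> lists J" for u using that lists_mono[OF JV] by blast
  note tab = table_congruence[OF n]
  \<comment> \<open>The finite quotient of W_J whose cosets form the complex, fine enough to see
    both \<rho> and the matrices modulo n.\<close>
  define F where "F u = (restrict (fold \<rho> u) S, table n u)" for u
  have F: "finite_congruence J E m F"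
    unfolding F_def
    by (rule finite_congruence_pair[OF action_finite_congruence[OF \<rho> finS] finite_congruence_mono[OF tab JV]])
  have Fapp: "F (x @ w) = F (x' @ w)" if "F x = F x'" "x \<in> lists J" "x' \<in> lists J" "w \<in> lists J" for x x' w
    using finite_congruenceD[OF F that(2,3) _ that(4,1), of "[]"] by simp
  have Fpre: "F (w @ x) = F (w @ x')" if "F x = F x'" "x \<in> lists J" "x' \<in> lists J" "w \<in> lists J" for x x' w
    using finite_congruenceD[OF F that(2,3,4) _ that(1), of "[]"] by simp
  have Fce: "F (u @ w) = F (u @ w')" if "(w, w') \<in> cox_equiv D E m" "D \<subseteq> J" "u \<in> lists J" for u w w' D
  proof -
    have "(u @ w @ [], u @ w' @ []) \<in> cox_equiv J E m"
      by (rule cox_equiv_context[OF cox_equiv_mono[OF that(2,1)] that(3)]) simp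
    then show ?thesis using finite_congruence_equiv[OF F] by simp
  qed
  have Fwc: "weight_cong n v u u'" if "F u = F u'" "u \<in> lists J" "u' \<in> lists J" "v \<in> J" for u u' v
    using that lJV JV by (intro weight_cong_table) (auto simp: F_def)
  \<comment> \<open>The coset u W_D in this quotient, as a set of words.\<close>
  define block where "block D u = {u' \<in> lists J. \<exists>w\<in>lists D. F u' = F (u @ w)}" for D u
  have blockJ: "u' \<in> lists J" if "u' \<in> block D u" for u' D u using that by (simp add: block_def)
  have lD: "w \<in> lists J" if "w \<in> lists D" "D \<subseteq> J" for w D using that lists_mono by blast
  have block_self: "u \<in> block D u" if "u \<in> lists J" for D u
    using that unfolding block_def by (auto intro!: bexI[of _ "[]"])
  have block_sub: "block D u' \<subseteq> block D u" if "u' \<in> block D u" "D \<subseteq> J" "u \<in> lists J" for D u u'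
  proof
    fix x assume x: "x \<in> block D u'"
    obtain w where w: "w \<in> lists D" "F u' = F (u @ w)" using \<open>u' \<in> block D u\<close> by (auto simp: block_def)
    obtain w' where w': "w' \<in> lists D" "F x = F (u' @ w')" using x by (auto simp: block_def)
    have "F (u' @ w') = F ((u @ w) @ w')"
      using Fapp[OF w(2) blockJ[OF that(1)] _ lD[OF w'(1) that(2)]] lD[OF w(1) that(2)] that(3) by simp
    then show "x \<in> block D u" using x w w' unfolding block_def by (auto intro!: bexI[of _ "w @ w'"])
  qed
  have block_swap: "u \<in> block D u'" if "u' \<in> block D u" "D \<subseteq> J" "u \<in> lists J" for D u u'
  proof -
    from that obtain w where w: "w \<in> lists D" "F u' = F (u @ w)" by (auto simp: block_def)
    have wJ: "w \<in> lists J" using lD w that by blast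
    have "F (u' @ rev w) = F ((u @ w) @ rev w)" using Fapp[OF w(2) blockJ[OF that(1)]] that wJ by simp
    also have "\<dots> = F (u @ [])" using Fce[OF cox_equiv_rev[OF wJ] order_refl that(3)] by simp
    finally show ?thesis using w that(3) unfolding block_def by (auto intro!: bexI[of _ "rev w"])
  qed
  have block_eq: "block D u' = block D u" if "u' \<in> block D u" "D \<subseteq> J" "u \<in> lists J" for D u u'
    using block_sub block_swap that blockJ by (metis subset_antisym)
  have block_mono: "block D u \<subseteq> block D' u" if "D \<subseteq> D'" for D D' u
    using that lists_mono unfolding block_def by blast
  \<comment> \<open>A state \<open>q\<close> selects, for each type \<open>v\<close>, the hyperplane
    labelled by its image of \<omega>_v; \<open>W v q u\<close> says that \<open>u\<close> yields
    the same label.\<close>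
  define W where "W v q u \<longleftrightarrow> (\<exists>q'\<in>lists V. table n q' = q \<and> weight_cong n v u q')" for v q u
  have W_table: "W v (table n q) u \<longleftrightarrow> weight_cong n v u q" if "q \<in> lists V" "v \<in> V" for v q u
    using that weight_cong_table[of n] weight_cong_equivp(3) unfolding W_def by metis
  \<comment> \<open>A vertex next to the selected hyperplane is moved across it; all other vertices
    stay.\<close>
  define \<theta> where "\<theta> v q = (\<lambda>(D, c). if v \<in> J \<and> clique V E (insert v D) \<and> (\<exists>u\<in>c. W v q u)
      then (toggle v D, block (toggle v D) (SOME u. u \<in> c \<and> W v q u)) else (D, c))" for v q
  define S' where "S' = {(D, block D u) |D u. clique V E D \<and> D \<subseteq> J \<and> u \<in> lists J}"
  define T where "T = table n ` lists V"
  have togJ: "toggle v D \<subseteq> J" if "v \<in> J" "D \<subseteq> J" for v D using that toggle_subset[of v D] by blast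
  \<comment> \<open>Only the removal of \<open>v\<close> needs an argument: two representatives with
    the same image of \<omega>_v differ by an element of W_D fixing \<omega>_v modulo n, and
    \<open>S1\<close> puts it into \<open>W_{D - {v}}\<close>.\<close>
  have welldef: "block (toggle v D) u' = block (toggle v D) u"
    if h: "v \<in> J" "clique V E (insert v D)" "D \<subseteq> J" "u \<in> lists J" "u' \<in> block D u" "q \<in> T" "W v q u" "W v q u'" for v D u u' q
  proof (cases "v \<in> D")
    case False
    then have "u' \<in> block (toggle v D) u" using block_mono[of D "toggle v D"] h(5) by (auto simp: toggle_def)
    then show ?thesis by (rule block_eq[OF _ togJ[OF h(1,3)] h(4)])
  next
    case True
    obtain q0 where q0: "q0 \<in> lists V" "q = table n q0" using h(6) unfolding T_def by blast
    have vV: "v \<in> V" using h JV by blast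
    obtain w where w: "w \<in> lists D" "F u' = F (u @ w)" using h(5) by (auto simp: block_def)
    have wJ: "w \<in> lists J" using lD w h by blast
    have "weight_cong n v u u'"
      using h(7,8) W_table[OF q0(1) vV] weight_cong_equivp unfolding q0(2) by blast
    moreover have "weight_cong n v u' (u @ w)" using Fwc[OF w(2) blockJ[OF h(5)]] h wJ by simp
    ultimately have "weight_cong n v u (u @ w)" by (rule weight_cong_equivp)
    then have "weight_cong n v (rev u @ u) w" using weight_cong_cancel lJV h wJ by blast
    moreover have "weight_cong n v (rev u @ u) []" using weight_cong_equiv[OF cox_equiv_rev'[OF lJV[OF h(4)]]] .
    ultimately have "weight_cong n v w []" using weight_cong_equivp by blast
    moreover have "clique V E D" using clique_subset[OF h(2)] by blast
    ultimately obtain w' where w': "w' \<in> lists (D - {v})" "(w, w') \<in> cox_equiv D E m"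
      using S1[of D v w] True w by blast
    have "F u' = F (u @ w')" using w(2) Fce[OF w'(2) h(3,4)] by simp
    then have "u' \<in> block (toggle v D) u" using w' True blockJ[OF h(5)] by (auto simp: block_def toggle_def)
    then show ?thesis by (rule block_eq[OF _ togJ[OF h(1,3)] h(4)])
  qed
  have \<theta>_move: "\<theta> v q (D, block D u) = (toggle v D, block (toggle v D) u)"
    if h: "v \<in> J" "clique V E (insert v D)" "D \<subseteq> J" "u \<in> lists J" "q \<in> T" "W v q u" for v q D u
  proof -
    have ex: "\<exists>u'. u' \<in> block D u \<and> W v q u'" using block_self h by blast
    note u' = someI_ex[OF ex]
    have "block (toggle v D) (SOME u'. u' \<in> block D u \<and> W v q u') = block (toggle v D) u"
      using welldef[OF h(1-4) _ h(5,6)] u' by blast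
    then show ?thesis using h ex unfolding \<theta>_def by auto
  qed
  have \<theta>_fix: "\<theta> v q (D, c) = (D, c)"
    if "\<not> (v \<in> J \<and> clique V E (insert v D) \<and> (\<exists>u\<in>c. W v q u))" for v q D c
    using that unfolding \<theta>_def by auto
  have togC: "clique V E (toggle v D)" if "clique V E (insert v D)" for v D
    using clique_subset[OF that toggle_subset] .
  obtain r where r: "cox_action V E m T r" and
    r_fold: "\<And>u x. u \<in> lists V \<Longrightarrow> x \<in> lists V \<Longrightarrow> fold r x (table n u) = table n (u @ x)"
    using congruence_action[OF tab] unfolding T_def by blast
  have r1: "r v (table n u) = table n (u @ [v])" if "u \<in> lists V" "v \<in> V" for u v
    using r_fold[of u "[v]"] that by simp
  \<comment> \<open>Decompose the element leading from \<open>u\<close> to \<open>u2\<close> as w1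
    w2 by \<open>S2\<close>. Since w1 avoids \<open>s\<close> and w2 avoids \<open>t\<close>, the
    word u w1 has the s-label of \<open>u\<close> and the t-label of \<open>u2\<close>.\<close>
  have common: "\<exists>u3\<in>block D u. W s q u3 \<and> W t q u3"
    if h: "s \<in> J" "t \<in> J" "clique V E (insert s D)" "D \<subseteq> J" "u \<in> lists J" "q \<in> T" "W s q u"
      "u2 \<in> block (insert s D) u" "W t q u2" for s t D u q u2
  proof -
    obtain q0 where q0: "q0 \<in> lists V" "q = table n q0" using h(6) unfolding T_def by blast
    have sV: "s \<in> V" "t \<in> V" using h JV by blast+
    have wq: "weight_cong n s u q0" "weight_cong n t u2 q0"
      using h(7,9) W_table[OF q0(1)] sV unfolding q0(2) by blast+
    obtain w where w: "w \<in> lists (insert s D)" "F u2 = F (u @ w)" using h(8) by (auto simp: block_def)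
    have wJ: "w \<in> lists J" using lD[OF w(1)] h by blast
    have tq: "weight_cong n t (u @ w) q0"
      using Fwc[OF w(2) blockJ[OF h(8)] _ h(2)] h(5) wJ wq(2) weight_cong_equivp by (meson append_in_lists_conv)
    show ?thesis
    proof (cases "t \<in> insert s D")
      case False
      then have "t \<notin> set w" using w(1) by (auto simp: lists_eq_set)
      then have "weight_cong n t u q0" using tq weight_cong_append weight_cong_equivp by blast
      then have "W t q u" using W_table[OF q0(1)] sV unfolding q0(2) by blast
      then show ?thesis using h block_self by blast
    next
      case True
      have "weight_cong n s (rev u @ q0) []"
        using weight_cong_cancel[of u "[]" n s q0] lJV[OF h(5)] weight_cong_equivp(2)[OF wq(1)] by simp
      moreover have "weight_cong n t (rev u @ q0) w"
        using weight_cong_cancel[of u w n t q0] lJV[OF h(5)] lJV[OF wJ] tq weight_cong_equivp by blast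
      ultimately obtain w1 w2 where w12: "w1 \<in> lists (insert s D - {s})" "w2 \<in> lists (insert s D - {t})"
          "(w, w1 @ w2) \<in> cox_equiv (insert s D) E m"
        using S2[OF h(3) _ True w(1), of s "rev u @ q0"] lJV[OF h(5)] q0(1) by auto
      have w1D: "w1 \<in> lists D" using w12(1) by (auto simp: lists_eq_set)
      have w1J: "w1 \<in> lists J" "w2 \<in> lists J" using lD[OF w1D h(4)] lD[OF w12(2)] h(1,4) by auto
      have "s \<notin> set w1" "t \<notin> set w2" using w12 by (auto simp: lists_eq_set)
      then have s1: "weight_cong n s (u @ w1) u" and t1: "weight_cong n t ((u @ w1) @ w2) (u @ w1)"
        using weight_cong_append by blast+
      have "(u @ w @ [], u @ (w1 @ w2) @ []) \<in> ce"
        using h(1,4,5) JV w12(3) lJV by (intro cox_equiv_context cox_equiv_mono[of "insert s D" V]) auto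
      then have "weight_cong n t (u @ w) ((u @ w1) @ w2)" using weight_cong_equiv by simp
      then have "weight_cong n t (u @ w1) q0" using t1 tq weight_cong_equivp by blast
      moreover have "weight_cong n s (u @ w1) q0" using s1 wq(1) weight_cong_equivp by blast
      ultimately have "W s q (u @ w1)" "W t q (u @ w1)" using W_table[OF q0(1)] sV unfolding q0(2) by blast+
      moreover have "u @ w1 \<in> block D u" using w1D w1J h(5) unfolding block_def by auto
      ultimately show ?thesis by blast
    qed
  qed
  have comm1: "\<theta> s q (\<theta> t q (D, c)) = \<theta> t q (\<theta> s q (D, c))"
    if h: "s \<in> J" "t \<in> J" "s \<noteq> t" "{s, t} \<in> E" "q \<in> T" "clique V E D" "D \<subseteq> J" "u0 \<in> lists J" "c = block D u0"
    for s t q D c u0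
  \<comment> \<open>With a common representative, both crossings are performed on the same
    \<open>u\<close> and commute. Without one, \<open>common\<close> shows that at most one of them
    moves the vertex and that it does not bring the other into play.\<close>
  proof (cases "\<exists>u\<in>c. W s q u \<and> W t q u")
    case True
    then obtain u where u: "u \<in> c" "W s q u" "W t q u" by blast
    have uJ: "u \<in> lists J" using u blockJ h by blast
    have c: "c = block D u" using u(1) block_eq h by blast
    have e': "{t, s} \<in> E" using h(4) by (simp add: insert_commute)
    have mv: "\<theta> v q (D', block D' u) = (if clique V E (insert v D') then (toggle v D', block (toggle v D') u) else (D', block D' u))"
      if "v \<in> {s, t}" "D' \<subseteq> J" for v D'
      using \<theta>_move[of v D' u q] \<theta>_fix[of v D' "block D' u" q] that h u uJ by auto
    note ct = clique_insert_toggle[OF h(6)]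
    show ?thesis
      unfolding c
      using mv[of s D] mv[of t D] mv[of s "toggle t D"] mv[of t "toggle s D"] togJ h
        ct[of s t] ct[of t s] e' toggle_commute[OF h(3), of D] by simp
  next
    case no: False
    have step: "\<theta> t' q (\<theta> s' q (D, c)) = \<theta> s' q (D, c)" if st: "{s', t'} = {s, t}"
      and tn: "\<not> (clique V E (insert t' D) \<and> (\<exists>u\<in>c. W t' q u))" for s' t'
    proof (cases "clique V E (insert s' D) \<and> (\<exists>u\<in>c. W s' q u)")
      case True
      have st': "s' \<in> J" "t' \<in> J" using st h(1,2) by (auto simp: doubleton_eq_iff)
      obtain u where u: "u \<in> c" "W s' q u" using True by blast
      have uJ: "u \<in> lists J" using u blockJ h by blast
      have c: "c = block D u" using u(1) block_eq h by blast
      have mv: "\<theta> s' q (D, c) = (toggle s' D, block (toggle s' D) u)"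
        unfolding c using \<theta>_move True st' h uJ u by blast
      have "\<not> (\<exists>u2\<in>block (toggle s' D) u. W t' q u2)"
      proof
        assume "\<exists>u2\<in>block (toggle s' D) u. W t' q u2"
        then obtain u2 where "u2 \<in> block (insert s' D) u" "W t' q u2"
          using block_mono[OF toggle_subset] by blast
        then have "\<exists>u3\<in>block D u. W s' q u3 \<and> W t' q u3"
          using common[OF st' _ h(7) uJ h(5) u(2)] True by blast
        then show False using no st unfolding c by (auto simp: doubleton_eq_iff)
      qed
      then show ?thesis unfolding mv using \<theta>_fix by blast
    next
      case False
      then show ?thesis using \<theta>_fix tn by metis
    qed
    have "\<not> (clique V E (insert s D) \<and> (\<exists>u\<in>c. W s q u)) \<or> \<not> (clique V E (insert t D) \<and> (\<exists>u\<in>c. W t q u))"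
    proof (rule ccontr)
      assume "\<not> ?thesis"
      then obtain u u2 where u: "clique V E (insert s D)" "u \<in> c" "W s q u" "u2 \<in> c" "W t q u2" by blast
      have uJ: "u \<in> lists J" using u blockJ h by blast
      have c: "c = block D u" using u(2) block_eq h by blast
      have "u2 \<in> block (insert s D) u" using u(4) block_mono[of D "insert s D"] unfolding c by blast
      then show False using common[OF h(1,2) u(1) h(7) uJ h(5) u(3)] u(5) no unfolding c by blast
    qed
    then show ?thesis
    proof
      assume sn: "\<not> (clique V E (insert s D) \<and> (\<exists>u\<in>c. W s q u))"
      have "\<theta> s q (\<theta> t q (D, c)) = \<theta> t q (D, c)" using step[of t s] sn by (simp add: insert_commute)
      moreover have "\<theta> s q (D, c) = (D, c)" using \<theta>_fix sn by blast
      ultimately show ?thesis by simp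
    next
      assume tn: "\<not> (clique V E (insert t D) \<and> (\<exists>u\<in>c. W t q u))"
      have "\<theta> t q (\<theta> s q (D, c)) = \<theta> s q (D, c)" using step[of s t] tn by simp
      moreover have "\<theta> t q (D, c) = (D, c)" using \<theta>_fix tn by blast
      ultimately show ?thesis by simp
    qed
  qed
  have \<theta>_out: "\<theta> v q z = z" if "v \<notin> J" for v q z using that unfolding \<theta>_def by (cases z) auto
  have \<theta>_S': "\<theta> v q z \<in> S' \<and> \<theta> v q (\<theta> v q z) = z" if z: "z \<in> S'" and q: "q \<in> T" for v q z
  proof -
    obtain D u0 where D: "z = (D, block D u0)" "clique V E D" "D \<subseteq> J" "u0 \<in> lists J"
      using z unfolding S'_def by blast
    show ?thesis
    proof (cases "v \<in> J \<and> clique V E (insert v D) \<and> (\<exists>u\<in>block D u0. W v q u)")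
      case True
      then obtain u where u: "u \<in> block D u0" "W v q u" by blast
      have uJ: "u \<in> lists J" using u blockJ by blast
      have z': "z = (D, block D u)" using D u block_eq by simp
      have 1: "\<theta> v q z = (toggle v D, block (toggle v D) u)"
        unfolding z' using \<theta>_move True D uJ q u(2) by blast
      moreover have "\<theta> v q (toggle v D, block (toggle v D) u) = (toggle v (toggle v D), block (toggle v (toggle v D)) u)"
        using True togJ D uJ q u(2) by (intro \<theta>_move) auto
      moreover have "(toggle v D, block (toggle v D) u) \<in> S'"
        unfolding S'_def using True togC togJ D(3) uJ by blast
      ultimately show ?thesis using z' by simp
    next
      case False
      then have "\<theta> v q z = z" unfolding D(1) by (rule \<theta>_fix)
      then show ?thesis using z by simp
    qed
  qed
  \<comment> \<open>Passing from q to q v changes the image of \<omega>_v only.\<close>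
  have W_r: "W w (r v q) u \<longleftrightarrow> W w q u" if "v \<in> V" "w \<in> V" "v \<noteq> w" "q \<in> T" for v w q u
  proof -
    from that(4) obtain q0 where q0: "q0 \<in> lists V" "q = table n q0" unfolding T_def by blast
    have "W w (r v q) u \<longleftrightarrow> weight_cong n w u (q0 @ [v])"
      unfolding q0(2) r1[OF q0(1) that(1)] using W_table[of "q0 @ [v]"] q0(1) that by simp
    also have "\<dots> \<longleftrightarrow> weight_cong n w u q0" using weight_cong_snoc[OF that(3)] weight_cong_equivp by blast
    also have "\<dots> \<longleftrightarrow> W w q u" unfolding q0(2) using W_table[OF q0(1) that(2)] by simp
    finally show ?thesis .
  qed
  \<comment> \<open>The hyperplane selected before the step is crossed first, then the one selected
    after it. From the vertex of the element u this leads through the coset of type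
    \<open>{v}\<close> to the vertex of u v.\<close>
  define \<rho>' where "\<rho>' v = (\<lambda>(z, q). (\<theta> v (r v q) (\<theta> v q z), r v q))" for v
  have \<rho>': "cox_action V E m (S' \<times> T) \<rho>'"
    unfolding \<rho>'_def
  proof (rule skew_action[OF r])
    fix v w q z assume vw: "v \<in> V" "w \<in> V" "{v, w} \<in> E" and q: "q \<in> T" and z: "z \<in> S'"
    then have ne: "v \<noteq> w" using edge by blast
    show "\<theta> w (r v q) z = \<theta> w q z"
    proof -
      have e: "W w (r v q) = W w q" using W_r[OF vw(1,2) ne q] by blast
      show ?thesis unfolding \<theta>_def e ..
    qed
    obtain D u0 where D: "z = (D, block D u0)" "clique V E D" "D \<subseteq> J" "u0 \<in> lists J"
      using z unfolding S'_def by blast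
    show "\<theta> v q (\<theta> w q z) = \<theta> w q (\<theta> v q z)"
    proof (cases "v \<in> J \<and> w \<in> J")
      case True
      then show ?thesis unfolding D(1) using comm1 ne vw(3) q D by blast
    next
      case False
      then show ?thesis using \<theta>_out by metis
    qed
  qed (use \<theta>_S' in auto)
  have "finite (S' \<times> T)"
  proof (rule finite_cartesian_product)
    have block_F: "block D u = block D u'" if "F u = F u'" "u \<in> lists J" "u' \<in> lists J" "D \<subseteq> J" for D u u'
    proof -
      have "u \<in> block D u'" using that unfolding block_def by (auto intro!: bexI[of _ "[]"])
      then show ?thesis using block_eq that by blast
    qed
    have "S' \<subseteq> (\<lambda>(D, f). (D, block D (SOME u. u \<in> lists J \<and> F u = f))) ` (Pow J \<times> F ` lists J)"
    proof
      fix z assume "z \<in> S'"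
      then obtain D u where D: "z = (D, block D u)" "D \<subseteq> J" "u \<in> lists J" unfolding S'_def by blast
      have "\<exists>u'. u' \<in> lists J \<and> F u' = F u" using D by blast
      from someI_ex[OF this] have "block D (SOME u'. u' \<in> lists J \<and> F u' = F u) = block D u"
        using block_F D by blast
      then show "z \<in> (\<lambda>(D, f). (D, block D (SOME u. u \<in> lists J \<and> F u = f))) ` (Pow J \<times> F ` lists J)"
        using D by (intro image_eqI[of _ _ "(D, F u)"]) auto
    qed
    moreover have "finite (Pow J \<times> F ` lists J)"
      using F finite_subset[OF JV finite_V] unfolding finite_congruence_def by simp
    ultimately show "finite S'" using finite_subset by blast
    show "finite T" using tab unfolding T_def finite_congruence_def by blast
  qed
  note cong = action_finite_congruence[OF \<rho>' this]
  \<comment> \<open>The orbit of the base vertex is a copy of the regular action on the quotient by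
    \<open>F\<close>, so a word over \<open>J\<close> in the kernel of \<rho>' has trivial
    \<open>F\<close> and acts trivially on \<open>S\<close>.\<close>
  have base: "fold \<rho>' u (({}, block {} []), table n []) = (({}, block {} u), table n u)" if "u \<in> lists J" for u
    using that
  proof (induction u rule: rev_induct)
    case (snoc s u)
    have u: "u \<in> lists J" "s \<in> J" using snoc.prems by auto
    have sV: "s \<in> V" using u JV by blast
    have cs: "clique V E (insert s {})" "clique V E (insert s {s})" using sV by (auto simp: clique_def)
    have T: "table n u \<in> T" "table n (u @ [s]) \<in> T" using lJV u sV unfolding T_def by auto
    have W: "W s (table n x) x" if "x \<in> lists J" for x using W_table[OF lJV[OF that] sV] weight_cong_equivp(1) by blast
    have "\<theta> s (table n u) ({}, block {} u) = ({s}, block {s} u)"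
      using \<theta>_move[OF u(2) cs(1) _ u(1) T(1) W[OF u(1)]] by (simp add: toggle_def)
    moreover have "block {s} (u @ [s]) = block {s} u"
      using u by (intro block_eq) (auto simp: block_def intro!: bexI[of _ "[s]"])
    moreover have "\<theta> s (table n (u @ [s])) ({s}, block {s} (u @ [s])) = ({}, block {} (u @ [s]))"
      using \<theta>_move[OF u(2) cs(2) _ _ T(2) W[of "u @ [s]"]] u by (simp add: toggle_def)
    ultimately show ?case using snoc.IH[OF u(1)] r1[OF lJV[OF u(1)] sV] by (simp add: \<rho>'_def)
  qed simp
  show ?thesis
  proof (rule that[OF kernel_fin_index_normal(1)[OF cong]])
    fix u z assume u: "u \<in> lists J"
      "cls V E m u \<in> cls V E m ` {u \<in> lists V. restrict (fold \<rho>' u) (S' \<times> T) = restrict (fold \<rho>' []) (S' \<times> T)}" and z: "z \<in> S"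
    then have e: "restrict (fold \<rho>' u) (S' \<times> T) = restrict (fold \<rho>' []) (S' \<times> T)"
      using kernel_fin_index_normal(2)[OF cong lJV] by blast
    have "(({}, block {} []), table n []) \<in> S' \<times> T" unfolding S'_def T_def by (auto simp: clique_def)
    then have "fold \<rho>' u (({}, block {} []), table n []) = (({}, block {} []), table n [])"
      using fun_cong[OF e, of "(({}, block {} []), table n [])"] by simp
    then have "block {} u = block {} []" using base[OF u(1)] by simp
    then have "u \<in> block {} []" using block_self[OF u(1)] by blast
    then have "F u = F []" by (simp add: block_def)
    then have "restrict (fold \<rho> u) S = restrict (fold \<rho> []) S" by (simp add: F_def)
    from fun_cong[OF this, of z] show "fold \<rho> u z = z" using z by simp
  qed
qed

end

section \<open>Profinite trees\<close>

text \<open>Every orbit has exactly \<open>p\<close> points, since a period prime to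
  \<open>p\<close> would force a fixed point. After the choice of a base point in each orbit, \<psi>
  counts the steps from it.\<close>

lemma free_action_coordinate:
  fixes g :: "'k \<Rightarrow> 'k" and p :: nat
  assumes p: "Factorial_Ring.prime p" and gZ: "\<And>z. z \<in> Z \<Longrightarrow> g z \<in> Z"
    and per: "\<And>z. z \<in> Z \<Longrightarrow> (g ^^ p) z = z" and free: "\<And>z. z \<in> Z \<Longrightarrow> g z \<noteq> z"
  obtains \<psi> :: "'k \<Rightarrow> int" where "\<And>z. z \<in> Z \<Longrightarrow> [\<psi> (g z) = \<psi> z + 1] (mod int p)"
proof -
  have itZ: "(g ^^ k) z \<in> Z" if "z \<in> Z" for z k
    using that gZ by (induction k) auto
  have mult: "(g ^^ (p * k)) z = z" if "z \<in> Z" for z k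
    using that per by (induction k) (auto simp: funpow_add)
  have multd: "(g ^^ (d * k)) z = z" if "(g ^^ d) z = z" for z d k
    using that by (induction k) (auto simp: funpow_add)
  \<comment> \<open>In place of an inverse of \<open>g\<close>, another k(p-1) applications complete
    k to a multiple of \<open>p\<close>.\<close>
  have cancel: "(g ^^ d) y = y" if y: "y \<in> Z" and e: "(g ^^ (k + d)) y = (g ^^ k) y" for y k d
  proof -
    have "(g ^^ (k * (p - 1) + (k + d))) y = (g ^^ (k * (p - 1) + k)) y"
      unfolding funpow_add[of "k * (p - 1)"] comp_apply e ..
    moreover have "k * (p - 1) + k = p * k" and "k * (p - 1) + (k + d) = d + p * k"
      using prime_gt_0_nat[OF p] by (cases p; simp)+
    ultimately have "(g ^^ (d + p * k)) y = (g ^^ (p * k)) y" by (simp only:)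
    then have "(g ^^ d) ((g ^^ (p * k)) y) = (g ^^ (p * k)) y"
      unfolding funpow_add comp_apply .
    then show ?thesis
      using mult[OF y] by simp
  qed
  have dvd: "p dvd d" if y: "y \<in> Z" and e: "(g ^^ d) y = y" for y d
  proof (rule ccontr)
    assume "\<not> p dvd d"
    then have "coprime d p"
      using p by (metis coprime_commute prime_imp_coprime)
    then obtain a where "[d * a = 1] (mod p)"
      using cong_solve_coprime_nat[of d p] by auto
    then have "(d * a) mod p = 1"
      using prime_gt_1_nat[OF p] by (simp add: Cong.cong_def)
    then have "d * a = p * (d * a div p) + 1"
      by (metis mult_div_mod_eq)
    then have "(g ^^ (d * a)) y = g y"
      using mult[OF y, of "d * a div p"] by (metis Suc_eq_plus1 comp_apply funpow.simps(2))
    with multd[OF e, of a] free[OF y] show False by simp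
  qed
  have uniq: "[int k = int l] (mod int p)" if y: "y \<in> Z" and e: "(g ^^ k) y = (g ^^ l) y" for y k l
  proof (cases "k \<le> l")
    case True
    then have "p dvd (l - k)"
      using dvd[OF y] cancel[OF y, of k "l - k"] e by simp
    then show ?thesis
      using True by (metis cong_altdef_nat cong_int_iff cong_sym)
  next
    case False
    then have "p dvd (k - l)"
      using dvd[OF y] cancel[OF y, of l "k - l"] e by simp
    then show ?thesis
      using False by (metis cong_altdef_nat cong_int_iff nat_le_linear)
  qed
  define orb where "orb z = {(g ^^ k) z | k. True}" for z
  have orb_g: "orb (g z) = orb z" if z: "z \<in> Z" for z
  proof -
    have 1: "(g ^^ k) (g z) = (g ^^ Suc k) z" for k
      by (simp add: funpow_swap1)
    have "(g ^^ k) z = (g ^^ (k + (p - 1))) (g z)" for k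
    proof -
      have "(g ^^ (k + (p - 1))) (g z) = (g ^^ (k + p)) z"
        unfolding 1 using prime_gt_0_nat[OF p] by (simp del: funpow.simps)
      then show ?thesis using per[OF z] by (simp add: funpow_add)
    qed
    then show ?thesis unfolding orb_def using 1 by blast
  qed
  define r where "r z = (SOME y. y \<in> orb z)" for z
  define c where "c z = (SOME k. (g ^^ k) (r z) = z)" for z
  have r_in: "r z \<in> orb z" for z
    unfolding r_def by (rule someI[of _ z]) (auto simp: orb_def intro: exI[of _ 0])
  have c: "(g ^^ c z) (r z) = z" and rZ: "r z \<in> Z" if z: "z \<in> Z" for z
  proof -
    obtain k where k: "r z = (g ^^ k) z" using r_in[of z] by (auto simp: orb_def)
    have "k * (p - 1) + k = p * k"
      using prime_gt_0_nat[OF p] by (cases p) auto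
    then have "(g ^^ (k * (p - 1))) (r z) = z"
      using mult[OF z, of k] unfolding k by (metis comp_apply funpow_add)
    then show "(g ^^ c z) (r z) = z" unfolding c_def by (rule someI)
    show "r z \<in> Z" using k itZ[OF z] by simp
  qed
  have "[int (c (g z)) = int (c z) + 1] (mod int p)" if z: "z \<in> Z" for z
  proof -
    have rr: "r (g z) = r z" unfolding r_def using orb_g[OF z] by simp
    have "(g ^^ c (g z)) (r z) = (g ^^ (c z + 1)) (r z)"
      using c[OF gZ[OF z]] c[OF z] rr by simp
    from uniq[OF rZ[OF z] this] show ?thesis by (simp add: add.commute)
  qed
  then show ?thesis by (rule that)
qed

text \<open>A point of \<open>\<Omega>\<close> is an edge of a profinite bipartite graph, and \<open>key b i\<close> is its end vertex of type
  \<open>b\<close> as seen in the finite graph of level \<open>i\<close>. The last axiom expresses that the graph is simply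
  connected.\<close>
locale pro_tree =
  fixes \<Omega> :: "'x set" and I :: "'i set" and le :: "'i \<Rightarrow> 'i \<Rightarrow> bool"
    and key :: "bool \<Rightarrow> 'i \<Rightarrow> 'x \<Rightarrow> 'k"
  assumes directed: "\<And>i j. i \<in> I \<Longrightarrow> j \<in> I \<Longrightarrow> \<exists>k\<in>I. le i k \<and> le j k"
    and nonempty: "I \<noteq> {}"
    and coarser: "\<And>b i j u v. \<lbrakk>i \<in> I; j \<in> I; le i j; u \<in> \<Omega>; v \<in> \<Omega>; key b j u = key b j v\<rbrakk>
      \<Longrightarrow> key b i u = key b i v"
    and compact: "\<And>R. \<lbrakk>\<And>i. i \<in> I \<Longrightarrow> R i \<subseteq> \<Omega>; \<And>i. i \<in> I \<Longrightarrow> R i \<noteq> {};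
        \<And>i u v. \<lbrakk>i \<in> I; u \<in> R i; v \<in> \<Omega>; \<And>b. key b i u = key b i v\<rbrakk> \<Longrightarrow> v \<in> R i;
        \<And>i j. \<lbrakk>i \<in> I; j \<in> I; le i j\<rbrakk> \<Longrightarrow> R j \<subseteq> R i\<rbrakk> \<Longrightarrow> \<exists>x. \<forall>i\<in>I. x \<in> R i"
    and potential: "\<And>i f n. \<lbrakk>i \<in> I; (n::int) > 0;
        \<And>u v. \<lbrakk>u \<in> \<Omega>; v \<in> \<Omega>; \<And>b. key b i u = key b i v\<rbrakk> \<Longrightarrow> f u = f v\<rbrakk>
      \<Longrightarrow> \<exists>\<phi>. (\<forall>b. \<exists>j\<in>I. \<forall>u\<in>\<Omega>. \<forall>v\<in>\<Omega>. key b j u = key b j v \<longrightarrow> \<phi> b u = (\<phi> b v :: int))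
            \<and> (\<forall>u\<in>\<Omega>. [\<phi> True u - \<phi> False u = f u] (mod n))"
begin

text \<open>Functions and sets of vertices are carried by the edges. Factoring through
  \<open>key b i\<close> at some level \<open>i\<close> expresses local constancy on the vertices of
  type \<open>b\<close>.\<close>

definition lc :: "bool \<Rightarrow> ('x \<Rightarrow> 'z) \<Rightarrow> bool" where
  "lc b \<gamma> \<longleftrightarrow> (\<exists>i\<in>I. \<forall>u\<in>\<Omega>. \<forall>v\<in>\<Omega>. key b i u = key b i v \<longrightarrow> \<gamma> u = \<gamma> v)"

definition cld :: "bool \<Rightarrow> 'x set \<Rightarrow> bool" where
  "cld b S \<longleftrightarrow> S \<subseteq> \<Omega> \<and> (\<forall>u\<in>\<Omega>. (\<forall>i\<in>I. \<exists>y\<in>S. key b i u = key b i y) \<longrightarrow> u \<in> S)"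

text \<open>A subgraph is given by its vertices, represented by the sets \<open>Y b\<close> of edges having an end of type
  \<open>b\<close> in it; it contains an edge when it contains both ends. A locally constant function that agrees on
  the two ends of each edge must be constant.\<close>
definition subtree :: "(bool \<Rightarrow> 'x set) \<Rightarrow> bool" where
  "subtree Y \<longleftrightarrow> (\<forall>b. cld b (Y b)) \<and> (\<exists>b. Y b \<noteq> {})
     \<and> (\<forall>\<gamma> :: bool \<Rightarrow> 'x \<Rightarrow> int. (\<forall>b. lc b (\<gamma> b)) \<longrightarrow> (\<forall>u\<in>Y True \<inter> Y False. \<gamma> True u = \<gamma> False u)
          \<longrightarrow> (\<exists>c. \<forall>b. \<forall>u\<in>Y b. \<gamma> b u = c))"

text \<open>The levels are respected one by one, so an automorphism induces an injective map on the
  vertices of each finite graph.\<close>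

definition aut :: "('x \<Rightarrow> 'x) \<Rightarrow> bool" where
  "aut x \<longleftrightarrow> (\<forall>u\<in>\<Omega>. x u \<in> \<Omega>)
     \<and> (\<forall>b. \<forall>i\<in>I. \<forall>u\<in>\<Omega>. \<forall>v\<in>\<Omega>. key b i (x u) = key b i (x v) \<longleftrightarrow> key b i u = key b i v)"

definition Fix :: "('x \<Rightarrow> 'x) \<Rightarrow> bool \<Rightarrow> 'x set" where
  "Fix x b = {u\<in>\<Omega>. \<forall>i\<in>I. key b i (x u) = key b i u}"

section \<open>Locally constant functions and compactness\<close>

lemma level_lc:
  "i \<in> I \<Longrightarrow> (\<And>u v. u \<in> \<Omega> \<Longrightarrow> v \<in> \<Omega> \<Longrightarrow> key b i u = key b i v \<Longrightarrow> \<gamma> u = \<gamma> v) \<Longrightarrow> lc b \<gamma>"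
  unfolding lc_def by blast

lemma potential_lc:
  assumes "i \<in> I" "(n::int) > 0"
    and "\<And>u v. u \<in> \<Omega> \<Longrightarrow> v \<in> \<Omega> \<Longrightarrow> (\<And>b. key b i u = key b i v) \<Longrightarrow> f u = f v"
  obtains \<phi> where "\<And>b. lc b (\<phi> b)" "\<And>u. u \<in> \<Omega> \<Longrightarrow> [\<phi> True u - \<phi> False u = f u] (mod n)"
proof -
  have "\<exists>\<phi>. (\<forall>b. lc b (\<phi> b)) \<and> (\<forall>u\<in>\<Omega>. [\<phi> True u - \<phi> False u = f u] (mod n))"
    unfolding lc_def by (rule potential[OF assms(1,2)]) (rule assms(3))
  then show ?thesis using that by blast
qed

lemma lc_combine:
  assumes "lc b \<gamma>" and "lc b \<eta>"
  shows "lc b (\<lambda>u. h (\<gamma> u) (\<eta> u))"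
proof -
  obtain i j where "i \<in> I" "j \<in> I" and
    i: "\<And>u v. u \<in> \<Omega> \<Longrightarrow> v \<in> \<Omega> \<Longrightarrow> key b i u = key b i v \<Longrightarrow> \<gamma> u = \<gamma> v" and
    j: "\<And>u v. u \<in> \<Omega> \<Longrightarrow> v \<in> \<Omega> \<Longrightarrow> key b j u = key b j v \<Longrightarrow> \<eta> u = \<eta> v"
    using assms unfolding lc_def by blast
  then obtain k where "k \<in> I" "le i k" "le j k" using directed by blast
  show ?thesis
  proof (rule level_lc[OF \<open>k \<in> I\<close>])
    fix u v assume "u \<in> \<Omega>" "v \<in> \<Omega>" "key b k u = key b k v"
    then have "key b i u = key b i v" "key b j u = key b j v"
      using coarser \<open>i \<in> I\<close> \<open>j \<in> I\<close> \<open>k \<in> I\<close> \<open>le i k\<close> \<open>le j k\<close> by blast+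
    then show "h (\<gamma> u) (\<eta> u) = h (\<gamma> v) (\<eta> v)"
      using i[of u v] j[of u v] \<open>u \<in> \<Omega>\<close> \<open>v \<in> \<Omega>\<close> by simp
  qed
qed

lemma lc_common:
  assumes "\<And>b. lc b (\<gamma> b)"
  obtains i where "i \<in> I" "\<And>b u v. u \<in> \<Omega> \<Longrightarrow> v \<in> \<Omega> \<Longrightarrow> key b i u = key b i v \<Longrightarrow> \<gamma> b u = \<gamma> b v"
proof -
  have "\<exists>i\<in>I. \<forall>u\<in>\<Omega>. \<forall>v\<in>\<Omega>. key b i u = key b i v \<longrightarrow> \<gamma> b u = \<gamma> b v" for b
    using assms unfolding lc_def by blast
  then obtain lev where lev: "\<And>b. lev b \<in> I"
    "\<And>b u v. u \<in> \<Omega> \<Longrightarrow> v \<in> \<Omega> \<Longrightarrow> key b (lev b) u = key b (lev b) v \<Longrightarrow> \<gamma> b u = \<gamma> b v"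
    by metis
  obtain i where i: "i \<in> I" "le (lev True) i" "le (lev False) i" using directed lev(1) by blast
  have "le (lev b) i" for b using i by (cases b) auto
  then show ?thesis using that[OF i(1)] lev(2) coarser[OF lev(1) i(1)] by blast
qed

lemma lc_const: "lc b (\<lambda>u. c)"
  using nonempty unfolding lc_def by blast

lemma lc_comp: "lc b \<gamma> \<Longrightarrow> lc b (\<lambda>u. h (\<gamma> u))"
  unfolding lc_def by metis

lemma lc_aut:
  assumes "lc b \<gamma>" "aut x" shows "lc b (\<lambda>u. \<gamma> (x u))"
  using assms unfolding lc_def aut_def by metis

lemma lc_sum:
  fixes \<gamma> :: "nat \<Rightarrow> 'x \<Rightarrow> int"
  assumes "\<And>k. lc b (\<gamma> k)" shows "lc b (\<lambda>u. \<Sum>k<n. \<gamma> k u)"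
proof (induction n)
  case 0 show ?case by (simp add: lc_const)
next
  case (Suc n)
  show ?case using lc_combine[OF Suc assms[of n], of "(+)"] by simp
qed

lemma aut_funpow: assumes "aut x" shows "aut (x ^^ k)"
proof (induction k)
  case (Suc k)
  then show ?case using assms by (simp add: aut_def)
qed (auto simp: aut_def)

text \<open>Compactness in contrapositive form: a condition that no edge satisfies at all levels is
  satisfied by no edge at some level. The base \<open>i0\<close> is there because \<open>P\<close>
  may involve functions that depend only on keys of level \<open>i0\<close> or finer.\<close>

lemma escape_level:
  assumes base: "i0 \<in> I"
    and sat: "\<And>i u v. \<lbrakk>i \<in> I; le i0 i; u \<in> \<Omega>; v \<in> \<Omega>; \<And>b. key b i u = key b i v; P i u\<rbrakk> \<Longrightarrow> P i v"
    and decr: "\<And>i j u. \<lbrakk>i \<in> I; j \<in> I; le i j; u \<in> \<Omega>; P j u\<rbrakk> \<Longrightarrow> P i u"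
    and esc: "\<And>u. u \<in> \<Omega> \<Longrightarrow> (\<And>i. i \<in> I \<Longrightarrow> P i u) \<Longrightarrow> False"
  obtains i where "i \<in> I" "le i0 i" "\<And>u. u \<in> \<Omega> \<Longrightarrow> \<not> P i u"
proof -
  have "\<exists>i\<in>I. \<forall>u\<in>\<Omega>. \<not> P i u"
  proof (rule ccontr)
    assume neg: "\<not> (\<exists>i\<in>I. \<forall>u\<in>\<Omega>. \<not> P i u)"
    define R where "R i = {u\<in>\<Omega>. \<exists>v\<in>\<Omega>. (\<forall>b. key b i v = key b i u) \<and> P i v}" for i
    have "\<exists>x. \<forall>i\<in>I. x \<in> R i"
    proof (rule compact)
      show "R j \<subseteq> R i" if ij: "i \<in> I" "j \<in> I" "le i j" for i j
      proof
        fix u assume "u \<in> R j"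
        then obtain v where "u \<in> \<Omega>" "v \<in> \<Omega>" "\<forall>b. key b j v = key b j u" "P j v"
          by (auto simp: R_def)
        then have "\<forall>b. key b i v = key b i u" "P i v"
          using coarser[OF ij] decr[OF ij] by blast+
        then show "u \<in> R i" using \<open>u \<in> \<Omega>\<close> \<open>v \<in> \<Omega>\<close> by (auto simp: R_def)
      qed
      show "R i \<noteq> {}" if "i \<in> I" for i
        using neg that unfolding R_def by blast
    qed (auto simp: R_def)
    then obtain u where u: "\<And>i. i \<in> I \<Longrightarrow> u \<in> R i" by blast
    have "u \<in> \<Omega>" using u[OF base] by (simp add: R_def)
    have "P i u" if "i \<in> I" for i
    proof -
      obtain k where k: "k \<in> I" "le i k" "le i0 k" using directed \<open>i \<in> I\<close> base by blast
      then obtain v where "v \<in> \<Omega>" "\<forall>b. key b k v = key b k u" "P k v"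
        using u[of k] by (auto simp: R_def)
      then have "P k u" using sat k \<open>u \<in> \<Omega>\<close> by blast
      then show ?thesis using decr k \<open>i \<in> I\<close> \<open>u \<in> \<Omega>\<close> by blast
    qed
    then show False using esc \<open>u \<in> \<Omega>\<close> by blast
  qed
  then obtain i where i: "i \<in> I" "\<forall>u\<in>\<Omega>. \<not> P i u" by blast
  obtain k where k: "k \<in> I" "le i k" "le i0 k" using directed i(1) base by blast
  show ?thesis
    using that[OF k(1) k(3)] decr[OF i(1) k(1) k(2)] i(2) by blast
qed

lemma cld_Fix:
  assumes "cld b S" "aut x" shows "cld b (S \<inter> Fix x b)"
  unfolding cld_def
proof (intro conjI ballI impI)
  show "S \<inter> Fix x b \<subseteq> \<Omega>" by (auto simp: Fix_def)
  fix u assume u: "u \<in> \<Omega>" "\<forall>i\<in>I. \<exists>y\<in>S \<inter> Fix x b. key b i u = key b i y"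
  then have "u \<in> S" using assms(1) unfolding cld_def by blast
  moreover have "key b i (x u) = key b i u" if i: "i \<in> I" for i
  proof -
    obtain y where y: "y \<in> Fix x b" "key b i u = key b i y" using u(2) i by blast
    then have "key b i (x y) = key b i y" "y \<in> \<Omega>" using i by (auto simp: Fix_def)
    moreover have "key b i (x u) = key b i (x y)"
      using assms(2) y \<open>y \<in> \<Omega>\<close> u(1) i unfolding aut_def by blast
    ultimately show ?thesis using y by simp
  qed
  ultimately show "u \<in> S \<inter> Fix x b" using u(1) by (simp add: Fix_def)
qed

lemma cld_Int: "cld b S \<Longrightarrow> cld b T \<Longrightarrow> cld b (S \<inter> T)"
  unfolding cld_def by (meson IntD1 IntD2 IntI le_infI1)

lemma cldD:
  "cld b S \<Longrightarrow> u \<in> \<Omega> \<Longrightarrow> (\<And>i. i \<in> I \<Longrightarrow> \<exists>y\<in>S. key b i u = key b i y) \<Longrightarrow> u \<in> S"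
  unfolding cld_def by blast

lemma subtreeD:
  fixes \<gamma> :: "bool \<Rightarrow> 'x \<Rightarrow> int"
  assumes "subtree Y" "\<And>b. lc b (\<gamma> b)" "\<And>u. u \<in> Y True \<Longrightarrow> u \<in> Y False \<Longrightarrow> \<gamma> True u = \<gamma> False u"
  obtains c where "\<And>b u. u \<in> Y b \<Longrightarrow> \<gamma> b u = c"
  using assms unfolding subtree_def by (metis IntD1 IntD2)

lemma subtree_sub: "subtree Y \<Longrightarrow> Y b \<subseteq> \<Omega>"
  unfolding subtree_def cld_def by blast

lemma subtree_cld: "subtree Y \<Longrightarrow> cld b (Y b)"
  unfolding subtree_def by blast

lemma key_map:
  assumes "aut x" "i \<in> I"
  obtains g where "\<And>u k. u \<in> \<Omega> \<Longrightarrow> (g ^^ k) (key b i u) = key b i ((x ^^ k) u)"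
proof -
  define g where "g z = key b i (x (SOME u. u \<in> \<Omega> \<and> key b i u = z))" for z
  have 1: "g (key b i u) = key b i (x u)" if "u \<in> \<Omega>" for u
  proof -
    have "\<exists>v. v \<in> \<Omega> \<and> key b i v = key b i u" using that by blast
    from someI_ex[OF this] show ?thesis
      unfolding g_def using assms that unfolding aut_def by blast
  qed
  have "(g ^^ k) (key b i u) = key b i ((x ^^ k) u)" if "u \<in> \<Omega>" for u k
  proof (induction k)
    case (Suc k)
    have "(x ^^ k) u \<in> \<Omega>" using aut_funpow[OF assms(1)] that unfolding aut_def by blast
    then show ?case using Suc 1 by simp
  qed simp
  then show ?thesis by (rule that)
qed

text \<open>Otherwise \<open>x\<close> moves all vertices of \<open>Y\<close> at some finite level. Then some \<open>\<psi>\<close> with values in \<open>\<int>/p\<close>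
  satisfies \<open>\<psi> (x u) = \<psi> u + 1\<close>. Lifting its coboundary to \<open>\<int>/p\<^sup>2\<close> and integrating gives \<open>\<phi>\<close> with
  \<open>\<phi> (x u) = \<phi> u + \<kappa>\<close> where \<open>\<kappa> = 1\<close> modulo \<open>p\<close>, so \<open>x ^ p\<close> acts nontrivially.\<close>
lemma fixed_vertex:
  assumes Y: "subtree Y" and x: "aut x" and p: "Factorial_Ring.prime (p::nat)"
    and inv: "\<And>b u. u \<in> Y b \<Longrightarrow> x u \<in> Y b"
    and per: "\<And>b u. u \<in> Y b \<Longrightarrow> u \<in> Fix (x ^^ p) b"
  shows "\<exists>b. Y b \<inter> Fix x b \<noteq> {}"
proof (rule ccontr)
  assume "\<not> ?thesis"
  then have nofix: "\<not> (\<forall>i\<in>I. key b i (x u) = key b i u)" if "u \<in> Y b" for u b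
    using that subtree_sub[OF Y] unfolding Fix_def by blast
  have lev: "\<exists>i\<in>I. \<forall>u\<in>Y b. key b i (x u) \<noteq> key b i u" for b
  proof -
    obtain i0 where "i0 \<in> I" using nonempty by blast
    define P where "P i u \<longleftrightarrow> (\<exists>y\<in>Y b. key b i u = key b i y) \<and> key b i (x u) = key b i u" for i u
    obtain i where "i \<in> I" "\<And>u. u \<in> \<Omega> \<Longrightarrow> \<not> P i u"
    proof (rule escape_level[OF \<open>i0 \<in> I\<close>, of P])
      show "P i v" if "i \<in> I" "le i0 i" "u \<in> \<Omega>" "v \<in> \<Omega>" "\<And>b. key b i u = key b i v" "P i u" for i u v
      proof -
        have "key b i (x u) = key b i (x v)" using x that unfolding aut_def by blast
        then show ?thesis using that unfolding P_def by metis
      qed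
      show "P i u" if h: "i \<in> I" "j \<in> I" "le i j" "u \<in> \<Omega>" "P j u" for i j u
      proof -
        obtain y where "y \<in> Y b" "key b j u = key b j y" and "key b j (x u) = key b j u"
          using h(5) unfolding P_def by blast
        then show ?thesis
          using coarser[OF h(1-3)] h(4) subtree_sub[OF Y] x unfolding P_def aut_def by blast
      qed
      show False if "u \<in> \<Omega>" "\<And>i. i \<in> I \<Longrightarrow> P i u" for u
      proof -
        have "u \<in> Y b" using subtree_cld[OF Y, of b] that unfolding P_def cld_def by blast
        with nofix[OF this] that(2) show False unfolding P_def by blast
      qed
    qed blast
    then show ?thesis using subtree_sub[OF Y] unfolding P_def by blast
  qed
  obtain lv where lv: "\<And>b. lv b \<in> I" "\<And>b u. u \<in> Y b \<Longrightarrow> key b (lv b) (x u) \<noteq> key b (lv b) u"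
    using lev by metis
  obtain i where i: "i \<in> I" "le (lv True) i" "le (lv False) i" using directed lv(1) by blast
  have lei: "le (lv b) i" for b using i by (cases b) auto
  have xX: "x u \<in> \<Omega>" if "u \<in> \<Omega>" for u using x that unfolding aut_def by blast
  have move: "key b i (x u) \<noteq> key b i u" if u: "u \<in> Y b" for b u
  proof -
    have "u \<in> \<Omega>" using u subtree_sub[OF Y] by blast
    then show ?thesis using lv(2)[OF u] coarser[OF lv(1) i(1) lei xX] by blast
  qed
  have "\<exists>\<psi> :: 'k \<Rightarrow> int. \<forall>u\<in>Y b. [\<psi> (key b i (x u)) = \<psi> (key b i u) + 1] (mod int p)" for b
  proof -
    obtain g where g: "\<And>u k. u \<in> \<Omega> \<Longrightarrow> (g ^^ k) (key b i u) = key b i ((x ^^ k) u)"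
      using key_map[OF x i(1), where b = b] by blast
    have YX: "u \<in> \<Omega>" if "u \<in> Y b" for u using that subtree_sub[OF Y] by blast
    have g1: "g (key b i u) = key b i (x u)" if "u \<in> \<Omega>" for u using g[OF that, of 1] by simp
    obtain \<psi> where "\<And>z. z \<in> key b i ` Y b \<Longrightarrow> [\<psi> (g z) = \<psi> z + 1] (mod int p)"
    proof (rule free_action_coordinate[OF p, where Z = "key b i ` Y b" and g = g])
      show "g z \<in> key b i ` Y b" if "z \<in> key b i ` Y b" for z using that YX inv g1 by auto
      show "(g ^^ p) z = z" if "z \<in> key b i ` Y b" for z
        using that YX per i(1) g unfolding Fix_def by auto
      show "g z \<noteq> z" if "z \<in> key b i ` Y b" for z using that YX move g1 by auto
    qed blast
    then have "[\<psi> (key b i (x u)) = \<psi> (key b i u) + 1] (mod int p)" if "u \<in> Y b" for u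
      using g1[OF YX[OF that]] that by (metis imageI)
    then show ?thesis by blast
  qed
  then obtain \<psi>' :: "bool \<Rightarrow> 'k \<Rightarrow> int" where
    \<psi>': "\<And>b u. u \<in> Y b \<Longrightarrow> [\<psi>' b (key b i (x u)) = \<psi>' b (key b i u) + 1] (mod int p)" by metis
  define \<psi> where "\<psi> b u = \<psi>' b (key b i u)" for b u
  have \<psi>x: "[\<psi> b (x u) = \<psi> b u + 1] (mod int p)" if "u \<in> Y b" for b u
    using \<psi>'[OF that] unfolding \<psi>_def .
  have lc\<psi>: "lc b (\<psi> b)" for b
    by (rule level_lc[OF i(1)]) (simp add: \<psi>_def)
  \<comment> \<open>Taking residues in \<open>{0..<p}\<close> lifts the coboundary from Z/p to
    Z/p^2; invariance under \<open>x\<close> becomes an equality of integers and survives the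
    lift.\<close>
  define f where "f u = (\<psi> True u - \<psi> False u) mod int p" for u
  have p0: "int p > 0" using prime_gt_0_nat[OF p] by simp
  then have pp: "(int p)^2 > 0" by simp
  obtain \<phi> where \<phi>: "\<And>b. lc b (\<phi> b)" and
    d\<phi>: "\<And>u. u \<in> \<Omega> \<Longrightarrow> [\<phi> True u - \<phi> False u = f u] (mod (int p)^2)"
  proof (rule potential_lc[OF i(1) pp, of f])
    show "f u = f v" if "\<And>b. key b i u = key b i v" for u v
      unfolding f_def \<psi>_def using that by simp
  qed blast
  have d\<phi>p: "[\<phi> True u - \<phi> False u = \<psi> True u - \<psi> False u] (mod int p)" if "u \<in> \<Omega>" for u
  proof -
    have "[\<phi> True u - \<phi> False u = f u] (mod int p)"
      using d\<phi>[OF that] by (rule cong_dvd_modulus) simp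
    then show ?thesis unfolding f_def by (simp add: Cong.cong_def)
  qed
  have lc\<phi>x: "lc b (\<lambda>u. \<phi> b (x u))" for b using lc_aut[OF \<phi> x] .
  \<comment> \<open>The coboundaries of \<phi> and of its translate by \<open>x\<close> agree modulo
    p^2 on \<open>Y\<close>, so connectedness makes their difference constant.\<close>
  obtain \<kappa> where \<kappa>: "\<And>b u. u \<in> Y b \<Longrightarrow> (\<phi> b (x u) - \<phi> b u) mod (int p)^2 = \<kappa>"
  proof (rule subtreeD[OF Y, where \<gamma> = "\<lambda>b u. (\<phi> b (x u) - \<phi> b u) mod (int p)^2"])
    show "lc b (\<lambda>u. (\<phi> b (x u) - \<phi> b u) mod (int p)^2)" for b
      using lc_combine[OF lc\<phi>x \<phi>, where h = "\<lambda>s t. (s - t) mod (int p)^2"] .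
    fix u assume u: "u \<in> Y True" "u \<in> Y False"
    then have uX: "u \<in> \<Omega>" using subtree_sub[OF Y] by blast
    have "[\<psi> True (x u) - \<psi> False (x u) = (\<psi> True u + 1) - (\<psi> False u + 1)] (mod int p)"
      using \<psi>x u by (intro cong_diff) auto
    then have "f (x u) = f u" unfolding f_def Cong.cong_def by simp
    then have "[\<phi> True (x u) - \<phi> False (x u) = \<phi> True u - \<phi> False u] (mod (int p)^2)"
      using d\<phi>[OF uX] d\<phi>[OF xX[OF uX]] by (metis cong_sym cong_trans)
    then have "[\<phi> True (x u) - \<phi> True u = \<phi> False (x u) - \<phi> False u] (mod (int p)^2)"
      by (simp add: cong_iff_dvd_diff algebra_simps)
    then show "(\<phi> True (x u) - \<phi> True u) mod (int p)^2 = (\<phi> False (x u) - \<phi> False u) mod (int p)^2"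
      by (simp add: Cong.cong_def)
  qed blast
  obtain \<nu> where \<nu>: "\<And>b u. u \<in> Y b \<Longrightarrow> (\<phi> b u - \<psi> b u) mod int p = \<nu>"
  proof (rule subtreeD[OF Y, where \<gamma> = "\<lambda>b u. (\<phi> b u - \<psi> b u) mod int p"])
    show "lc b (\<lambda>u. (\<phi> b u - \<psi> b u) mod int p)" for b
      using lc_combine[OF \<phi> lc\<psi>, where h = "\<lambda>s t. (s - t) mod int p"] .
    fix u assume "u \<in> Y True" "u \<in> Y False"
    then have "u \<in> \<Omega>" using subtree_sub[OF Y] by blast
    from d\<phi>p[OF this] have "[\<phi> True u - \<psi> True u = \<phi> False u - \<psi> False u] (mod int p)"
      by (simp add: cong_iff_dvd_diff algebra_simps)
    then show "(\<phi> True u - \<psi> True u) mod int p = (\<phi> False u - \<psi> False u) mod int p"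
      by (simp add: Cong.cong_def)
  qed blast
  obtain b u where u: "u \<in> Y b" using Y unfolding subtree_def by blast
  have it: "(x ^^ k) u \<in> Y b" for k using u inv by (induction k) auto
  have it\<phi>: "[\<phi> b ((x ^^ k) u) = \<phi> b u + int k * \<kappa>] (mod (int p)^2)" for k
  proof (induction k)
    case (Suc k)
    have "[\<phi> b (x ((x ^^ k) u)) - \<phi> b ((x ^^ k) u) = \<kappa>] (mod (int p)^2)"
      using \<kappa>[OF it[of k]] by (metis cong_mod_right cong_refl)
    from cong_add[OF this Suc] show ?case by (simp add: algebra_simps)
  qed simp
  have uX: "u \<in> \<Omega>" using u subtree_sub[OF Y] by blast
  \<comment> \<open>The p-th power of \<open>x\<close> fixes the vertex, so p \<kappa> is 0 modulo
    p^2 and \<open>p\<close> divides \<kappa>; comparison of \<phi> with \<psi> gives \<kappa> = 1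
    modulo \<open>p\<close>.\<close>
  have "\<phi> b ((x ^^ p) u) = \<phi> b u"
  proof -
    obtain j where j: "j \<in> I" "\<And>u v. u \<in> \<Omega> \<Longrightarrow> v \<in> \<Omega> \<Longrightarrow> key b j u = key b j v \<Longrightarrow> \<phi> b u = \<phi> b v"
      using \<phi>[of b] unfolding lc_def by blast
    have "(x ^^ p) u \<in> \<Omega>" using it subtree_sub[OF Y] by blast
    then show ?thesis using j uX per[OF u] unfolding Fix_def by blast
  qed
  with it\<phi>[of p] have "(int p)^2 dvd int p * \<kappa>"
    by (metis add.right_neutral cong_add_lcancel cong_0_iff cong_sym)
  then have "int p dvd \<kappa>" using p0 by (simp add: power2_eq_square)
  moreover have "[\<kappa> = 1] (mod int p)"
  proof -
    have "[\<phi> b (x u) - \<phi> b u = \<kappa>] (mod (int p)^2)"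
      using \<kappa>[OF u] by (metis cong_mod_right cong_refl)
    then have a: "[\<phi> b (x u) - \<phi> b u = \<kappa>] (mod int p)" by (rule cong_dvd_modulus) simp
    have "[\<phi> b (x u) - \<psi> b (x u) = \<phi> b u - \<psi> b u] (mod int p)"
      using \<nu>[OF u] \<nu>[OF inv[OF u]] by (simp add: Cong.cong_def)
    from cong_add[OF this \<psi>x[OF u]] have "[\<phi> b (x u) = \<phi> b u + 1] (mod int p)"
      by (simp add: algebra_simps)
    then have "[\<phi> b (x u) - \<phi> b u = 1] (mod int p)"
      by (simp add: cong_iff_dvd_diff algebra_simps)
    with a show ?thesis by (metis cong_sym cong_trans)
  qed
  ultimately have "int p dvd 1"
    by (metis cong_dvd_iff)
  then show False using p by auto
qed

text \<open>For connectedness, extend a function on the fixed vertices to an \<open>x\<close>-invariant \<open>\<psi>\<close>. Its coboundary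
  vanishes on fixed edges, hence is the sum over the \<open>x\<close>-orbit of some cochain, which integrates to \<open>\<phi>\<close>.
  Then \<open>\<psi>\<close> is the orbit sum of \<open>\<phi>\<close> up to a constant, and this sum is \<open>0\<close> modulo \<open>p\<close> at fixed vertices.\<close>
lemma fixed_subtree:
  assumes Y: "subtree Y" and x: "aut x" and p: "Factorial_Ring.prime (p::nat)"
    and inv: "\<And>b u. u \<in> Y b \<Longrightarrow> x u \<in> Y b"
    and per: "\<And>b u. u \<in> Y b \<Longrightarrow> u \<in> Fix (x ^^ p) b"
  shows "subtree (\<lambda>b. Y b \<inter> Fix x b)"
  unfolding subtree_def
proof (intro conjI allI impI)
  show "cld b (Y b \<inter> Fix x b)" for b using cld_Fix[OF subtree_cld[OF Y] x] .
  show "\<exists>b. Y b \<inter> Fix x b \<noteq> {}" using fixed_vertex[OF assms] .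
  then obtain b0 u0 where u0: "u0 \<in> Y b0" "u0 \<in> Fix x b0" by blast
  fix \<gamma> :: "bool \<Rightarrow> 'x \<Rightarrow> int"
  assume lc: "\<forall>b. lc b (\<gamma> b)"
    and edge: "\<forall>u\<in>(Y True \<inter> Fix x True) \<inter> (Y False \<inter> Fix x False). \<gamma> True u = \<gamma> False u"
  define c where "c = \<gamma> b0 u0"
  have YX: "u \<in> \<Omega>" if "u \<in> Y b" for u b using that subtree_sub[OF Y] by blast
  have xX: "x u \<in> \<Omega>" if "u \<in> \<Omega>" for u using x that unfolding aut_def by blast
  have xk: "key b i (x u) = key b i (x v) \<longleftrightarrow> key b i u = key b i v" if "i \<in> I" "u \<in> \<Omega>" "v \<in> \<Omega>" for b i u v
    using x that unfolding aut_def by blast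
  obtain i0 where i0: "i0 \<in> I" and
    \<gamma>0: "\<And>b u v. u \<in> \<Omega> \<Longrightarrow> v \<in> \<Omega> \<Longrightarrow> key b i0 u = key b i0 v \<Longrightarrow> \<gamma> b u = \<gamma> b v"
    using lc_common[of \<gamma>] lc by blast
  \<comment> \<open>The limit has no fixed edge of \<open>Y\<close> joining different values of
    \<gamma>. Hence none is left at some level \<open>k\<close> either, with membership in
    \<open>Y\<close> and fixedness tested at that level only.\<close>
  define P where "P i u \<longleftrightarrow> (\<forall>b. \<exists>y\<in>Y b. key b i u = key b i y) \<and> \<gamma> True u \<noteq> \<gamma> False u
     \<and> (\<forall>b. key b i (x u) = key b i u)" for i u
  obtain k where k: "k \<in> I" "le i0 k" and noP: "\<And>u. u \<in> \<Omega> \<Longrightarrow> \<not> P k u"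
  proof (rule escape_level[OF i0, of P])
    show "P i v" if h: "i \<in> I" "le i0 i" "u \<in> \<Omega>" "v \<in> \<Omega>" "\<And>b. key b i u = key b i v" "P i u" for i u v
    proof -
      have "\<gamma> b u = \<gamma> b v" for b using \<gamma>0[OF h(3,4)] coarser[OF i0 h(1,2,3,4,5)] by blast
      moreover have "key b i (x u) = key b i (x v)" for b using xk h by blast
      ultimately show ?thesis using h(5,6) unfolding P_def by simp
    qed
    show "P i u" if h: "i \<in> I" "j \<in> I" "le i j" "u \<in> \<Omega>" "P j u" for i j u
    proof -
      have "\<exists>y\<in>Y b. key b i u = key b i y" for b
        using h(5) coarser[OF h(1-3) h(4)] YX unfolding P_def by blast
      moreover have "key b i (x u) = key b i u" for b
        using h(5) coarser[OF h(1-3) xX[OF h(4)] h(4)] unfolding P_def by blast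
      ultimately show ?thesis using h(5) unfolding P_def by blast
    qed
    show False if u: "u \<in> \<Omega>" "\<And>i. i \<in> I \<Longrightarrow> P i u" for u
    proof -
      have "u \<in> Y b" for b using subtree_cld[OF Y, of b] u unfolding P_def cld_def by blast
      moreover have "u \<in> Fix x b" for b using u unfolding Fix_def P_def by blast
      ultimately have "\<gamma> True u = \<gamma> False u" using edge by blast
      then show False using u(2)[OF i0] unfolding P_def by blast
    qed
  qed blast
  define fx where "fx b u \<longleftrightarrow> key b k (x u) = key b k u" for b u
  have fxx: "fx b (x u) \<longleftrightarrow> fx b u" if "u \<in> \<Omega>" for b u
    unfolding fx_def using xk[OF k(1) xX[OF that] that] .
  have fxk: "fx b u \<longleftrightarrow> fx b v" if "u \<in> \<Omega>" "v \<in> \<Omega>" "key b k u = key b k v" for b u v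
    unfolding fx_def using xk[OF k(1) that(1,2)] that(3) by metis
  have \<gamma>k: "\<gamma> b u = \<gamma> b v" if "u \<in> \<Omega>" "v \<in> \<Omega>" "key b k u = key b k v" for b u v
    using \<gamma>0[OF that(1,2)] coarser[OF i0 k(1,2) that] by blast
  \<comment> \<open>The indicator of the value \<open>c\<close>, extended by 0 to the vertices that
    are not fixed at level \<open>k\<close>.\<close>
  define \<psi> where "\<psi> b u = (if fx b u \<and> \<gamma> b u = c then 1 else 0 :: int)" for b u
  have \<psi>k: "\<psi> b u = \<psi> b v" if "u \<in> \<Omega>" "v \<in> \<Omega>" "key b k u = key b k v" for b u v
    unfolding \<psi>_def using fxk[OF that] \<gamma>k[OF that] by simp
  have \<psi>x: "\<psi> b (x u) = \<psi> b u" if "u \<in> \<Omega>" for b u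
  proof (cases "fx b u")
    case True
    then show ?thesis using \<psi>k[OF xX[OF that] that] unfolding fx_def by blast
  next
    case False
    then show ?thesis using fxx[OF that] unfolding \<psi>_def by simp
  qed
  define e where "e u = \<psi> True u - \<psi> False u" for u
  define \<kappa> where "\<kappa> u = (key True k u, key False k u)" for u
  have emove: "\<kappa> (x u) \<noteq> \<kappa> u" if "u \<in> Y True" "u \<in> Y False" "e u \<noteq> 0" for u
  proof
    assume "\<kappa> (x u) = \<kappa> u"
    then have fu: "fx True u" "fx False u" unfolding \<kappa>_def fx_def by auto
    then have "\<gamma> True u \<noteq> \<gamma> False u" using that(3) unfolding e_def \<psi>_def by (auto split: if_splits)
    then have "P k u"
      unfolding P_def
    proof (intro conjI allI)
      show "\<exists>y\<in>Y b. key b k u = key b k y" for b using that by (cases b) auto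
      show "key b k (x u) = key b k u" for b using fu unfolding fx_def by (cases b) auto
    qed
    then show False using noP YX that by blast
  qed
  define Z where "Z = {\<kappa> u |u. u \<in> Y True \<inter> Y False \<and> \<kappa> (x u) \<noteq> \<kappa> u}"
  obtain gT where gT: "\<And>u n. u \<in> \<Omega> \<Longrightarrow> (gT ^^ n) (key True k u) = key True k ((x ^^ n) u)"
    using key_map[OF x k(1), where b = True] by blast
  obtain gF where gF: "\<And>u n. u \<in> \<Omega> \<Longrightarrow> (gF ^^ n) (key False k u) = key False k ((x ^^ n) u)"
    using key_map[OF x k(1), where b = False] by blast
  define g where "g = map_prod gT gF"
  have gn: "(g ^^ n) (\<kappa> u) = \<kappa> ((x ^^ n) u)" if "u \<in> \<Omega>" for u n
  proof -
    have "(g ^^ n) (s, t) = ((gT ^^ n) s, (gF ^^ n) t)" for s t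
      by (induction n) (auto simp: g_def)
    then show ?thesis unfolding \<kappa>_def using gT gF that by simp
  qed
  have g1: "g (\<kappa> u) = \<kappa> (x u)" if "u \<in> \<Omega>" for u using gn[OF that, of 1] by simp
  have \<kappa>x: "\<kappa> (x u) = \<kappa> (x v) \<longleftrightarrow> \<kappa> u = \<kappa> v" if "u \<in> \<Omega>" "v \<in> \<Omega>" for u v
    unfolding \<kappa>_def using xk[OF k(1) that] by simp
  obtain \<psi>' where \<psi>': "\<And>z. z \<in> Z \<Longrightarrow> [\<psi>' (g z) = \<psi>' z + 1] (mod int p)"
  proof (rule free_action_coordinate[OF p, where Z = Z and g = g])
    fix z assume "z \<in> Z"
    then obtain u where u: "u \<in> Y True" "u \<in> Y False" "\<kappa> (x u) \<noteq> \<kappa> u" and z: "z = \<kappa> u"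
      unfolding Z_def by blast
    have uX: "u \<in> \<Omega>" using u YX by blast
    show "g z \<noteq> z" unfolding z g1[OF uX] by (rule u)
    have "\<kappa> (x (x u)) \<noteq> \<kappa> (x u)" using \<kappa>x u xX uX by blast
    then show "g z \<in> Z" unfolding z g1[OF uX] Z_def using inv u by blast
    have "\<kappa> ((x ^^ p) u) = \<kappa> u"
      unfolding \<kappa>_def using per[OF u(1)] per[OF u(2)] k(1) by (auto simp: Fix_def)
    then show "(g ^^ p) z = z" unfolding z gn[OF uX] .
  qed blast
  \<comment> \<open>Keeps the coboundary \<open>e\<close> on one edge of each free orbit, the one
    with coordinate 0 modulo \<open>p\<close>, so that the orbit sum in \<open>trace\<close> returns
    \<open>e\<close>.\<close>
  define f where "f u = (if \<psi>' (\<kappa> u) mod int p = 0 \<and> \<kappa> (x u) \<noteq> \<kappa> u then e u else 0)" for u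
  have p0: "int p > 0" using prime_gt_0_nat[OF p] by simp
  have itY: "(x ^^ n) u \<in> Y b" if "u \<in> Y b" for n u b using that inv by (induction n) auto
  have itX: "(x ^^ n) u \<in> \<Omega>" if "u \<in> \<Omega>" for n u using that xX by (induction n) auto
  have trace: "(\<Sum>n<p. f ((x ^^ n) u)) = e u" if u: "u \<in> Y True" "u \<in> Y False" for u
  proof (cases "\<kappa> (x u) = \<kappa> u")
    case True
    have "f ((x ^^ n) u) = 0" for n
    proof -
      have "\<kappa> (x ((x ^^ n) u)) = \<kappa> ((x ^^ n) u)"
      proof (induction n)
        case (Suc n)
        then show ?case using \<kappa>x[OF itX[of u "Suc n"] itX[of u n]] YX u by simp
      qed (simp add: True)
      then show ?thesis by (simp add: f_def)
    qed
    moreover have "e u = 0" using True emove u by blast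
    ultimately show ?thesis by simp
  next
    case False
    have uX: "u \<in> \<Omega>" using u YX by blast
    have mv: "\<kappa> (x ((x ^^ n) u)) \<noteq> \<kappa> ((x ^^ n) u)" for n
    proof (induction n)
      case (Suc n)
      then show ?case using \<kappa>x[OF itX[of u "Suc n"] itX[of u n]] uX by simp
    qed (simp add: False)
    have inZ: "\<kappa> ((x ^^ n) u) \<in> Z" for n unfolding Z_def using mv itY u by blast
    have \<psi>n: "[\<psi>' (\<kappa> ((x ^^ n) u)) = \<psi>' (\<kappa> u) + int n] (mod int p)" for n
    proof (induction n)
      case (Suc n)
      have "[\<psi>' (\<kappa> (x ((x ^^ n) u))) = \<psi>' (\<kappa> ((x ^^ n) u)) + 1] (mod int p)"
        using \<psi>'[OF inZ[of n]] g1[OF itX[OF uX]] by simp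
      also have "[\<psi>' (\<kappa> ((x ^^ n) u)) + 1 = (\<psi>' (\<kappa> u) + int n) + 1] (mod int p)"
        using Suc by (intro cong_add) auto
      finally show ?case by (simp add: algebra_simps)
    qed simp
    have en: "e ((x ^^ n) u) = e u" for n
    proof (induction n)
      case (Suc n)
      then show ?case using \<psi>x[OF itX[OF uX, of n]] unfolding e_def by simp
    qed simp
    define n0 where "n0 = nat ((- \<psi>' (\<kappa> u)) mod int p)"
    have n0: "int n0 = (- \<psi>' (\<kappa> u)) mod int p" "n0 < p"
      using p0 unfolding n0_def by (simp_all add: nat_less_iff)
    have "f ((x ^^ n) u) = (if n = n0 then e u else 0)" if "n < p" for n
    proof -
      have "\<psi>' (\<kappa> ((x ^^ n) u)) mod int p = 0 \<longleftrightarrow> [\<psi>' (\<kappa> u) + int n = 0] (mod int p)"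
        using \<psi>n[of n] unfolding Cong.cong_def by simp
      also have "\<dots> \<longleftrightarrow> [int n = - \<psi>' (\<kappa> u)] (mod int p)"
        by (simp add: cong_iff_dvd_diff algebra_simps)
      also have "\<dots> \<longleftrightarrow> n = n0"
        using n0 that unfolding Cong.cong_def by (metis mod_less of_nat_eq_iff of_nat_mod)
      finally show ?thesis using mv en by (simp add: f_def)
    qed
    then have "(\<Sum>n<p. f ((x ^^ n) u)) = (\<Sum>n<p. if n = n0 then e u else 0)" by simp
    then show ?thesis using n0(2) by simp
  qed
  have fk: "f u = f v" if "u \<in> \<Omega>" "v \<in> \<Omega>" "\<And>b. key b k u = key b k v" for u v
  proof -
    have "\<kappa> u = \<kappa> v" using that(3) unfolding \<kappa>_def by simp
    moreover have "\<kappa> (x u) = \<kappa> (x v)" using \<kappa>x that(1,2) \<open>\<kappa> u = \<kappa> v\<close> by blast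
    moreover have "e u = e v" unfolding e_def using \<psi>k[OF that(1,2) that(3)] by simp
    ultimately show ?thesis unfolding f_def by simp
  qed
  obtain \<phi> where \<phi>: "\<And>b. lc b (\<phi> b)" and
    d\<phi>: "\<And>u. u \<in> \<Omega> \<Longrightarrow> [\<phi> True u - \<phi> False u = f u] (mod int p)"
    using potential_lc[OF k(1) p0, of f] fk by blast
  obtain d where d: "\<And>b u. u \<in> Y b \<Longrightarrow> ((\<Sum>n<p. \<phi> b ((x ^^ n) u)) - \<psi> b u) mod int p = d"
  proof (rule subtreeD[OF Y, where \<gamma> = "\<lambda>b u. ((\<Sum>n<p. \<phi> b ((x ^^ n) u)) - \<psi> b u) mod int p"])
    show "lc b (\<lambda>u. ((\<Sum>n<p. \<phi> b ((x ^^ n) u)) - \<psi> b u) mod int p)" for b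
    proof (rule lc_combine[of b _ _ "\<lambda>s t. (s - t) mod int p"])
      show "lc b (\<lambda>u. \<Sum>n<p. \<phi> b ((x ^^ n) u))"
        by (rule lc_sum) (rule lc_aut[OF \<phi> aut_funpow[OF x]])
      show "lc b (\<psi> b)" using level_lc[OF k(1)] \<psi>k by blast
    qed
    fix u assume u: "u \<in> Y True" "u \<in> Y False"
    have "[(\<Sum>n<p. \<phi> True ((x ^^ n) u) - \<phi> False ((x ^^ n) u)) = (\<Sum>n<p. f ((x ^^ n) u))] (mod int p)"
      using d\<phi> itX YX u by (intro cong_sum) blast
    then have "[(\<Sum>n<p. \<phi> True ((x ^^ n) u)) - \<psi> True u = (\<Sum>n<p. \<phi> False ((x ^^ n) u)) - \<psi> False u] (mod int p)"
      unfolding trace[OF u] e_def sum_subtractf by (simp add: cong_iff_dvd_diff algebra_simps)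
    then show "((\<Sum>n<p. \<phi> True ((x ^^ n) u)) - \<psi> True u) mod int p =
       ((\<Sum>n<p. \<phi> False ((x ^^ n) u)) - \<psi> False u) mod int p" by (simp add: Cong.cong_def)
  qed blast
  \<comment> \<open>At a fixed vertex the \<open>p\<close> terms of the orbit sum agree, so it
    vanishes modulo \<open>p\<close> and only -\<psi> is left. At \<open>u0\<close> this is -1,
    nonzero modulo \<open>p\<close>, which forces \<psi> = 1 at every fixed vertex of
    \<open>Y\<close>.\<close>
  have val: "(- of_bool (\<gamma> b u = c)) mod int p = d" if u: "u \<in> Y b" "u \<in> Fix x b" for b u
  proof -
    have uX: "u \<in> \<Omega>" using YX u by blast
    have "key b i ((x ^^ n) u) = key b i u" if "i \<in> I" for n i
    proof (induction n)
      case (Suc n)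
      then have "key b i (x ((x ^^ n) u)) = key b i (x u)"
        using xk[OF that itX[OF uX, of n] uX] by blast
      then show ?case using u(2) that unfolding Fix_def by simp
    qed simp
    then have "\<phi> b ((x ^^ n) u) = \<phi> b u" for n
      using \<phi>[of b] itX[OF uX] uX unfolding lc_def by blast
    then have s: "(\<Sum>n<p. \<phi> b ((x ^^ n) u)) = int p * \<phi> b u" by simp
    have "fx b u" using u(2) k(1) unfolding fx_def Fix_def by blast
    then have "\<psi> b u = of_bool (\<gamma> b u = c)" unfolding \<psi>_def by simp
    then show ?thesis using d[OF u(1)] unfolding s by (metis add.commute diff_conv_add_uminus mod_mult_self2)
  qed
  have "(- 1) mod int p = d" using val[OF u0] unfolding c_def by simp
  have "(- 1) mod int p \<noteq> 0" using prime_gt_1_nat[OF p] by (simp add: zmod_minus1)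
  show "\<exists>c. \<forall>b. \<forall>u\<in>Y b \<inter> Fix x b. \<gamma> b u = c"
  proof (intro exI[of _ c] allI ballI, rule ccontr)
    fix b u assume "u \<in> Y b \<inter> Fix x b" and "\<gamma> b u \<noteq> c"
    then show False using val[of u b] \<open>(- 1) mod int p = d\<close> \<open>(- 1) mod int p \<noteq> 0\<close> by simp
  qed
qed

text \<open>For a prime p dividing n, the power x^(n/p) has trivial p-th power on \<open>Y\<close>,
  so its fixed vertices form a subtree. There x^(n/p) is trivial and the induction continues; fixed
  vertices of \<open>x\<close> are not lost, being fixed by all its powers.\<close>

lemma fixed_subtree_torsion:
  assumes "subtree Y" "aut x" "\<And>b u. u \<in> Y b \<Longrightarrow> x u \<in> Y b" "n > 0"
    "\<And>b u. u \<in> Y b \<Longrightarrow> u \<in> Fix (x ^^ n) b"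
  shows "subtree (\<lambda>b. Y b \<inter> Fix x b)"
  using assms
proof (induction n arbitrary: Y rule: less_induct)
  case (less n)
  note Y = less.prems(1) and x = less.prems(2) and inv = less.prems(3) and per = less.prems(5)
  show ?case
  proof (cases "n = 1")
    case True
    then have "Y b \<inter> Fix x b = Y b" for b using per by auto
    then show ?thesis using Y by simp
  next
    case False
    then obtain p where p: "Factorial_Ring.prime p" "p dvd n" using prime_factor_nat by blast
    then obtain n' where n: "n = n' * p" by (metis dvdE mult.commute)
    have n': "n' > 0" "n' < n" using less.prems(4) prime_gt_1_nat[OF p(1)] n by auto
    define y where "y = x ^^ n'"
    have y: "aut y" unfolding y_def by (rule aut_funpow[OF x])
    have yp: "y ^^ p = x ^^ n" unfolding y_def n by (simp add: funpow_mult)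
    have invn: "(x ^^ k) u \<in> Y b" if "u \<in> Y b" for u b k using that inv by (induction k) auto
    have sub: "subtree (\<lambda>b. Y b \<inter> Fix y b)"
      using fixed_subtree[OF Y y p(1)] invn per unfolding yp by (simp add: y_def)
    have "subtree (\<lambda>b. (Y b \<inter> Fix y b) \<inter> Fix x b)"
    proof (rule less.IH[OF n'(2) sub x _ n'(1)])
      show "u \<in> Fix (x ^^ n') b" if "u \<in> Y b \<inter> Fix y b" for b u using that by (simp add: y_def)
      show "x u \<in> Y b \<inter> Fix y b" if u: "u \<in> Y b \<inter> Fix y b" for b u
      proof
        show "x u \<in> Y b" using u inv by blast
        have uX: "u \<in> \<Omega>" "y u \<in> \<Omega>" using u y unfolding Fix_def aut_def by blast+
        have "y (x u) = x (y u)" unfolding y_def by (simp add: funpow_swap1)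
        then show "x u \<in> Fix y b"
          using u uX x unfolding Fix_def aut_def by auto
      qed
    qed
    moreover have "(Y b \<inter> Fix y b) \<inter> Fix x b = Y b \<inter> Fix x b" for b
    proof -
      have "u \<in> Fix y b" if u: "u \<in> Fix x b" for u
      proof -
        have uX: "u \<in> \<Omega>" using u by (simp add: Fix_def)
        have "key b i ((x ^^ k) u) = key b i u" if "i \<in> I" for k i
        proof (induction k)
          case (Suc k)
          have "(x ^^ k) u \<in> \<Omega>" using aut_funpow[OF x] uX unfolding aut_def by blast
          then have "key b i (x ((x ^^ k) u)) = key b i (x u)"
            using Suc uX x that unfolding aut_def by blast
          then show ?case using u that unfolding Fix_def by simp
        qed simp
        then show ?thesis using uX unfolding Fix_def y_def by blast
      qed
      then show ?thesis by blast
    qed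
    ultimately show ?thesis by simp
  qed
qed

text \<open>By compactness the edges of \<open>Y\<close> where \<psi> jumps are separated, at a
  finite level, from the edges of \<open>Z\<close> and \<open>Z'\<close>. The coboundary of \<psi>,
  cut off outside a neighbourhood of the former, integrates to \<phi>.\<close>

lemma edge_cochain:
  fixes \<psi> :: "bool \<Rightarrow> 'x \<Rightarrow> int"
  assumes cld: "\<And>b. cld b (Y b)" "\<And>b. cld b (Z b)" "\<And>b. cld b (Z' b)"
    and \<psi>: "\<And>b. lc b (\<psi> b)" and n: "n > 0"
    and agree: "\<And>u. \<forall>b. u \<in> Y b \<Longrightarrow> (\<forall>b. u \<in> Z b) \<or> (\<forall>b. u \<in> Z' b) \<Longrightarrow> \<psi> True u = \<psi> False u"
  obtains \<phi> where "\<And>b. lc b (\<phi> b)"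
    "\<And>u. \<forall>b. u \<in> Y b \<Longrightarrow> [\<phi> True u - \<phi> False u = \<psi> True u - \<psi> False u] (mod n)"
    "\<And>u. (\<forall>b. u \<in> Z b) \<or> (\<forall>b. u \<in> Z' b) \<Longrightarrow> [\<phi> True u = \<phi> False u] (mod n)"
proof -
  obtain i0 where i0: "i0 \<in> I" and
    \<psi>0: "\<And>b u v. u \<in> \<Omega> \<Longrightarrow> v \<in> \<Omega> \<Longrightarrow> key b i0 u = key b i0 v \<Longrightarrow> \<psi> b u = \<psi> b v"
    using lc_common[OF \<psi>] by blast
  define M where "M = {u. (\<forall>b. u \<in> Y b) \<and> \<psi> True u \<noteq> \<psi> False u}"
  define E where "E = {u. (\<forall>b. u \<in> Z b) \<or> (\<forall>b. u \<in> Z' b)}"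
  have MX: "M \<subseteq> \<Omega>" and EX: "E \<subseteq> \<Omega>" using cld unfolding M_def E_def cld_def by blast+
  define P where "P i u \<longleftrightarrow> (\<exists>m\<in>M. \<forall>b. key b i u = key b i m) \<and> (\<exists>z\<in>E. \<forall>b. key b i u = key b i z)" for i u
  obtain k where k: "k \<in> I" "le i0 k" and noP: "\<And>u. u \<in> \<Omega> \<Longrightarrow> \<not> P k u"
  proof (rule escape_level[OF i0, of P])
    show "P i v" if "\<And>b. key b i u = key b i v" "P i u" for i u v
      using that unfolding P_def by simp
    show "P i u" if h: "i \<in> I" "j \<in> I" "le i j" "u \<in> \<Omega>" "P j u" for i j u
    proof -
      obtain m z where mz: "m \<in> M" "\<forall>b. key b j u = key b j m" "z \<in> E" "\<forall>b. key b j u = key b j z"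
        using h(5) unfolding P_def by blast
      then have "m \<in> \<Omega>" "z \<in> \<Omega>" using MX EX by blast+
      then have "\<forall>b. key b i u = key b i m" "\<forall>b. key b i u = key b i z"
        using coarser[OF h(1-4)] mz by blast+
      then show ?thesis using mz unfolding P_def by blast
    qed
    show False if u: "u \<in> \<Omega>" "\<And>i. i \<in> I \<Longrightarrow> P i u" for u
    proof -
      have "u \<in> Y b" for b
      proof -
        have "\<forall>i\<in>I. \<exists>y\<in>Y b. key b i u = key b i y" using u(2) unfolding P_def M_def by blast
        then show ?thesis using cld(1)[of b] u(1) unfolding cld_def by blast
      qed
      moreover have "\<psi> True u \<noteq> \<psi> False u"
      proof -
        obtain m where m: "m \<in> M" "\<forall>b. key b i0 u = key b i0 m" using u(2)[OF i0] unfolding P_def by blast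
        then have "\<psi> b u = \<psi> b m" for b using \<psi>0 u(1) MX by blast
        then show ?thesis using m unfolding M_def by simp
      qed
      moreover have "(\<forall>b. u \<in> Z b) \<or> (\<forall>b. u \<in> Z' b)"
      proof (rule ccontr)
        assume "\<not> ?thesis"
        then obtain b1 b2 where b: "u \<notin> Z b1" "u \<notin> Z' b2" by blast
        obtain i1 where i1: "i1 \<in> I" "\<forall>y\<in>Z b1. key b1 i1 u \<noteq> key b1 i1 y"
          using cld(2)[of b1] b u(1) unfolding cld_def by blast
        obtain i2 where i2: "i2 \<in> I" "\<forall>y\<in>Z' b2. key b2 i2 u \<noteq> key b2 i2 y"
          using cld(3)[of b2] b u(1) unfolding cld_def by blast
        obtain j where j: "j \<in> I" "le i1 j" "le i2 j" using directed i1 i2 by blast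
        obtain z where z: "z \<in> E" "\<forall>b. key b j u = key b j z" using u(2)[OF j(1)] unfolding P_def by blast
        then have "z \<in> \<Omega>" using EX by blast
        then have "key b1 i1 u = key b1 i1 z" "key b2 i2 u = key b2 i2 z"
          using coarser[OF i1(1) j(1,2) u(1)] coarser[OF i2(1) j(1,3) u(1)] z(2) by blast+
        then show False using i1(2) i2(2) z(1) unfolding E_def by blast
      qed
      ultimately show False using agree by blast
    qed
  qed blast
  define near where "near u \<longleftrightarrow> (\<exists>m\<in>M. \<forall>b. key b k u = key b k m)" for u
  define f where "f u = (if near u then \<psi> True u - \<psi> False u else 0)" for u
  have fk: "f u = f v" if h: "u \<in> \<Omega>" "v \<in> \<Omega>" "\<And>b. key b k u = key b k v" for u v
  proof -
    have "near u = near v" using h(3) unfolding near_def by simp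
    moreover have "\<psi> b u = \<psi> b v" for b
      using \<psi>0[OF h(1,2)] coarser[OF i0 k h(1,2) h(3)] by blast
    ultimately show ?thesis unfolding f_def by simp
  qed
  obtain \<phi> where \<phi>: "\<And>b. lc b (\<phi> b)" "\<And>u. u \<in> \<Omega> \<Longrightarrow> [\<phi> True u - \<phi> False u = f u] (mod n)"
    using potential_lc[OF k(1) n, of f] fk by blast
  show ?thesis
  proof (rule that[of \<phi>])
    show "lc b (\<phi> b)" for b by (rule \<phi>)
    fix u
    show "[\<phi> True u - \<phi> False u = \<psi> True u - \<psi> False u] (mod n)" if u: "\<forall>b. u \<in> Y b"
    proof -
      have "u \<in> \<Omega>" using u cld(1) unfolding cld_def by blast
      have "f u = \<psi> True u - \<psi> False u"
      proof (cases "\<psi> True u = \<psi> False u")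
        case False
        then have "near u" using u unfolding near_def M_def by blast
        then show ?thesis by (simp add: f_def)
      qed (simp add: f_def)
      then show ?thesis using \<phi>(2)[OF \<open>u \<in> \<Omega>\<close>] by simp
    qed
    show "[\<phi> True u = \<phi> False u] (mod n)" if u: "(\<forall>b. u \<in> Z b) \<or> (\<forall>b. u \<in> Z' b)"
    proof -
      have "u \<in> E" using u unfolding E_def by blast
      then have "u \<in> \<Omega>" using EX by blast
      have "\<not> near u" using noP[OF \<open>u \<in> \<Omega>\<close>] \<open>u \<in> E\<close> unfolding P_def near_def by blast
      then have "[\<phi> True u - \<phi> False u = 0] (mod n)" using \<phi>(2)[OF \<open>u \<in> \<Omega>\<close>] unfolding f_def by simp
      then show ?thesis by (simp add: cong_iff_dvd_diff)
    qed
  qed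
qed

lemma subtree_edge_const:
  fixes \<phi> :: "bool \<Rightarrow> 'x \<Rightarrow> int"
  assumes Y: "subtree Y" and lc: "\<And>b. lc b (\<phi> b)"
    and e: "\<And>u. \<forall>b. u \<in> Y b \<Longrightarrow> [\<phi> True u = \<phi> False u] (mod n)"
  obtains c where "\<And>b u. u \<in> Y b \<Longrightarrow> \<phi> b u mod n = c"
proof (rule subtreeD[OF Y, where \<gamma> = "\<lambda>b u. \<phi> b u mod n"])
  show "lc b (\<lambda>u. \<phi> b u mod n)" for b by (rule lc_comp[OF lc])
  show "\<phi> True u mod n = \<phi> False u mod n" if "u \<in> Y True" "u \<in> Y False" for u
  proof -
    have "\<forall>b. u \<in> Y b" using that by (metis (full_types))
    from e[OF this] show ?thesis by (simp add: Cong.cong_def)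
  qed
qed (use that in blast)

text \<open>A Mayer-Vietoris argument: on the intersection the indicator \<psi> is the difference of
  \<phi>, constant on \<open>Z\<close>, and \<phi> - \<psi>, constant on \<open>Y\<close>. Modulus 2
  suffices to tell 0 from 1.\<close>

lemma Helly_Int:
  assumes Y: "subtree Y" and Z: "subtree Z" and ne: "\<exists>b. Y b \<inter> Z b \<noteq> {}"
  shows "subtree (\<lambda>b. Y b \<inter> Z b)"
  unfolding subtree_def
proof (intro conjI allI impI)
  show "cld b (Y b \<inter> Z b)" for b using cld_Int[OF subtree_cld[OF Y] subtree_cld[OF Z]] .
  show "\<exists>b. Y b \<inter> Z b \<noteq> {}" by (rule ne)
  then obtain b0 u0 where u0: "u0 \<in> Y b0" "u0 \<in> Z b0" by blast
  fix \<gamma> :: "bool \<Rightarrow> 'x \<Rightarrow> int"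
  assume lc: "\<forall>b. lc b (\<gamma> b)"
    and edge: "\<forall>u\<in>(Y True \<inter> Z True) \<inter> (Y False \<inter> Z False). \<gamma> True u = \<gamma> False u"
  define \<psi> where "\<psi> b u = (of_bool (\<gamma> b u = \<gamma> b0 u0) :: int)" for b u
  have lc\<psi>: "lc b (\<psi> b)" for b
    unfolding \<psi>_def using lc_comp[of b "\<gamma> b" "\<lambda>t. of_bool (t = \<gamma> b0 u0)"] lc by blast
  obtain \<phi> where lc\<phi>: "\<And>b. lc b (\<phi> b)" and
    1: "\<And>u. \<forall>b. u \<in> Y b \<Longrightarrow> [\<phi> True u - \<phi> False u = \<psi> True u - \<psi> False u] (mod 2)" and
    2: "\<And>u. (\<forall>b. u \<in> Z b) \<or> (\<forall>b. u \<in> Z b) \<Longrightarrow> [\<phi> True u = \<phi> False u] (mod 2)"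
  proof (rule edge_cochain[OF subtree_cld[OF Y] subtree_cld[OF Z] subtree_cld[OF Z] lc\<psi>, where n = 2])
    show "\<psi> True u = \<psi> False u" if "\<forall>b. u \<in> Y b" "(\<forall>b. u \<in> Z b) \<or> (\<forall>b. u \<in> Z b)" for u
      using edge that unfolding \<psi>_def by simp
  qed auto
  obtain c1 where c1: "\<And>b u. u \<in> Z b \<Longrightarrow> \<phi> b u mod 2 = c1"
    using subtree_edge_const[OF Z lc\<phi>, of 2] 2 by blast
  have lcd: "lc b (\<lambda>u. \<phi> b u - \<psi> b u)" for b using lc_combine[OF lc\<phi> lc\<psi>] .
  obtain c2 where c2: "\<And>b u. u \<in> Y b \<Longrightarrow> (\<phi> b u - \<psi> b u) mod 2 = c2"
  proof (rule subtree_edge_const[OF Y lcd, of 2])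
    show "[\<phi> True u - \<psi> True u = \<phi> False u - \<psi> False u] (mod 2)" if "\<forall>b. u \<in> Y b" for u
      using 1[OF that] by (simp add: cong_iff_dvd_diff algebra_simps)
  qed blast
  have "[\<psi> b u = c1 - c2] (mod 2)" if "u \<in> Y b" "u \<in> Z b" for b u
  proof -
    have "[\<phi> b u = c1] (mod 2)" "[\<phi> b u - \<psi> b u = c2] (mod 2)"
      using c1[OF that(2)] c2[OF that(1)] by (metis cong_mod_right cong_refl)+
    from cong_diff[OF this] show ?thesis by simp
  qed
  then have "[\<psi> b u = \<psi> b0 u0] (mod 2)" if "u \<in> Y b" "u \<in> Z b" for b u
    using that u0 by (metis cong_sym cong_trans)
  then have "\<gamma> b u = \<gamma> b0 u0" if "u \<in> Y b" "u \<in> Z b" for b u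
    using that unfolding \<psi>_def Cong.cong_def by (force split: if_splits)
  then show "\<exists>c. \<forall>b. \<forall>u\<in>Y b \<inter> Z b. \<gamma> b u = c" by blast
qed

text \<open>Without a common vertex there would be a cycle. It is detected by a function \<psi> that
  is 1 on the vertices common to \<open>Y1\<close> and \<open>Y2\<close> and 0 on those common to
  \<open>Y1\<close> and \<open>Y3\<close>: \<phi> has the same constant value on \<open>Y2\<close>
  and \<open>Y3\<close>, while \<phi> - \<psi> is constant on \<open>Y1\<close>, so 1 = 0 modulo
  2.\<close>

lemma Helly_three:
  assumes Y: "subtree Y1" "subtree Y2" "subtree Y3"
    and ne: "\<exists>b. Y1 b \<inter> Y2 b \<noteq> {}" "\<exists>b. Y1 b \<inter> Y3 b \<noteq> {}" "\<exists>b. Y2 b \<inter> Y3 b \<noteq> {}"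
  shows "\<exists>b. Y1 b \<inter> Y2 b \<inter> Y3 b \<noteq> {}"
proof (rule ccontr)
  assume no: "\<not> ?thesis"
  have lev: "\<exists>i\<in>I. \<forall>u\<in>\<Omega>. \<not> ((\<exists>y\<in>Y1 b \<inter> Y2 b. key b i u = key b i y) \<and> (\<exists>z\<in>Y1 b \<inter> Y3 b. key b i u = key b i z))" for b
  proof -
    define P where "P i u \<longleftrightarrow> (\<exists>y\<in>Y1 b \<inter> Y2 b. key b i u = key b i y) \<and> (\<exists>z\<in>Y1 b \<inter> Y3 b. key b i u = key b i z)" for i u
    obtain i0 where "i0 \<in> I" using nonempty by blast
    obtain i where "i \<in> I" "\<And>u. u \<in> \<Omega> \<Longrightarrow> \<not> P i u"
    proof (rule escape_level[OF \<open>i0 \<in> I\<close>, of P])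
      show "P i v" if "\<And>b. key b i u = key b i v" "P i u" for i u v
        using that unfolding P_def by simp
      show "P i u" if h: "i \<in> I" "j \<in> I" "le i j" "u \<in> \<Omega>" "P j u" for i j u
        using coarser[OF h(1-4)] h(5) subtree_sub[OF Y(1)] unfolding P_def by blast
      show False if u: "u \<in> \<Omega>" "\<And>i. i \<in> I \<Longrightarrow> P i u" for u
      proof -
        have "u \<in> Y1 b"
          by (rule cldD[OF subtree_cld[OF Y(1)] u(1)]) (use u(2) in \<open>auto simp: P_def\<close>)
        moreover have "u \<in> Y2 b"
          by (rule cldD[OF subtree_cld[OF Y(2)] u(1)]) (use u(2) in \<open>auto simp: P_def\<close>)
        moreover have "u \<in> Y3 b"
          by (rule cldD[OF subtree_cld[OF Y(3)] u(1)]) (use u(2) in \<open>auto simp: P_def\<close>)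
        ultimately show False using no by blast
      qed
    qed blast
    then show ?thesis unfolding P_def by blast
  qed
  then obtain lv where lv: "\<And>b. lv b \<in> I" and sep: "\<And>b u. u \<in> \<Omega> \<Longrightarrow>
      \<not> ((\<exists>y\<in>Y1 b \<inter> Y2 b. key b (lv b) u = key b (lv b) y) \<and> (\<exists>z\<in>Y1 b \<inter> Y3 b. key b (lv b) u = key b (lv b) z))"
    by metis
  define \<psi> where "\<psi> b u = (of_bool (\<exists>y\<in>Y1 b \<inter> Y2 b. key b (lv b) u = key b (lv b) y) :: int)" for b u
  have lc\<psi>: "lc b (\<psi> b)" for b
    by (rule level_lc[OF lv[of b]]) (simp add: \<psi>_def)
  have \<psi>1: "\<psi> b u = 1" if "u \<in> Y1 b" "u \<in> Y2 b" for b u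
    using that unfolding \<psi>_def by auto
  have \<psi>0: "\<psi> b u = 0" if "u \<in> Y1 b" "u \<in> Y3 b" for b u
  proof -
    have "u \<in> \<Omega>" using that subtree_sub[OF Y(1)] by blast
    from sep[OF this] show ?thesis using that unfolding \<psi>_def by auto
  qed
  obtain \<phi> where lc\<phi>: "\<And>b. lc b (\<phi> b)" and
    1: "\<And>u. \<forall>b. u \<in> Y1 b \<Longrightarrow> [\<phi> True u - \<phi> False u = \<psi> True u - \<psi> False u] (mod 2)" and
    2: "\<And>u. (\<forall>b. u \<in> Y2 b) \<or> (\<forall>b. u \<in> Y3 b) \<Longrightarrow> [\<phi> True u = \<phi> False u] (mod 2)"
  proof (rule edge_cochain[OF subtree_cld[OF Y(1)] subtree_cld[OF Y(2)] subtree_cld[OF Y(3)] lc\<psi>, where n = 2])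
    show "\<psi> True u = \<psi> False u" if "\<forall>b. u \<in> Y1 b" "(\<forall>b. u \<in> Y2 b) \<or> (\<forall>b. u \<in> Y3 b)" for u
      using \<psi>0 \<psi>1 that by metis
  qed auto
  obtain c2 where c2: "\<And>b u. u \<in> Y2 b \<Longrightarrow> \<phi> b u mod 2 = c2"
    using subtree_edge_const[OF Y(2) lc\<phi>, of 2] 2 by blast
  obtain c3 where c3: "\<And>b u. u \<in> Y3 b \<Longrightarrow> \<phi> b u mod 2 = c3"
    using subtree_edge_const[OF Y(3) lc\<phi>, of 2] 2 by blast
  have lcd: "lc b (\<lambda>u. \<phi> b u - \<psi> b u)" for b using lc_combine[OF lc\<phi> lc\<psi>] .
  obtain c1 where c1: "\<And>b u. u \<in> Y1 b \<Longrightarrow> (\<phi> b u - \<psi> b u) mod 2 = c1"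
  proof (rule subtree_edge_const[OF Y(1) lcd, of 2])
    show "[\<phi> True u - \<psi> True u = \<phi> False u - \<psi> False u] (mod 2)" if "\<forall>b. u \<in> Y1 b" for u
      using 1[OF that] by (simp add: cong_iff_dvd_diff algebra_simps)
  qed blast
  obtain b u where u12: "u \<in> Y1 b" "u \<in> Y2 b" using ne(1) by blast
  obtain b' u' where u13: "u' \<in> Y1 b'" "u' \<in> Y3 b'" using ne(2) by blast
  obtain b'' u'' where u23: "u'' \<in> Y2 b''" "u'' \<in> Y3 b''" using ne(3) by blast
  note u = u12 u13 u23
  have "c2 = c3" using c2[OF u(5)] c3[OF u(6)] by simp
  moreover have "(c2 - 1) mod 2 = c1"
    using c2[OF u(2)] c1[OF u(1)] \<psi>1[OF u(1,2)] by (metis mod_diff_left_eq)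
  moreover have "c3 mod 2 = c1"
    using c3[OF u(4)] c1[OF u(3)] \<psi>0[OF u(3,4)] by (metis diff_zero mod_mod_trivial)
  ultimately show False by presburger
qed

text \<open>Intersect all members with one of them: \<open>Helly_Int\<close> keeps them subtrees and
  \<open>Helly_three\<close> keeps them pairwise meeting.\<close>

lemma Helly:
  assumes "finite C" "C \<noteq> {}" "\<And>c. c \<in> C \<Longrightarrow> subtree (T c)"
    "\<And>c d. c \<in> C \<Longrightarrow> d \<in> C \<Longrightarrow> \<exists>b. T c b \<inter> T d b \<noteq> {}"
  shows "\<exists>b. (\<Inter>c\<in>C. T c b) \<noteq> {}"
  using assms
proof (induction C arbitrary: T rule: finite_ne_induct)
  case (singleton c)
  then show ?case by auto
next
  case (insert c C)
  have "\<exists>b. (\<Inter>d\<in>C. T d b \<inter> T c b) \<noteq> {}"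
  proof (rule insert.IH)
    show "subtree (\<lambda>b. T d b \<inter> T c b)" if "d \<in> C" for d
      by (rule Helly_Int) (use insert.prems that in simp_all)
    show "\<exists>b. (T d b \<inter> T c b) \<inter> (T d' b \<inter> T c b) \<noteq> {}" if "d \<in> C" "d' \<in> C" for d d'
    proof -
      have "\<exists>b. T d b \<inter> T d' b \<inter> T c b \<noteq> {}"
        by (rule Helly_three) (use insert.prems that in \<open>simp_all\<close>)
      then show ?thesis by blast
    qed
  qed
  moreover have "(\<Inter>d\<in>C. T d b \<inter> T c b) = (\<Inter>d\<in>insert c C. T d b)" for b
    using insert.hyps by blast
  ultimately show ?case by simp
qed

text \<open>The torsion product \<rho> of two of the involutions has a fixed subtree. On it
  \<open>s c\<close> and \<open>s d\<close> agree and \<open>s c\<close> preserves it, so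
  \<open>s c\<close> fixes a vertex there, which \<open>s d\<close> fixes too. Hence the fixed
  subtrees meet pairwise and \<open>Helly\<close> applies.\<close>

theorem common_fixed_vertex:
  assumes \<Omega>: "subtree (\<lambda>b. \<Omega>)" and C: "finite C" "C \<noteq> {}" and s: "\<And>c. c \<in> C \<Longrightarrow> aut (s c)"
    and invol: "\<And>c u. c \<in> C \<Longrightarrow> u \<in> \<Omega> \<Longrightarrow> s c (s c u) = u"
    and tors: "\<And>c d. c \<in> C \<Longrightarrow> d \<in> C \<Longrightarrow> \<exists>m>0. \<forall>u\<in>\<Omega>. ((s c \<circ> s d) ^^ m) u = u"
  shows "\<exists>b. \<exists>u\<in>\<Omega>. \<forall>c\<in>C. u \<in> Fix (s c) b"
proof -
  have sX: "s c u \<in> \<Omega>" if "c \<in> C" "u \<in> \<Omega>" for c u using s that unfolding aut_def by blast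
  have keyiff: "key b i (s c u) = key b i (s c v) \<longleftrightarrow> key b i u = key b i v"
    if "c \<in> C" "i \<in> I" "u \<in> \<Omega>" "v \<in> \<Omega>" for b i c u v using s that unfolding aut_def by blast
  have Fixs: "subtree (Fix (s c))" if c: "c \<in> C" for c
  proof -
    have "subtree (\<lambda>b. \<Omega> \<inter> Fix (s c) b)"
    proof (rule fixed_subtree_torsion[OF \<Omega> s[OF c], of 2])
      show "u \<in> Fix (s c ^^ 2) b" if "u \<in> \<Omega>" for b u
        using that invol[OF c] by (simp add: Fix_def numeral_2_eq_2)
    qed (use sX c in auto)
    moreover have "(\<lambda>b. \<Omega> \<inter> Fix (s c) b) = Fix (s c)" by (auto simp: Fix_def)
    ultimately show ?thesis by simp
  qed
  have "\<exists>b. (\<Inter>c\<in>C. Fix (s c) b) \<noteq> {}"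
  proof (rule Helly[OF C])
    fix c d assume c: "c \<in> C" and d: "d \<in> C"
    define \<rho> where "\<rho> = s c \<circ> s d"
    obtain m where m: "m > 0" "\<forall>u\<in>\<Omega>. (\<rho> ^^ m) u = u" using tors[OF c d] unfolding \<rho>_def by blast
    have \<rho>: "aut \<rho>" using s[OF c] s[OF d] unfolding \<rho>_def aut_def by simp
    have R: "subtree (Fix \<rho>)"
    proof -
      have "subtree (\<lambda>b. \<Omega> \<inter> Fix \<rho> b)"
      proof (rule fixed_subtree_torsion[OF \<Omega> \<rho> _ m(1)])
        show "u \<in> Fix (\<rho> ^^ m) b" if "u \<in> \<Omega>" for b u using that m by (simp add: Fix_def)
      qed (use \<rho> in \<open>auto simp: aut_def\<close>)
      moreover have "(\<lambda>b. \<Omega> \<inter> Fix \<rho> b) = Fix \<rho>" by (auto simp: Fix_def)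
      ultimately show ?thesis by simp
    qed
    have dc: "key b i (s d u) = key b i (s c u)" if "u \<in> Fix \<rho> b" "i \<in> I" for b i u
    proof -
      have "u \<in> \<Omega>" "key b i (s c (s d u)) = key b i (s c (s c u))"
        using that invol[OF c] unfolding Fix_def \<rho>_def by auto
      then show ?thesis using keyiff[OF c that(2) sX[OF d] sX[OF c]] by blast
    qed
    have "subtree (\<lambda>b. Fix \<rho> b \<inter> Fix (s c) b)"
    proof (rule fixed_subtree_torsion[OF R s[OF c], of 2])
      fix b u assume u: "u \<in> Fix \<rho> b"
      then have uX: "u \<in> \<Omega>" by (simp add: Fix_def)
      show "u \<in> Fix (s c ^^ 2) b" using uX invol[OF c] by (simp add: Fix_def numeral_2_eq_2)
      have "key b i (s c (s d (s c u))) = key b i (s c u)" if i: "i \<in> I" for i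
      proof -
        have "key b i (s d (s c u)) = key b i (s d (s d u))"
          using keyiff[OF d i sX[OF c uX] sX[OF d uX]] dc[OF u i] by metis
        then have "key b i (s d (s c u)) = key b i u" using invol[OF d uX] by simp
        then show ?thesis using keyiff[OF c i sX[OF d sX[OF c uX]] uX] by blast
      qed
      then show "s c u \<in> Fix \<rho> b" using sX[OF c uX] unfolding Fix_def \<rho>_def by simp
    qed simp
    then obtain b u where u: "u \<in> Fix \<rho> b" "u \<in> Fix (s c) b" unfolding subtree_def by blast
    then have "u \<in> Fix (s d) b" using dc unfolding Fix_def by simp
    then show "\<exists>b. Fix (s c) b \<inter> Fix (s d) b \<noteq> {}" using u by blast
  qed (use Fixs in auto)
  then obtain b u where u: "\<forall>c\<in>C. u \<in> Fix (s c) b" by blast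
  moreover have "u \<in> \<Omega>" using u C(2) unfolding Fix_def by blast
  ultimately show ?thesis by blast
qed

end

section \<open>Profinite completions\<close>

lemma carrier_fin_index:
  assumes "group G" shows "carrier G \<in> fin_index_normals G"
proof -
  interpret group G by (rule assms)
  have "carrier G \<lhd> G"
    unfolding normal_inv_iff using subgroup_self by auto
  moreover have "rcosets\<^bsub>G\<^esub> (carrier G) \<subseteq> {carrier G}"
    using coset_join2[OF _ subgroup_self] by (auto simp: RCOSETS_def)
  ultimately show ?thesis unfolding fin_index_normals_def using finite_subset by auto
qed

lemma fin_index_normals_Inter:
  assumes "group G" "finite K" "K \<noteq> {}" "K \<subseteq> fin_index_normals G"
  shows "\<Inter>K \<in> fin_index_normals G"
  using assms(2-4)
proof (induction K rule: finite_ne_induct)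
  case (insert N K)
  then show ?case using fin_index_normals_Int[OF assms(1)] by simp
qed simp

locale profinite = group G for G (structure)
begin

abbreviation "I \<equiv> fin_index_normals G"
abbreviation "P \<equiv> profinite_completion G"

lemma normalI: "N \<in> I \<Longrightarrow> N \<lhd> G"
  by (simp add: fin_index_normals_def)

lemma subgroupN: "N \<in> I \<Longrightarrow> subgroup N G"
  using normalI normal_imp_subgroup by blast

lemma mem_carrier:
  "x \<in> carrier P \<longleftrightarrow> (\<forall>N\<in>I. x N \<in> rcosets N) \<and> (\<forall>N\<in>I. \<forall>M\<in>I. N \<subseteq> M \<longrightarrow> x N \<subseteq> x M)
     \<and> (\<forall>N. N \<notin> I \<longrightarrow> x N = undefined)"
  by (simp add: profinite_completion_def FactGroup_def)

lemma coord_coset: "x \<in> carrier P \<Longrightarrow> N \<in> I \<Longrightarrow> x N \<in> rcosets N"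
  by (simp add: mem_carrier)

lemma coord_mono: "x \<in> carrier P \<Longrightarrow> N \<in> I \<Longrightarrow> M \<in> I \<Longrightarrow> N \<subseteq> M \<Longrightarrow> x N \<subseteq> x M"
  by (simp add: mem_carrier)

lemma coord_subset: "x \<in> carrier P \<Longrightarrow> N \<in> I \<Longrightarrow> x N \<subseteq> carrier G"
  using coord_coset rcosets_part_G[OF subgroupN] by blast

lemma coord_rep:
  assumes "x \<in> carrier P" "N \<in> I" "g \<in> x N" shows "x N = N #> g" "g \<in> carrier G"
proof -
  show g: "g \<in> carrier G" using coord_subset[OF assms(1,2)] assms(3) by blast
  obtain h where h: "h \<in> carrier G" "x N = N #> h"
    using coord_coset[OF assms(1,2)] by (auto simp: RCOSETS_def)
  show "x N = N #> g" using repr_independence[OF _ h(1) subgroupN[OF assms(2)], of g] assms(3) h by simp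
qed

lemma coord_nonempty:
  assumes "x \<in> carrier P" "N \<in> I" shows "x N \<noteq> {}"
proof -
  obtain h where h: "h \<in> carrier G" "x N = N #> h"
    using coord_coset[OF assms] by (auto simp: RCOSETS_def)
  then show ?thesis using rcos_self[OF h(1) subgroupN[OF assms(2)]] by blast
qed

lemma mult_coord: "N \<in> I \<Longrightarrow> (x \<otimes>\<^bsub>P\<^esub> y) N = x N <#> y N"
  by (simp add: profinite_completion_def)

lemma one_coord: "N \<in> I \<Longrightarrow> \<one>\<^bsub>P\<^esub> N = N"
  by (simp add: profinite_completion_def)

lemma P_eqI:
  assumes "x \<in> carrier P" "y \<in> carrier P" "\<And>N. N \<in> I \<Longrightarrow> x N = y N" shows "x = y"
proof
  fix N show "x N = y N"
    using assms(3) assms(1,2)[unfolded mem_carrier] by (cases "N \<in> I") auto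
qed

lemma group_P: "group P"
proof (rule groupI)
  have fac: "group (G Mod N)" if "N \<in> I" for N using normal.factorgroup_is_group[OF normalI[OF that]] .
  fix x y assume x: "x \<in> carrier P" and y: "y \<in> carrier P"
  have "x N <#> y N \<in> rcosets N" if "N \<in> I" for N
    using normal.setmult_closed[OF normalI[OF that]] coord_coset that x y by blast
  moreover have "x N <#> y N \<subseteq> x M <#> y M" if "N \<in> I" "M \<in> I" "N \<subseteq> M" for N M
    using mono_set_mult[OF coord_mono[OF x that] coord_mono[OF y that]] .
  ultimately show "x \<otimes>\<^bsub>P\<^esub> y \<in> carrier P"
    unfolding mem_carrier by (simp add: mult_coord) (simp add: profinite_completion_def)
  fix z assume z: "z \<in> carrier P"
  have ass: "(x N <#> y N) <#> z N = x N <#> (y N <#> z N)" if "N \<in> I" for N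
    by (rule set_mult_assoc) (use coord_subset that x y z in auto)
  show "x \<otimes>\<^bsub>P\<^esub> y \<otimes>\<^bsub>P\<^esub> z = x \<otimes>\<^bsub>P\<^esub> (y \<otimes>\<^bsub>P\<^esub> z)"
    by (rule ext) (auto simp: profinite_completion_def ass)
next
  show "\<one>\<^bsub>P\<^esub> \<in> carrier P"
    unfolding mem_carrier
  proof (intro conjI ballI allI impI)
    show "\<one>\<^bsub>P\<^esub> N \<in> rcosets N" if "N \<in> I" for N
      using subgroup.subgroup_in_rcosets[OF subgroupN[OF that] is_group] one_coord[OF that] by simp
  qed (simp_all add: one_coord, simp add: profinite_completion_def)
next
  fix x assume x: "x \<in> carrier P"
  show "\<one>\<^bsub>P\<^esub> \<otimes>\<^bsub>P\<^esub> x = x"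
  proof
    fix N show "(\<one>\<^bsub>P\<^esub> \<otimes>\<^bsub>P\<^esub> x) N = x N"
    proof (cases "N \<in> I")
      case True
      then show ?thesis
        using normal.rcosets_mult_eq[OF normalI[OF True] coord_coset[OF x True]]
        by (simp add: mult_coord one_coord)
    next
      case False
      then show ?thesis using x by (simp add: mem_carrier) (simp add: profinite_completion_def)
    qed
  qed
  define y where "y N = (if N \<in> I then set_inv (x N) else undefined)" for N
  have "y \<in> carrier P"
    unfolding mem_carrier
  proof (intro conjI ballI allI impI)
    show "y N \<in> rcosets N" if "N \<in> I" for N
      using normal.setinv_closed[OF normalI[OF that] coord_coset[OF x that]] that by (simp add: y_def)
    show "y N \<subseteq> y M" if "N \<in> I" "M \<in> I" "N \<subseteq> M" for N M
      using coord_mono[OF x that] that by (auto simp: y_def SET_INV_def)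
  qed (simp add: y_def)
  moreover have "y \<otimes>\<^bsub>P\<^esub> x = \<one>\<^bsub>P\<^esub>"
  proof
    fix N show "(y \<otimes>\<^bsub>P\<^esub> x) N = \<one>\<^bsub>P\<^esub> N"
    proof (cases "N \<in> I")
      case True
      then show ?thesis
        using normal.rcosets_inv_mult_group_eq[OF normalI[OF True] coord_coset[OF x True]]
        by (simp add: mult_coord one_coord y_def)
    qed (simp add: profinite_completion_def)
  qed
  ultimately show "\<exists>y\<in>carrier P. y \<otimes>\<^bsub>P\<^esub> x = \<one>\<^bsub>P\<^esub>" by blast
qed

section \<open>The canonical map and closures of subgroups\<close>

definition emb :: "'a \<Rightarrow> 'a set \<Rightarrow> 'a set" where
  "emb g = (\<lambda>N. if N \<in> I then N #> g else undefined)"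

lemma emb_coord: "N \<in> I \<Longrightarrow> emb g N = N #> g"
  by (simp add: emb_def)

lemma emb_carrier:
  assumes "g \<in> carrier G" shows "emb g \<in> carrier P"
  unfolding mem_carrier
proof (intro conjI ballI allI impI)
  show "emb g N \<in> rcosets N" if "N \<in> I" for N using that assms by (auto simp: emb_coord RCOSETS_def)
  show "emb g N \<subseteq> emb g M" if "N \<in> I" "M \<in> I" "N \<subseteq> M" for N M
    using that by (auto simp: emb_coord r_coset_def)
qed (simp add: emb_def)

lemma emb_self: "g \<in> carrier G \<Longrightarrow> N \<in> I \<Longrightarrow> g \<in> emb g N"
  using rcos_self[OF _ subgroupN] by (simp add: emb_coord)

lemma emb_mult:
  assumes "g \<in> carrier G" "h \<in> carrier G" shows "emb (g \<otimes> h) = emb g \<otimes>\<^bsub>P\<^esub> emb h"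
proof (rule P_eqI)
  interpret P: group P by (rule group_P)
  show "emb (g \<otimes> h) \<in> carrier P" "emb g \<otimes>\<^bsub>P\<^esub> emb h \<in> carrier P" using assms emb_carrier by auto
  fix N assume N: "N \<in> I"
  then show "emb (g \<otimes> h) N = (emb g \<otimes>\<^bsub>P\<^esub> emb h) N"
    using normal.rcos_sum[OF normalI[OF N] assms] by (simp add: emb_coord mult_coord)
qed

lemma emb_one: "emb \<one> = \<one>\<^bsub>P\<^esub>"
proof (rule P_eqI)
  interpret P: group P by (rule group_P)
  show "emb \<one> \<in> carrier P" "\<one>\<^bsub>P\<^esub> \<in> carrier P" using emb_carrier by auto
  show "emb \<one> N = \<one>\<^bsub>P\<^esub> N" if "N \<in> I" for N
    using coset_mult_one subgroup.subset[OF subgroupN[OF that]] that by (simp add: emb_coord one_coord)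
qed

definition cl :: "'a set \<Rightarrow> ('a set \<Rightarrow> 'a set) set" where
  "cl H = {x \<in> carrier P. \<forall>N\<in>I. x N \<inter> H \<noteq> {}}"

lemma cl_carrier: "x \<in> cl H \<Longrightarrow> x \<in> carrier P"
  by (simp add: cl_def)

lemma cl_emb: "g \<in> H \<Longrightarrow> H \<subseteq> carrier G \<Longrightarrow> emb g \<in> cl H"
  unfolding cl_def using emb_carrier emb_self by blast

lemma cl_mult:
  assumes "subgroup H G" "x \<in> cl H" "y \<in> cl H" shows "x \<otimes>\<^bsub>P\<^esub> y \<in> cl H"
proof -
  interpret P: group P by (rule group_P)
  have "(x \<otimes>\<^bsub>P\<^esub> y) N \<inter> H \<noteq> {}" if N: "N \<in> I" for N
  proof -
    obtain g h where "g \<in> x N" "g \<in> H" "h \<in> y N" "h \<in> H" using assms(2,3) N unfolding cl_def by blast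
    then have "g \<otimes> h \<in> x N <#> y N" "g \<otimes> h \<in> H"
      using subgroup.m_closed[OF assms(1)] by (auto simp: set_mult_def)
    then show ?thesis using N by (auto simp: mult_coord)
  qed
  then show ?thesis using assms(2,3) unfolding cl_def by auto
qed

text \<open>An \<open>x\<close> outside the image is separated from each g in \<open>H\<close> by
  some subgroup; the intersection of these finitely many subgroups separates it from all of
  \<open>H\<close> at once.\<close>

lemma cl_finite:
  assumes H: "finite H" "H \<subseteq> carrier G" shows "cl H \<subseteq> emb ` H"
proof
  fix x assume x: "x \<in> cl H"
  show "x \<in> emb ` H"
  proof (rule ccontr)
    assume no: "x \<notin> emb ` H"
    have "\<exists>N\<in>I. x N \<noteq> N #> g" if "g \<in> H" for g
    proof (rule ccontr)
      assume "\<not> ?thesis"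
      then have "x = emb g" using that H by (intro P_eqI cl_carrier[OF x] emb_carrier) (auto simp: emb_coord)
      then show False using no that by blast
    qed
    then obtain Ng where Ng: "\<And>g. g \<in> H \<Longrightarrow> Ng g \<in> I \<and> x (Ng g) \<noteq> Ng g #> g" by metis
    define N where "N = \<Inter>(insert (carrier G) (Ng ` H))"
    have N: "N \<in> I"
      unfolding N_def using H Ng carrier_fin_index[OF is_group]
      by (intro fin_index_normals_Inter[OF is_group]) auto
    then obtain g where g: "g \<in> x N" "g \<in> H" using x unfolding cl_def by blast
    have "N \<subseteq> Ng g" using g unfolding N_def by blast
    then have "g \<in> x (Ng g)" using coord_mono[OF cl_carrier[OF x] N] Ng[OF g(2)] g(1) by blast
    then show False using coord_rep(1)[OF cl_carrier[OF x]] Ng[OF g(2)] by blast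
  qed
qed

lemma coord_coarser:
  assumes "x \<in> carrier P" "N \<in> I" "M \<in> I" "M \<subseteq> N" shows "x N = N <#> x M"
proof -
  obtain g where g: "g \<in> x M" using coord_nonempty[OF assms(1,3)] by blast
  have "g \<in> x N" using g coord_mono[OF assms(1,3,2,4)] by blast
  note rM = coord_rep[OF assms(1,3) g] and rN = coord_rep[OF assms(1,2) this]
  have "N <#> M = N"
  proof
    show "N <#> M \<subseteq> N"
      using assms(4) subgroup.m_closed[OF subgroupN[OF assms(2)]] by (auto simp: set_mult_def)
    show "N \<subseteq> N <#> M"
    proof
      fix n assume n: "n \<in> N"
      then have "n \<otimes> \<one> = n" using subgroup.subset[OF subgroupN[OF assms(2)]] by auto
      then show "n \<in> N <#> M"
        using n subgroup.one_closed[OF subgroupN[OF assms(3)]] unfolding set_mult_def by blast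
    qed
  qed
  moreover have "N <#> (M #> g) = (N <#> M) #> g"
    using setmult_rcos_assoc subgroup.subset[OF subgroupN] assms(2,3) rM(2) by blast
  ultimately show ?thesis using rM(1) rN(1) by simp
qed

text \<open>Tychonoff's theorem for the product of the finite discrete coset spaces.\<close>

lemma compact:
  assumes RP: "\<And>N. N \<in> I \<Longrightarrow> R N \<subseteq> carrier P" and ne: "\<And>N. N \<in> I \<Longrightarrow> R N \<noteq> {}"
    and sat: "\<And>N x y. \<lbrakk>N \<in> I; x \<in> R N; y \<in> carrier P; x N = y N\<rbrakk> \<Longrightarrow> y \<in> R N"
    and decr: "\<And>N M. \<lbrakk>N \<in> I; M \<in> I; M \<subseteq> N\<rbrakk> \<Longrightarrow> R M \<subseteq> R N"
  shows "\<exists>x\<in>carrier P. \<forall>N\<in>I. x \<in> R N"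
proof -
  define T where "T = product_topology (\<lambda>N. discrete_topology (rcosets N)) I"
  have topT: "topspace T = (\<Pi>\<^sub>E N\<in>I. rcosets N)" by (simp add: T_def)
  have "compact_space T"
    unfolding T_def compact_space_product_topology
    by (simp add: compact_space_discrete_topology fin_index_normals_def)
  \<comment> \<open>Only the coordinates at subgroups containing \<open>N\<close> are prescribed. An
    element of \<open>R\<close> at the intersection of finitely many subgroups therefore lies in all
    the sets \<open>C\<close> belonging to them.\<close>
  define C where "C N = (\<Union>A\<in>(\<lambda>x. x N) ` R N. \<Inter>M\<in>{M\<in>I. N \<subseteq> M}. {f \<in> topspace T. f M = M <#> A})" for N
  have closed: "closedin T (C N)" if N: "N \<in> I" for N
    unfolding C_def
  proof (rule closedin_Union)
    have "(\<lambda>x. x N) ` R N \<subseteq> rcosets N" using RP[OF N] coord_coset N by blast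
    moreover have "finite (rcosets N)" using N by (simp add: fin_index_normals_def)
    ultimately have "finite ((\<lambda>x. x N) ` R N)" by (rule finite_subset)
    then show "finite ((\<lambda>A. \<Inter>M\<in>{M\<in>I. N \<subseteq> M}. {f \<in> topspace T. f M = M <#> A}) ` (\<lambda>x. x N) ` R N)"
      by (rule finite_imageI)
    fix S assume "S \<in> (\<lambda>A. \<Inter>M\<in>{M\<in>I. N \<subseteq> M}. {f \<in> topspace T. f M = M <#> A}) ` (\<lambda>x. x N) ` R N"
    then obtain A where S: "S = (\<Inter>M\<in>{M\<in>I. N \<subseteq> M}. {f \<in> topspace T. f M = M <#> A})" by blast
    have "closedin T {f \<in> topspace T. f M \<in> {B \<in> rcosets M. B = M <#> A}}" if "M \<in> I" for M
    proof (rule closedin_continuous_map_preimage[where Y = "discrete_topology (rcosets M)"])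
      show "continuous_map T (discrete_topology (rcosets M)) (\<lambda>f. f M)"
        unfolding T_def by (rule continuous_map_product_projection[OF that])
    qed auto
    moreover have "{f \<in> topspace T. f M \<in> {B \<in> rcosets M. B = M <#> A}} = {f \<in> topspace T. f M = M <#> A}" if "M \<in> I" for M
      using that by (auto simp: topT)
    ultimately show "closedin T S" unfolding S using N by (intro closedin_Inter) auto
  qed
  have "\<Inter>(C ` I) \<noteq> {}"
  proof (rule compact_space_fip[THEN iffD1, rule_format, OF \<open>compact_space T\<close>], intro conjI allI impI ballI)
    show "closedin T S" if "S \<in> C ` I" for S using that closed by blast
    fix K assume K: "finite K \<and> K \<subseteq> C ` I"
    then obtain I0 where I0: "I0 \<subseteq> I" "finite I0" "K = C ` I0" by (meson finite_subset_image)
    define N where "N = \<Inter>(insert (carrier G) I0)"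
    have N: "N \<in> I"
      unfolding N_def using I0 carrier_fin_index[OF is_group] by (intro fin_index_normals_Inter[OF is_group]) auto
    obtain x where x: "x \<in> R N" using ne[OF N] by blast
    have xP: "x \<in> carrier P" using RP[OF N] x by blast
    have "x \<in> topspace T" using xP by (auto simp: topT PiE_def extensional_def mem_carrier)
    have "x \<in> C M" if M: "M \<in> I0" for M
    proof -
      have "M \<in> I" using M I0 by blast
      have "N \<subseteq> M" using M by (auto simp: N_def)
      then have "x \<in> R M" using decr[OF \<open>M \<in> I\<close> N] x by blast
      moreover have "x M' = M' <#> x M" if "M' \<in> I" "M \<subseteq> M'" for M'
        using coord_coarser[OF xP that(1) \<open>M \<in> I\<close> that(2)] .
      ultimately show ?thesis unfolding C_def using \<open>x \<in> topspace T\<close> by blast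
    qed
    then show "\<Inter>K \<noteq> {}" unfolding I0(3) by blast
  qed
  then obtain f where f: "\<And>N. N \<in> I \<Longrightarrow> f \<in> C N" by blast
  have key: "\<exists>x\<in>R N. \<forall>M\<in>I. N \<subseteq> M \<longrightarrow> f M = x M" if N: "N \<in> I" for N
  proof -
    obtain x where x: "x \<in> R N" "\<forall>M\<in>I. N \<subseteq> M \<longrightarrow> f M = M <#> x N"
      using f[OF N, unfolded C_def] by auto
    moreover have "x \<in> carrier P" using x(1) RP[OF N] by blast
    ultimately show ?thesis using coord_coarser[OF _ _ N] by auto
  qed
  have "f \<in> topspace T"
  proof -
    have "f \<in> C (carrier G)" by (rule f[OF carrier_fin_index[OF is_group]])
    then show ?thesis unfolding C_def using carrier_fin_index[OF is_group] by auto
  qed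
  have fP: "f \<in> carrier P"
    unfolding mem_carrier
  proof (intro conjI ballI allI impI)
    show "f N \<in> rcosets N" if "N \<in> I" for N using \<open>f \<in> topspace T\<close> that unfolding topT by auto
    show "f N = undefined" if "N \<notin> I" for N using \<open>f \<in> topspace T\<close> that unfolding topT by auto
    show "f N \<subseteq> f M" if NM: "N \<in> I" "M \<in> I" "N \<subseteq> M" for N M
    proof -
      obtain x where x: "x \<in> R N" "\<forall>M\<in>I. N \<subseteq> M \<longrightarrow> f M = x M" using key[OF NM(1)] by blast
      then show ?thesis using coord_mono[of x N M] RP NM by auto
    qed
  qed
  have "f \<in> R N" if N: "N \<in> I" for N
  proof -
    obtain x where x: "x \<in> R N" "\<forall>M\<in>I. N \<subseteq> M \<longrightarrow> f M = x M" using key[OF N] by blast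
    then show ?thesis using sat[OF N x(1) fP] N by simp
  qed
  then show ?thesis using fP by blast
qed

text \<open>The vertex x A_b of the coset graph at level \<open>N\<close>, as the subset N g A_b of
  the group for any g in \<open>x N\<close>.\<close>

definition vkey :: "(bool \<Rightarrow> 'a set) \<Rightarrow> bool \<Rightarrow> 'a set \<Rightarrow> ('a set \<Rightarrow> 'a set) \<Rightarrow> 'a set" where
  "vkey A b N x = x N <#> A b"

lemma vkey_left:
  assumes "A b \<subseteq> carrier G" "s \<in> carrier P" "x \<in> carrier P" "N \<in> I"
  shows "vkey A b N (s \<otimes>\<^bsub>P\<^esub> x) = s N <#> vkey A b N x"
  unfolding vkey_def mult_coord[OF assms(4)]
  by (rule set_mult_assoc) (use coord_subset assms in auto)

lemma vkey_left_iff: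
  assumes "A b \<subseteq> carrier G" "s \<in> carrier P" "x \<in> carrier P" "y \<in> carrier P" "N \<in> I"
  shows "vkey A b N (s \<otimes>\<^bsub>P\<^esub> x) = vkey A b N (s \<otimes>\<^bsub>P\<^esub> y) \<longleftrightarrow> vkey A b N x = vkey A b N y"
proof
  interpret P: group P by (rule group_P)
  assume h: "vkey A b N (s \<otimes>\<^bsub>P\<^esub> x) = vkey A b N (s \<otimes>\<^bsub>P\<^esub> y)"
  have "vkey A b N (inv\<^bsub>P\<^esub> s \<otimes>\<^bsub>P\<^esub> (s \<otimes>\<^bsub>P\<^esub> x)) = vkey A b N (inv\<^bsub>P\<^esub> s \<otimes>\<^bsub>P\<^esub> (s \<otimes>\<^bsub>P\<^esub> y))"
    using vkey_left[where A = A and b = b and N = N and s = "inv\<^bsub>P\<^esub> s"] h assms by simp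
  then show "vkey A b N x = vkey A b N y" using assms by (simp add: P.m_assoc[symmetric])
next
  assume "vkey A b N x = vkey A b N y"
  then show "vkey A b N (s \<otimes>\<^bsub>P\<^esub> x) = vkey A b N (s \<otimes>\<^bsub>P\<^esub> y)" using vkey_left assms by simp
qed

lemma vkey_coarser:
  assumes "A b \<subseteq> carrier G" "x \<in> carrier P" "N \<in> I" "M \<in> I" "M \<subseteq> N"
  shows "vkey A b N x = N <#> vkey A b M x"
  unfolding vkey_def coord_coarser[OF assms(2-5)]
  by (rule set_mult_assoc) (use coord_subset assms(1,2,4) subgroup.subset[OF subgroupN[OF assms(3)]] in auto)

text \<open>An element fixing the base vertex at every level meets \<open>A b\<close> modulo every
  \<open>N\<close>; so vertex stabilisers are closures.\<close>

lemma vkey_one_cl: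
  assumes A: "subgroup (A b) G" and x: "x \<in> carrier P" and e: "\<And>N. N \<in> I \<Longrightarrow> vkey A b N x = vkey A b N \<one>\<^bsub>P\<^esub>"
  shows "x \<in> cl (A b)"
proof -
  have "x N \<inter> A b \<noteq> {}" if N: "N \<in> I" for N
  proof -
    obtain g where g: "g \<in> x N" using coord_nonempty[OF x N] by blast
    note r = coord_rep[OF x N g]
    have "g \<otimes> \<one> \<in> x N <#> A b" using g subgroup.one_closed[OF A] unfolding set_mult_def by blast
    then have "g \<in> N <#> A b" using e[OF N] r(2) one_coord[OF N] by (simp add: vkey_def)
    then obtain n a where na: "n \<in> N" "a \<in> A b" "g = n \<otimes> a" unfolding set_mult_def by blast
    have nc: "n \<in> carrier G" "a \<in> carrier G"
      using na subgroup.subset[OF A] subgroup.subset[OF subgroupN[OF N]] by blast+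
    have "inv n \<otimes> g \<in> N #> g" using subgroup.m_inv_closed[OF subgroupN[OF N] na(1)] unfolding r_coset_def by blast
    moreover have "inv n \<otimes> g = a" using na(3) nc by (simp add: m_assoc[symmetric])
    ultimately show ?thesis using na(2) r(1) by auto
  qed
  then show ?thesis using x unfolding cl_def by blast
qed

end

section \<open>Torsion in the profinite completion\<close>

context coxeter
begin

sublocale pf: profinite "coxeter_group V E m"
  unfolding profinite_def by (rule group_coxeter)

abbreviation "G \<equiv> coxeter_group V E m"

definition par :: "'a set \<Rightarrow> 'a list set set" where
  "par J = cls V E m ` lists J"

lemma par_carrier: "J \<subseteq> V \<Longrightarrow> par J \<subseteq> carrier G"
  unfolding par_def carrier_coxeter using lists_mono by blast

lemma par_subgroup: assumes "J \<subseteq> V" shows "subgroup (par J) G"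
  unfolding par_def special_parabolic_eq[OF assms, symmetric] special_parabolic_def
  by (rule pf.generate_is_subgroup) (use assms in \<open>auto simp: carrier_coxeter cox_gen_def cls_def\<close>)

lemma cl_word:
  assumes "x \<in> pf.cl (par J)" "N \<in> pf.I"
  obtains u where "u \<in> lists J" "cls V E m u \<in> x N"
  using assms unfolding pf.cl_def par_def by blast

lemma vkey_word:
  assumes "x \<in> pf.cl (par J)" "N \<in> pf.I" "cls V E m u \<in> x N"
  shows "pf.vkey H b N x = pf.vkey H b N (pf.emb (cls V E m u))"
  unfolding pf.vkey_def pf.emb_coord[OF assms(2)]
  using pf.coord_rep(1)[OF pf.cl_carrier[OF assms(1)] assms(2,3)] by simp

lemma emb_in_cl: "J \<subseteq> V \<Longrightarrow> u \<in> lists J \<Longrightarrow> pf.emb (cls V E m u) \<in> pf.cl (par J)"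
  using pf.cl_emb[OF _ par_carrier] unfolding par_def by blast

lemma vkey_absorb:
  assumes J: "J \<subseteq> V" and D: "D \<subseteq> V" and u: "u \<in> lists V" and w: "w \<in> lists D" and N: "N \<in> pf.I" and H: "H b = par D"
  shows "pf.vkey H b N (pf.emb (cls V E m (u @ w))) = pf.vkey H b N (pf.emb (cls V E m u))"
proof -
  let ?u = "cls V E m u" and ?w = "cls V E m w"
  have wV: "w \<in> lists V" using w lists_mono[OF D] by blast
  have c: "?u \<in> carrier G" "?w \<in> carrier G" using u wV by (simp_all add: carrier_coxeter)
  have NG: "N \<subseteq> carrier G" using subgroup.subset[OF pf.subgroupN[OF N]] .
  have wD: "?w \<in> par D" using w by (simp add: par_def)
  have "?w <#\<^bsub>G\<^esub> par D = par D" using pf.coset_join3[OF c(2) par_subgroup[OF D] wD] .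
  have "(N #>\<^bsub>G\<^esub> (?u \<otimes>\<^bsub>G\<^esub> ?w)) <#>\<^bsub>G\<^esub> par D = ((N #>\<^bsub>G\<^esub> ?u) #>\<^bsub>G\<^esub> ?w) <#>\<^bsub>G\<^esub> par D"
    using pf.coset_mult_assoc[OF NG c] by simp
  also have "\<dots> = (N #>\<^bsub>G\<^esub> ?u) <#>\<^bsub>G\<^esub> (?w <#\<^bsub>G\<^esub> par D)"
    using pf.rcos_assoc_lcos[OF pf.r_coset_subset_G[OF NG c(1)] par_carrier[OF D] c(2)] .
  also have "?w <#\<^bsub>G\<^esub> par D = par D" using pf.coset_join3[OF c(2) par_subgroup[OF D] wD] .
  finally show ?thesis
    unfolding pf.vkey_def pf.emb_coord[OF N] H using mult_coxeter[OF u wV, of E m] by simp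
qed

text \<open>\<open>W_J\<close> is the amalgam of \<open>W_{J - {a}}\<close> and \<open>W_{J - {b}}\<close> over \<open>W_{J - {a, b}}\<close> when \<open>a\<close> and \<open>b\<close> are
  not adjacent, and \<open>extend_action\<close> says that the closure of \<open>W_J\<close> is its profinite completion.\<close>
lemma splitting_tree:
  assumes FC: "FC_type V E m" and J: "J \<subseteq> V" and ab: "a \<in> J" "b \<in> J" "a \<noteq> b" "{a, b} \<notin> E"
    and H_def: "H = (\<lambda>c. par (J - {if c then b else a}))"
  shows "pro_tree (pf.cl (par J)) pf.I (\<lambda>N M. M \<subseteq> N) (pf.vkey H)"
proof
  define s where "s c = (if c then b else a)" for c
  have As: "H c = par (J - {s c})" for c by (simp add: H_def s_def)
  have AG: "H c \<subseteq> carrier G" for c unfolding As using J by (intro par_carrier) blast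
  have lJ: "u \<in> lists V" if "u \<in> lists J" for u using that lists_mono[OF J] by blast
  have absorb: "pf.vkey H c N (pf.emb (cls V E m (u @ w))) = pf.vkey H c N (pf.emb (cls V E m u))"
    if "u \<in> lists J" "w \<in> lists (J - {s c})" "N \<in> pf.I" for c N u w
    using vkey_absorb[OF J _ lJ[OF that(1)] that(2,3), where H = H and b = c] As J by blast
  note clP = pf.cl_carrier
  show "\<exists>K\<in>pf.I. K \<subseteq> N \<and> K \<subseteq> M" if "N \<in> pf.I" "M \<in> pf.I" for N M
    using fin_index_normals_Int[OF group_coxeter that] by blast
  show "pf.I \<noteq> {}" using carrier_fin_index[OF group_coxeter] by blast
  show "pf.vkey H c N u = pf.vkey H c N v"
    if "N \<in> pf.I" "M \<in> pf.I" "M \<subseteq> N" "u \<in> pf.cl (par J)" "v \<in> pf.cl (par J)" "pf.vkey H c M u = pf.vkey H c M v"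
    for c N M u v
    using pf.vkey_coarser[where A = H and b = c, OF AG clP[OF that(4)] that(1-3)]
      pf.vkey_coarser[where A = H and b = c, OF AG clP[OF that(5)] that(1-3)] that(6) by simp
  show "\<exists>x. \<forall>N\<in>pf.I. x \<in> R N"
    if R: "\<And>N. N \<in> pf.I \<Longrightarrow> R N \<subseteq> pf.cl (par J)" "\<And>N. N \<in> pf.I \<Longrightarrow> R N \<noteq> {}"
      "\<And>N u v. \<lbrakk>N \<in> pf.I; u \<in> R N; v \<in> pf.cl (par J); \<And>b. pf.vkey H b N u = pf.vkey H b N v\<rbrakk> \<Longrightarrow> v \<in> R N"
      "\<And>N M. \<lbrakk>N \<in> pf.I; M \<in> pf.I; M \<subseteq> N\<rbrakk> \<Longrightarrow> R M \<subseteq> R N" for R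
  proof -
    \<comment> \<open>\<open>pf.compact\<close> concerns the whole completion, so the sets are first
      saturated in it. The limit returns to the closure because each of its coordinates meets
      \<open>par J\<close>.\<close>
    define R' where "R' N = {y \<in> carrier pf.P. \<exists>x\<in>R N. x N = y N}" for N
    have "\<exists>x\<in>carrier pf.P. \<forall>N\<in>pf.I. x \<in> R' N"
    proof (rule pf.compact)
      show "R' N \<noteq> {}" if "N \<in> pf.I" for N using R(1,2)[OF that] clP unfolding R'_def by blast
      show "R' M \<subseteq> R' N" if NM: "N \<in> pf.I" "M \<in> pf.I" "M \<subseteq> N" for N M
      proof
        fix y assume "y \<in> R' M"
        then obtain x where x: "y \<in> carrier pf.P" "x \<in> R M" "x M = y M" unfolding R'_def by blast
        have "x \<in> carrier pf.P" using x(2) R(1)[OF NM(2)] clP by blast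
        then have "x N = y N" using pf.coord_coarser[OF _ NM] x by metis
        then show "y \<in> R' N" using x R(4)[OF NM] unfolding R'_def by blast
      qed
    qed (auto simp: R'_def)
    then obtain y where y: "y \<in> carrier pf.P" "\<And>N. N \<in> pf.I \<Longrightarrow> y \<in> R' N" by blast
    have "y N \<inter> par J \<noteq> {}" if N: "N \<in> pf.I" for N
    proof -
      obtain x where "x \<in> R N" "x N = y N" using y(2)[OF N] unfolding R'_def by blast
      moreover from this have "x \<in> pf.cl (par J)" using R(1)[OF N] by blast
      then have "x N \<inter> par J \<noteq> {}" using N unfolding pf.cl_def by blast
      ultimately show ?thesis by simp
    qed
    then have yc: "y \<in> pf.cl (par J)" using y(1) unfolding pf.cl_def by blast
    have "y \<in> R N" if N: "N \<in> pf.I" for N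
    proof -
      obtain x where "x \<in> R N" "x N = y N" using y(2)[OF N] unfolding R'_def by blast
      then show ?thesis using R(3)[OF N _ yc] unfolding pf.vkey_def by simp
    qed
    then show ?thesis by blast
  qed
  fix N :: "'a list set set" and f :: "('a list set set \<Rightarrow> 'a list set set) \<Rightarrow> int" and n :: int
  assume N: "N \<in> pf.I" and n: "n > 0"
    and f: "\<And>u v. \<lbrakk>u \<in> pf.cl (par J); v \<in> pf.cl (par J); \<And>b. pf.vkey H b N u = pf.vkey H b N v\<rbrakk> \<Longrightarrow> f u = f v"
  \<comment> \<open>\<open>f\<close> as a function of words. Appending a letter other than
    \<open>a\<close> and \<open>b\<close> keeps both ends of an edge, hence also
    \<open>F\<close>.\<close>
  define F where "F u = f (pf.emb (cls V E m u))" for u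
  define q where "q u = N #>\<^bsub>G\<^esub> cls V E m u" for u
  note qc = coset_finite_congruence[OF N J]
  have ecl: "pf.emb (cls V E m u) \<in> pf.cl (par J)" if "u \<in> lists J" for u using emb_in_cl[OF J that] .
  have Fq: "F u = F u'" if "q u = q u'" "u \<in> lists J" "u' \<in> lists J" for u u'
    unfolding F_def using that by (intro f ecl) (auto simp: pf.vkey_def pf.emb_coord[OF N] q_def)
  have FC': "F (u @ [v]) = F u" if "u \<in> lists J" "v \<in> J - {a, b}" for u v
    unfolding F_def using that by (intro f ecl absorb N) (auto simp: s_def)
  define T where "T = q ` lists J"
  obtain r where r: "cox_action J E m T r" and
    r_fold: "\<And>u x. u \<in> lists J \<Longrightarrow> x \<in> lists J \<Longrightarrow> fold r x (q u) = q (u @ x)"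
    using congruence_action[OF qc] unfolding T_def q_def by blast
  have r1: "r v (q u) = q (u @ [v])" if "u \<in> lists J" "v \<in> J" for u v using r_fold[of u "[v]"] that by simp
  define Fh where "Fh t = F (SOME u. u \<in> lists J \<and> q u = t)" for t
  have Fh: "Fh (q u) = F u" if "u \<in> lists J" for u
  proof -
    have "\<exists>u'. u' \<in> lists J \<and> q u' = q u" using that by blast
    from someI_ex[OF this] show ?thesis unfolding Fh_def using Fq that by blast
  qed
  \<comment> \<open>A reflection of Z/n, hence an involution. Over a step from u to u a the two
    twists compose to the addition of F(u a) - F(u). A neighbour of \<open>a\<close> is never
    \<open>b\<close>, so it does not change \<open>F\<close>, as the braid relations
    require.\<close>
  define \<theta> where "\<theta> v t z = (if v = a then (Fh t - z) mod n else z)" for v t and z :: int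
  define \<rho> where "\<rho> v = (\<lambda>(z, t). (\<theta> v (r v t) (\<theta> v t z), r v t))" for v
  have \<rho>: "cox_action J E m ({0..<n} \<times> T) \<rho>"
    unfolding \<rho>_def
  proof (rule skew_action[OF r])
    show "\<theta> v t z \<in> {0..<n}" if "z \<in> {0..<n}" for v t z using that n by (auto simp: \<theta>_def)
    show "\<theta> v t (\<theta> v t z) = z" if "z \<in> {0..<n}" for v t z
      using that by (simp add: \<theta>_def mod_diff_right_eq)
    show "\<theta> w (r v t) z = \<theta> w t z" if vw: "v \<in> J" "w \<in> J" "{v, w} \<in> E" "t \<in> T" for v w t z
    proof (cases "w = a")
      case True
      then have "v \<noteq> a" "v \<noteq> b" using vw ab edge[of v w] J by (auto simp: insert_commute)
      obtain u where u: "u \<in> lists J" "t = q u" using vw(4) unfolding T_def by blast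
      then have "Fh (r v t) = Fh t"
        using r1[OF u(1) vw(1)] Fh FC'[OF u(1)] vw(1) \<open>v \<noteq> a\<close> \<open>v \<noteq> b\<close> by simp
      then show ?thesis by (simp add: \<theta>_def)
    qed (simp add: \<theta>_def)
    show "\<theta> v t (\<theta> w t z) = \<theta> w t (\<theta> v t z)" if vw: "v \<in> J" "w \<in> J" "{v, w} \<in> E" for v w t z
    proof -
      have "v \<noteq> w" using edge[of v w] vw J by blast
      then show ?thesis by (simp add: \<theta>_def)
    qed
  qed
  have "finite ({0..<n} \<times> T)" using qc unfolding T_def q_def finite_congruence_def by blast
  \<comment> \<open>The finite action of W_J becomes visible in a finite quotient of the whole
    group: \<open>z\<close> will depend only on classes modulo \<open>N'\<close>.\<close>
  from extend_action[OF FC J \<rho> this] obtain N' where N': "N' \<in> pf.I" and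
    triv: "\<And>u z. u \<in> lists J \<Longrightarrow> cls V E m u \<in> N' \<Longrightarrow> z \<in> {0..<n} \<times> T \<Longrightarrow> fold \<rho> u z = z" by blast
  define M where "M = N \<inter> N'"
  have M: "M \<in> pf.I" unfolding M_def by (rule fin_index_normals_Int[OF group_coxeter N N'])
  define base where "base = ((0::int), q [])"
  have baseS: "base \<in> {0..<n} \<times> T" using n unfolding base_def T_def by auto
  define z where "z u = fst (fold \<rho> u base)" for u
  have snd_\<rho>: "snd (\<rho> v p) = r v (snd p)" for v p by (simp add: \<rho>_def split: prod.splits)
  have snd: "snd (fold \<rho> u base) = q u" if "u \<in> lists J" for u
    using that
  proof (induction u rule: rev_induct)
    case (snoc v u)
    then show ?case using r1[of u v] by (simp add: snd_\<rho>)
  qed (simp add: base_def)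
  have zsnoc: "z (u @ [v]) = \<theta> v (q (u @ [v])) (\<theta> v (q u) (z u))" if "u \<in> lists J" "v \<in> J" for u v
  proof -
    have "fold \<rho> u base = (z u, q u)" using snd[OF that(1)] by (simp add: z_def prod_eq_iff)
    then show ?thesis using r1[OF that] unfolding z_def[of "u @ [v]"] by (simp add: \<rho>_def)
  qed
  have zother: "z (u @ [v]) = z u" if "u \<in> lists J" "v \<in> J" "v \<noteq> a" for u v
    using zsnoc[OF that(1,2)] that(3) by (simp add: \<theta>_def)
  have za: "z (u @ [a]) = (z u + F (u @ [a]) - F u) mod n" if "u \<in> lists J" for u
  proof -
    have "z (u @ [a]) = (F (u @ [a]) - (F u - z u) mod n) mod n"
      using zsnoc[OF that ab(1)] Fh[OF that] Fh[of "u @ [a]"] that ab(1) by (simp add: \<theta>_def)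
    also have "\<dots> = (F (u @ [a]) - (F u - z u)) mod n" by (simp add: mod_diff_right_eq)
    finally show ?thesis by (simp add: algebra_simps)
  qed
  \<comment> \<open>Modulo n, \<open>z\<close> sums the changes of \<open>F\<close> at the letters
    \<open>a\<close>, so -z is unchanged by letters other than \<open>a\<close>. Then F - z is
    unchanged by letters other than \<open>b\<close>, and subtracting -z from it leaves
    \<open>F\<close>.\<close>
  define \<mu> where "\<mu> c u = (if c then (F u - z u) mod n else - z u)" for c u
  have \<mu>step: "\<mu> c (u @ w) = \<mu> c u" if "u \<in> lists J" "w \<in> lists (J - {s c})" for c u w
    using that(2)
  proof (induction w rule: rev_induct)
    case (snoc v w)
    have uw: "u @ w \<in> lists J" "v \<in> J" "v \<noteq> s c" using snoc.prems that(1) by (auto simp: lists_eq_set)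
    have "\<mu> c ((u @ w) @ [v]) = \<mu> c (u @ w)"
    proof (cases "v = a")
      case True
      then have "c" using uw by (auto simp: s_def split: if_splits)
      have "(F ((u @ w) @ [a]) - z ((u @ w) @ [a])) mod n = (F (u @ w) - z (u @ w)) mod n"
        unfolding za[OF uw(1)] mod_diff_right_eq by simp
      then show ?thesis using \<open>c\<close> True by (simp add: \<mu>_def)
    next
      case False
      show ?thesis
      proof (cases c)
        case True
        then have "v \<in> J - {a, b}" using uw False by (simp add: s_def)
        then show ?thesis using zother[OF uw(1,2) False] FC'[OF uw(1)] by (simp add: \<mu>_def)
      next
        case False
        then show ?thesis using zother[OF uw(1,2) \<open>v \<noteq> a\<close>] by (simp add: \<mu>_def)
      qed
    qed
    then show ?case using snoc by simp
  qed simp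
  have same: "\<mu> c u = \<mu> c u'" if u: "u \<in> lists J" "u' \<in> lists J" "M #>\<^bsub>G\<^esub> cls V E m u = M #>\<^bsub>G\<^esub> cls V E m u'" for c u u'
  proof -
    have uV: "u \<in> lists V" "u' \<in> lists V" using u lJ by blast+
    have MG: "subgroup M G" using pf.subgroupN[OF M] .
    have "cls V E m u \<in> M #>\<^bsub>G\<^esub> cls V E m u'"
      using pf.rcos_self[OF _ MG, of "cls V E m u"] uV u(3) by (auto simp: carrier_coxeter)
    then obtain k where k: "k \<in> M" "cls V E m u = k \<otimes>\<^bsub>G\<^esub> cls V E m u'" unfolding r_coset_def by blast
    have kc: "k \<in> carrier G" using k(1) subgroup.subset[OF MG] by blast
    have u'c: "cls V E m u' \<in> carrier G" using uV by (simp add: carrier_coxeter)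
    have "cls V E m (u @ rev u') = cls V E m u \<otimes>\<^bsub>G\<^esub> inv\<^bsub>G\<^esub> (cls V E m u')"
      using uV by (simp add: inv_coxeter mult_coxeter)
    also have "\<dots> = k" unfolding k(2) using kc u'c by (simp add: pf.m_assoc)
    finally have k': "cls V E m (u @ rev u') \<in> N" "cls V E m (u @ rev u') \<in> N'" using k(1) by (simp_all add: M_def)
    have "fold \<rho> (u @ rev u') base = base" using triv[of "u @ rev u'"] k' u baseS by simp
    then have "fold \<rho> u' (fold \<rho> (rev u') (fold \<rho> u base)) = fold \<rho> u' base" by simp
    moreover have "fold \<rho> u base \<in> {0..<n} \<times> T" using cox_action_closed[OF \<rho> u(1) baseS] .
    then have "fold \<rho> (rev u' @ u') (fold \<rho> u base) = fold \<rho> u base"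
      using cox_action_equiv[OF \<rho> cox_equiv_rev'[OF u(2)]] by simp
    ultimately have e: "fold \<rho> u base = fold \<rho> u' base" by simp
    then have "z u = z u'" by (simp add: z_def)
    moreover have "q u = q u'" using snd[OF u(1)] snd[OF u(2)] e by simp
    ultimately show ?thesis using Fq[OF _ u(1,2)] by (simp add: \<mu>_def)
  qed
  define pick where "pick x = (SOME u. u \<in> lists J \<and> cls V E m u \<in> x M)" for x
  have pick: "pick x \<in> lists J" "cls V E m (pick x) \<in> x M" if "x \<in> pf.cl (par J)" for x
  proof -
    have "\<exists>u. u \<in> lists J \<and> cls V E m u \<in> x M" by (rule cl_word[OF that M]) blast
    from someI_ex[OF this] show "pick x \<in> lists J" "cls V E m (pick x) \<in> x M" unfolding pick_def by blast+
  qed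
  define \<phi> where "\<phi> c x = \<mu> c (pick x)" for c x
  have "\<phi> c x = \<phi> c y" if x: "x \<in> pf.cl (par J)" and y: "y \<in> pf.cl (par J)" and k: "pf.vkey H c M x = pf.vkey H c M y" for c x y
  proof -
    note px = pick[OF x] and py = pick[OF y]
    have "cls V E m (pick y) \<in> y M <#>\<^bsub>G\<^esub> H c"
    proof -
      have "cls V E m [] \<in> H c" unfolding As par_def by simp
      moreover have "cls V E m (pick y) \<otimes>\<^bsub>G\<^esub> cls V E m [] = cls V E m (pick y)"
        using mult_coxeter[OF lJ[OF py(1)], of "[]" E m] by simp
      ultimately show ?thesis using py(2) unfolding set_mult_def by force
    qed
    then have "cls V E m (pick y) \<in> x M <#>\<^bsub>G\<^esub> H c" using k by (simp add: pf.vkey_def)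
    then obtain h w where hw: "h \<in> x M" "w \<in> lists (J - {s c})" "cls V E m (pick y) = h \<otimes>\<^bsub>G\<^esub> cls V E m w"
      unfolding set_mult_def As par_def by blast
    have wJ: "w \<in> lists J" using hw(2) lists_mono[of "J - {s c}" J] by blast
    have "h \<in> M #>\<^bsub>G\<^esub> cls V E m (pick x)" using pf.coord_rep(1)[OF clP[OF x] M px(2)] hw(1) by simp
    then obtain k where k: "k \<in> M" "h = k \<otimes>\<^bsub>G\<^esub> cls V E m (pick x)" unfolding r_coset_def by blast
    have car: "k \<in> carrier G" "cls V E m (pick x) \<in> carrier G" "cls V E m w \<in> carrier G" "cls V E m (pick x @ w) \<in> carrier G"
      using k(1) subgroup.subset[OF pf.subgroupN[OF M]] lJ px(1) wJ by (auto simp: carrier_coxeter)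
    have "cls V E m (pick y) = k \<otimes>\<^bsub>G\<^esub> cls V E m (pick x @ w)"
      unfolding hw(3) k(2) using mult_coxeter[OF lJ[OF px(1)] lJ[OF wJ], of E m] pf.m_assoc[OF car(1-3)] by simp
    then have "cls V E m (pick y) \<in> M #>\<^bsub>G\<^esub> cls V E m (pick x @ w)" using k(1) unfolding r_coset_def by blast
    note coset = pf.repr_independence[OF this car(4) pf.subgroupN[OF M]]
    have "\<mu> c (pick x @ w) = \<mu> c (pick y)"
      by (rule same[OF _ py(1) coset]) (use px(1) wJ in simp)
    then show ?thesis unfolding \<phi>_def using \<mu>step[OF px(1) hw(2)] by simp
  qed
  moreover have "[\<phi> True x - \<phi> False x = f x] (mod n)" if x: "x \<in> pf.cl (par J)" for x
  proof -
    note px = pick[OF x]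
    have "x M \<subseteq> x N" using pf.coord_mono[OF clP[OF x] M N] by (simp add: M_def)
    then have "cls V E m (pick x) \<in> x N" using px(2) by blast
    then have "f x = F (pick x)"
      unfolding F_def using vkey_word[OF x N] by (intro f x ecl px(1)) blast
    then show ?thesis unfolding \<phi>_def \<mu>_def by (simp add: Cong.cong_def mod_add_left_eq)
  qed
  ultimately show "\<exists>\<phi>. (\<forall>b. \<exists>j\<in>pf.I. \<forall>u\<in>pf.cl (par J). \<forall>v\<in>pf.cl (par J).
      pf.vkey H b j u = pf.vkey H b j v \<longrightarrow> \<phi> b u = \<phi> b v)
      \<and> (\<forall>u\<in>pf.cl (par J). [\<phi> True u - \<phi> False u = f u] (mod n))"
    using M by (intro exI[of _ \<phi>]) blast
qed

lemma mult_funpow: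
  assumes "s \<in> carrier pf.P" "t \<in> carrier pf.P" "x \<in> carrier pf.P"
  shows "(((\<lambda>x. s \<otimes>\<^bsub>pf.P\<^esub> x) \<circ> (\<lambda>x. t \<otimes>\<^bsub>pf.P\<^esub> x)) ^^ k) x = ((s \<otimes>\<^bsub>pf.P\<^esub> t) [^]\<^bsub>pf.P\<^esub> k) \<otimes>\<^bsub>pf.P\<^esub> x"
proof -
  interpret P: group pf.P by (rule pf.group_P)
  have "(s \<otimes>\<^bsub>pf.P\<^esub> t) \<otimes>\<^bsub>pf.P\<^esub> (s \<otimes>\<^bsub>pf.P\<^esub> t) [^]\<^bsub>pf.P\<^esub> k = (s \<otimes>\<^bsub>pf.P\<^esub> t) [^]\<^bsub>pf.P\<^esub> (Suc k)" for k :: nat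
    using P.nat_pow_Suc2[of "s \<otimes>\<^bsub>pf.P\<^esub> t" k] assms by simp
  note pow = this
  define f where "f = (\<lambda>x. s \<otimes>\<^bsub>pf.P\<^esub> x) \<circ> (\<lambda>x. t \<otimes>\<^bsub>pf.P\<^esub> x)"
  have "(f ^^ k) x = ((s \<otimes>\<^bsub>pf.P\<^esub> t) [^]\<^bsub>pf.P\<^esub> k) \<otimes>\<^bsub>pf.P\<^esub> x"
  proof (induction k)
    case (Suc k)
    have "(f ^^ Suc k) x = s \<otimes>\<^bsub>pf.P\<^esub> (t \<otimes>\<^bsub>pf.P\<^esub> (f ^^ k) x)" by (simp add: f_def)
    also have "\<dots> = ((s \<otimes>\<^bsub>pf.P\<^esub> t) \<otimes>\<^bsub>pf.P\<^esub> (s \<otimes>\<^bsub>pf.P\<^esub> t) [^]\<^bsub>pf.P\<^esub> k) \<otimes>\<^bsub>pf.P\<^esub> x"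
      unfolding Suc using assms by (simp add: P.m_assoc)
    finally show ?case unfolding pow .
  qed (use assms in simp)
  then show ?thesis unfolding f_def .
qed

text \<open>The family acts on the coset graph by left multiplication. If it fixes the vertex of
  \<open>x\<close> of type c, conjugation by \<open>x\<close> takes it into the stabiliser of the
  base vertex of that type, the closure of \<open>H c\<close>.\<close>

lemma split_torsion:
  assumes FC: "FC_type V E m" and J: "J \<subseteq> V" and ab: "a \<in> J" "b \<in> J" "a \<noteq> b" "{a, b} \<notin> E"
    and C: "finite C" "C \<noteq> {}" and s: "\<And>c. c \<in> C \<Longrightarrow> s c \<in> pf.cl (par J)"
    and invol: "\<And>c. c \<in> C \<Longrightarrow> s c \<otimes>\<^bsub>pf.P\<^esub> s c = \<one>\<^bsub>pf.P\<^esub>"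
    and tors: "\<And>c d. c \<in> C \<Longrightarrow> d \<in> C \<Longrightarrow> \<exists>k>0::nat. (s c \<otimes>\<^bsub>pf.P\<^esub> s d) [^]\<^bsub>pf.P\<^esub> k = \<one>\<^bsub>pf.P\<^esub>"
  obtains x e where "x \<in> carrier pf.P" "e \<in> J"
    "\<And>c. c \<in> C \<Longrightarrow> inv\<^bsub>pf.P\<^esub> x \<otimes>\<^bsub>pf.P\<^esub> s c \<otimes>\<^bsub>pf.P\<^esub> x \<in> pf.cl (par (J - {e}))"
proof -
  interpret P: group pf.P by (rule pf.group_P)
  define H where "H = (\<lambda>c. par (J - {if c then b else a}))"
  interpret T: pro_tree "pf.cl (par J)" pf.I "\<lambda>N M. M \<subseteq> N" "pf.vkey H"
    by (rule splitting_tree[OF FC J ab H_def])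
  have HG: "H c \<subseteq> carrier G" for c unfolding H_def using J by (intro par_carrier) blast
  note clP = pf.cl_carrier
  note subJ = par_subgroup[OF J]
  have lJ: "u \<in> lists V" if "u \<in> lists J" for u using that lists_mono[OF J] by blast
  have whole: "T.subtree (\<lambda>_. pf.cl (par J))"
    unfolding T.subtree_def
  proof (intro conjI allI impI)
    show "T.cld c (pf.cl (par J))" for c unfolding T.cld_def by blast
    have e0: "pf.emb (cls V E m []) \<in> pf.cl (par J)" by (rule emb_in_cl[OF J]) simp
    then show "\<exists>c. pf.cl (par J) \<noteq> {}" by blast
    fix \<gamma> :: "bool \<Rightarrow> ('a list set set \<Rightarrow> 'a list set set) \<Rightarrow> int"
    assume lc: "\<forall>c. T.lc c (\<gamma> c)" and e: "\<forall>u\<in>pf.cl (par J) \<inter> pf.cl (par J). \<gamma> True u = \<gamma> False u"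
    obtain N where N: "N \<in> pf.I" and
      \<gamma>N: "\<And>c u v. u \<in> pf.cl (par J) \<Longrightarrow> v \<in> pf.cl (par J) \<Longrightarrow> pf.vkey H c N u = pf.vkey H c N v \<Longrightarrow> \<gamma> c u = \<gamma> c v"
      using T.lc_common[of \<gamma>] lc by blast
    have eq: "\<gamma> c u = \<gamma> True u" if "u \<in> pf.cl (par J)" for c u using e that by (cases c) auto
    have word: "\<gamma> True (pf.emb (cls V E m u)) = \<gamma> True (pf.emb (cls V E m []))" if "u \<in> lists J" for u
      using that
    proof (induction u rule: rev_induct)
      case (snoc v u)
      have u: "u \<in> lists J" "v \<in> J" using snoc.prems by auto
      \<comment> \<open>Each letter lies in one of the two vertex groups, so the edges u and u v
        share an end; in this way all edges are connected at level \<open>N\<close>.\<close>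
      define c where "c = (v = a)"
      have v: "[v] \<in> lists (J - {if c then b else a})" using u ab by (auto simp: c_def)
      have "pf.vkey H c N (pf.emb (cls V E m (u @ [v]))) = pf.vkey H c N (pf.emb (cls V E m u))"
        by (rule vkey_absorb[OF J _ lJ[OF u(1)] v N]) (use J in \<open>auto simp: H_def\<close>)
      then have "\<gamma> c (pf.emb (cls V E m (u @ [v]))) = \<gamma> c (pf.emb (cls V E m u))"
        by (rule \<gamma>N[OF emb_in_cl[OF J snoc.prems] emb_in_cl[OF J u(1)]])
      then show ?case
        using eq[OF emb_in_cl[OF J snoc.prems], of c] eq[OF emb_in_cl[OF J u(1)], of c] snoc.IH[OF u(1)] by simp
    qed simp
    have "\<gamma> c x = \<gamma> True (pf.emb (cls V E m []))" if x: "x \<in> pf.cl (par J)" for c x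
    proof -
      obtain u where u: "u \<in> lists J" "cls V E m u \<in> x N" using cl_word[OF x N] .
      have "\<gamma> True x = \<gamma> True (pf.emb (cls V E m u))"
        using \<gamma>N[OF x emb_in_cl[OF J u(1)]] vkey_word[OF x N u(2)] by blast
      then show ?thesis using eq[OF x, of c] word[OF u(1)] by simp
    qed
    then show "\<exists>k. \<forall>c. \<forall>x\<in>pf.cl (par J). \<gamma> c x = k" by blast
  qed
  have "\<exists>c. \<exists>x\<in>pf.cl (par J). \<forall>d\<in>C. x \<in> T.Fix (\<lambda>x. s d \<otimes>\<^bsub>pf.P\<^esub> x) c"
  proof (rule T.common_fixed_vertex[OF whole C])
    show "T.aut (\<lambda>x. s c \<otimes>\<^bsub>pf.P\<^esub> x)" if "c \<in> C" for c
      unfolding T.aut_def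
      using pf.cl_mult[OF subJ s[OF that]] pf.vkey_left_iff[where A = H, OF HG clP[OF s[OF that]] clP clP] by blast
    show "s c \<otimes>\<^bsub>pf.P\<^esub> (s c \<otimes>\<^bsub>pf.P\<^esub> x) = x" if "c \<in> C" "x \<in> pf.cl (par J)" for c x
      using P.m_assoc[OF clP[OF s[OF that(1)]] clP[OF s[OF that(1)]] clP[OF that(2)]] invol[OF that(1)] clP[OF that(2)] by simp
    show "\<exists>k>0. \<forall>x\<in>pf.cl (par J). (((\<lambda>x. s c \<otimes>\<^bsub>pf.P\<^esub> x) \<circ> (\<lambda>x. s d \<otimes>\<^bsub>pf.P\<^esub> x)) ^^ k) x = x"
      if cd: "c \<in> C" "d \<in> C" for c d
    proof -
      obtain k :: nat where k: "k > 0" "(s c \<otimes>\<^bsub>pf.P\<^esub> s d) [^]\<^bsub>pf.P\<^esub> k = \<one>\<^bsub>pf.P\<^esub>" using tors[OF cd] by blast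
      then show ?thesis using mult_funpow[OF clP[OF s[OF cd(1)]] clP[OF s[OF cd(2)]] clP] clP
        by (intro exI[of _ k]) simp
    qed
  qed
  then obtain c x where x: "x \<in> pf.cl (par J)" and fix_x: "\<And>d. d \<in> C \<Longrightarrow> x \<in> T.Fix (\<lambda>x. s d \<otimes>\<^bsub>pf.P\<^esub> x) c" by blast
  note xP = clP[OF x]
  define e where "e = (if c then b else a)"
  show ?thesis
  proof (rule that[of x e])
    show "e \<in> J" using ab by (simp add: e_def)
    fix d assume d: "d \<in> C"
    note sP = clP[OF s[OF d]]
    have "inv\<^bsub>pf.P\<^esub> x \<otimes>\<^bsub>pf.P\<^esub> s d \<otimes>\<^bsub>pf.P\<^esub> x \<in> pf.cl (H c)"
    proof (rule pf.vkey_one_cl)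
      show "subgroup (H c) G" unfolding H_def using J by (intro par_subgroup) blast
      show "inv\<^bsub>pf.P\<^esub> x \<otimes>\<^bsub>pf.P\<^esub> s d \<otimes>\<^bsub>pf.P\<^esub> x \<in> carrier pf.P" using xP sP by simp
      fix N assume N: "N \<in> pf.I"
      have "pf.vkey H c N (s d \<otimes>\<^bsub>pf.P\<^esub> x) = pf.vkey H c N x" using fix_x[OF d] N unfolding T.Fix_def by blast
      then have "pf.vkey H c N (inv\<^bsub>pf.P\<^esub> x \<otimes>\<^bsub>pf.P\<^esub> (s d \<otimes>\<^bsub>pf.P\<^esub> x)) = pf.vkey H c N (inv\<^bsub>pf.P\<^esub> x \<otimes>\<^bsub>pf.P\<^esub> x)"
        using pf.vkey_left_iff[where A = H, OF HG P.inv_closed[OF xP] P.m_closed[OF sP xP] xP N] by blast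
      then show "pf.vkey H c N (inv\<^bsub>pf.P\<^esub> x \<otimes>\<^bsub>pf.P\<^esub> s d \<otimes>\<^bsub>pf.P\<^esub> x) = pf.vkey H c N \<one>\<^bsub>pf.P\<^esub>"
        using xP sP by (simp add: P.m_assoc)
    qed
    then show "inv\<^bsub>pf.P\<^esub> x \<otimes>\<^bsub>pf.P\<^esub> s d \<otimes>\<^bsub>pf.P\<^esub> x \<in> pf.cl (par (J - {e}))" by (simp add: H_def e_def)
  qed (rule xP)
qed

text \<open>Induction on the size of \<open>J\<close>: while two of its vertices are not adjacent,
  \<open>split_torsion\<close> conjugates the family into the closure of a smaller parabolic
  subgroup, and conjugation preserves the torsion hypotheses.\<close>

theorem torsion_in_clique:
  assumes FC: "FC_type V E m" and J: "J \<subseteq> V" and C: "finite C" "C \<noteq> {}"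
    and s: "\<And>c. c \<in> C \<Longrightarrow> s c \<in> pf.cl (par J)"
    and invol: "\<And>c. c \<in> C \<Longrightarrow> s c \<otimes>\<^bsub>pf.P\<^esub> s c = \<one>\<^bsub>pf.P\<^esub>"
    and tors: "\<And>c d. c \<in> C \<Longrightarrow> d \<in> C \<Longrightarrow> \<exists>k>0::nat. (s c \<otimes>\<^bsub>pf.P\<^esub> s d) [^]\<^bsub>pf.P\<^esub> k = \<one>\<^bsub>pf.P\<^esub>"
  shows "\<exists>x\<in>carrier pf.P. \<exists>D. clique V E D \<and>
    (\<forall>c\<in>C. inv\<^bsub>pf.P\<^esub> x \<otimes>\<^bsub>pf.P\<^esub> s c \<otimes>\<^bsub>pf.P\<^esub> x \<in> pf.cl (par D))"
  using J s invol tors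
proof (induction "card J" arbitrary: J s rule: less_induct)
  case less
  interpret P: group pf.P by (rule pf.group_P)
  note clP = pf.cl_carrier
  show ?case
  proof (cases "clique V E J")
    case True
    have "inv\<^bsub>pf.P\<^esub> \<one>\<^bsub>pf.P\<^esub> \<otimes>\<^bsub>pf.P\<^esub> s c \<otimes>\<^bsub>pf.P\<^esub> \<one>\<^bsub>pf.P\<^esub> \<in> pf.cl (par J)" if "c \<in> C" for c
      using less.prems(2)[OF that] clP[OF less.prems(2)[OF that]] by simp
    then show ?thesis using True by blast
  next
    case False
    then obtain a b where ab: "a \<in> J" "b \<in> J" "a \<noteq> b" "{a, b} \<notin> E"
      using less.prems(1) unfolding clique_def by blast
    obtain x e where x: "x \<in> carrier pf.P" "e \<in> J" and
      mem: "\<And>c. c \<in> C \<Longrightarrow> inv\<^bsub>pf.P\<^esub> x \<otimes>\<^bsub>pf.P\<^esub> s c \<otimes>\<^bsub>pf.P\<^esub> x \<in> pf.cl (par (J - {e}))"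
    proof (rule split_torsion[where C = C and s = s, OF FC less.prems(1) ab C])
      show "s c \<in> pf.cl (par J)" if "c \<in> C" for c by (rule less.prems(2)[OF that])
      show "s c \<otimes>\<^bsub>pf.P\<^esub> s c = \<one>\<^bsub>pf.P\<^esub>" if "c \<in> C" for c by (rule less.prems(3)[OF that])
      show "\<exists>k>0::nat. (s c \<otimes>\<^bsub>pf.P\<^esub> s d) [^]\<^bsub>pf.P\<^esub> k = \<one>\<^bsub>pf.P\<^esub>" if "c \<in> C" "d \<in> C" for c d
        by (rule less.prems(4)[OF that])
    qed (rule that)
    define t where "t c = inv\<^bsub>pf.P\<^esub> x \<otimes>\<^bsub>pf.P\<^esub> s c \<otimes>\<^bsub>pf.P\<^esub> x" for c
    have sP: "s c \<in> carrier pf.P" if "c \<in> C" for c using clP[OF less.prems(2)[OF that]] .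
    have cancel: "x \<otimes>\<^bsub>pf.P\<^esub> (inv\<^bsub>pf.P\<^esub> x \<otimes>\<^bsub>pf.P\<^esub> z) = z" if "z \<in> carrier pf.P" for z
      using x(1) that by (simp add: P.m_assoc[symmetric])
    have tt: "t c \<otimes>\<^bsub>pf.P\<^esub> t d = inv\<^bsub>pf.P\<^esub> x \<otimes>\<^bsub>pf.P\<^esub> (s c \<otimes>\<^bsub>pf.P\<^esub> s d) \<otimes>\<^bsub>pf.P\<^esub> x" if "c \<in> C" "d \<in> C" for c d
      using x(1) sP that cancel by (simp add: t_def P.m_assoc)
    have pow: "(inv\<^bsub>pf.P\<^esub> x \<otimes>\<^bsub>pf.P\<^esub> z \<otimes>\<^bsub>pf.P\<^esub> x) [^]\<^bsub>pf.P\<^esub> (k::nat) = inv\<^bsub>pf.P\<^esub> x \<otimes>\<^bsub>pf.P\<^esub> (z [^]\<^bsub>pf.P\<^esub> k) \<otimes>\<^bsub>pf.P\<^esub> x"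
      if "z \<in> carrier pf.P" for z k
      using that x(1) cancel by (induction k) (simp_all add: P.m_assoc)
    have fin: "finite J" using less.prems(1) finite_V finite_subset by blast
    have "\<exists>y\<in>carrier pf.P. \<exists>D. clique V E D \<and> (\<forall>c\<in>C. inv\<^bsub>pf.P\<^esub> y \<otimes>\<^bsub>pf.P\<^esub> t c \<otimes>\<^bsub>pf.P\<^esub> y \<in> pf.cl (par D))"
    proof (rule less.hyps[of "J - {e}" t])
      show "card (J - {e}) < card J" using x(2) fin by (rule card_Diff1_less[rotated])
      show "J - {e} \<subseteq> V" using less.prems(1) by blast
      show "t c \<in> pf.cl (par (J - {e}))" if "c \<in> C" for c unfolding t_def by (rule mem[OF that])
      show "t c \<otimes>\<^bsub>pf.P\<^esub> t c = \<one>\<^bsub>pf.P\<^esub>" if "c \<in> C" for c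
        using tt[OF that that] less.prems(3)[OF that] x(1) by simp
      show "\<exists>k>0::nat. (t c \<otimes>\<^bsub>pf.P\<^esub> t d) [^]\<^bsub>pf.P\<^esub> k = \<one>\<^bsub>pf.P\<^esub>" if cd: "c \<in> C" "d \<in> C" for c d
      proof -
        obtain k :: nat where k: "k > 0" "(s c \<otimes>\<^bsub>pf.P\<^esub> s d) [^]\<^bsub>pf.P\<^esub> k = \<one>\<^bsub>pf.P\<^esub>" using less.prems(4)[OF cd] by blast
        then show ?thesis unfolding tt[OF cd] using pow sP cd x(1) by (intro exI[of _ k]) simp
      qed
    qed
    then obtain y D where y: "y \<in> carrier pf.P" "clique V E D"
      "\<And>c. c \<in> C \<Longrightarrow> inv\<^bsub>pf.P\<^esub> y \<otimes>\<^bsub>pf.P\<^esub> t c \<otimes>\<^bsub>pf.P\<^esub> y \<in> pf.cl (par D)" by blast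
    have "inv\<^bsub>pf.P\<^esub> (x \<otimes>\<^bsub>pf.P\<^esub> y) \<otimes>\<^bsub>pf.P\<^esub> s c \<otimes>\<^bsub>pf.P\<^esub> (x \<otimes>\<^bsub>pf.P\<^esub> y) = inv\<^bsub>pf.P\<^esub> y \<otimes>\<^bsub>pf.P\<^esub> t c \<otimes>\<^bsub>pf.P\<^esub> y"
      if "c \<in> C" for c
      using x(1) y(1) sP[OF that] by (simp add: t_def P.m_assoc P.inv_mult_group)
    then have "\<forall>c\<in>C. inv\<^bsub>pf.P\<^esub> (x \<otimes>\<^bsub>pf.P\<^esub> y) \<otimes>\<^bsub>pf.P\<^esub> s c \<otimes>\<^bsub>pf.P\<^esub> (x \<otimes>\<^bsub>pf.P\<^esub> y) \<in> pf.cl (par D)"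
      using y(3) by simp
    then show ?thesis using y(2) P.m_closed[OF x(1) y(1)] by blast
  qed
qed

section \<open>Residual finiteness and transfer of FC type\<close>

lemma cl_whole: "x \<in> carrier pf.P \<Longrightarrow> x \<in> pf.cl (par V)"
  unfolding pf.cl_def par_def carrier_coxeter[symmetric]
  using pf.coord_nonempty pf.coord_subset by blast

lemma emb_inj: "inj_on pf.emb (carrier G)"
proof (rule inj_onI)
  fix g h assume "g \<in> carrier G" "h \<in> carrier G" and e: "pf.emb g = pf.emb h"
  then obtain u u' where u: "u \<in> lists V" "g = cls V E m u" and u': "u' \<in> lists V" "h = cls V E m u'"
    by (auto simp: carrier_coxeter)
  obtain F :: "'a list \<Rightarrow> bool \<times> 'a \<times> 'a \<Rightarrow> real set" where F: "finite_congruence V E m F" and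
    sep: "\<And>w w'. w \<in> {u, u'} \<Longrightarrow> w' \<in> {u, u'} \<Longrightarrow> F w = F w' \<Longrightarrow> (w, w') \<in> ce"
    using residually_finite[of "{u, u'}"] u u' by blast
  define N where "N = cls V E m ` {u \<in> lists V. F u = F []}"
  have N: "N \<in> pf.I" unfolding N_def by (rule kernel_fin_index_normal(1)[OF F])
  have "g \<in> pf.emb h N" using pf.emb_self[OF \<open>g \<in> carrier G\<close> N] e by simp
  then have "g \<in> N #>\<^bsub>G\<^esub> h" unfolding pf.emb_coord[OF N] .
  then obtain a where a: "a \<in> N" "g = a \<otimes>\<^bsub>G\<^esub> h" unfolding r_coset_def by blast
  from a(1) obtain k where k': "k \<in> lists V" "F k = F []" "a = cls V E m k" unfolding N_def by blast
  then have k: "k \<in> lists V" "F k = F []" "cls V E m u = cls V E m (k @ u')"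
    using a(2) u(2) u' by (simp_all add: mult_coxeter)
  have "F u = F (k @ u')" using finite_congruence_equiv[OF F] k(3) by (simp add: cls_eq_iff)
  also have "\<dots> = F u'" using finite_congruenceD[OF F k(1) _ _ u'(1) k(2), of "[]"] by simp
  finally show "g = h" using sep[of u u'] u u' by (simp add: cls_eq_iff)
qed

end

text \<open>For \<open>c\<close>, \<open>d\<close> adjacent in the clique, the order of the product
  of their images divides \<open>m2 {c, d}\<close>, as \<open>torsion_in_clique\<close> needs. Its
  conclusion concerns generators; closure of \<open>A.pf.cl (A.par D)\<close> under products extends
  it to all words over \<open>C\<close>.\<close>

lemma FC_transfer:
  assumes 1: "coxeter V1 E1 m1" and 2: "coxeter V2 E2 m2" and FC: "FC_type V1 E1 m1"
    and \<phi>: "\<phi> \<in> hom (profinite_completion (coxeter_group V2 E2 m2)) (profinite_completion (coxeter_group V1 E1 m1))"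
    and inj: "inj_on \<phi> (carrier (profinite_completion (coxeter_group V2 E2 m2)))"
  shows "FC_type V2 E2 m2"
  unfolding FC_type_def
proof (intro allI impI)
  interpret A: coxeter V1 E1 m1 by (rule 1)
  interpret B: coxeter V2 E2 m2 by (rule 2)
  interpret PA: group A.pf.P by (rule A.pf.group_P)
  interpret PB: group B.pf.P by (rule B.pf.group_P)
  interpret \<phi>: group_hom B.pf.P A.pf.P \<phi>
    by unfold_locales (rule \<phi>)
  fix C assume C: "clique V2 E2 C"
  then have CV: "C \<subseteq> V2" by (simp add: clique_def)
  show "finite (special_parabolic V2 E2 m2 C)"
    unfolding special_parabolic_eq[OF CV]
  proof (cases "C = {}")
    case True
    then have "lists C = {[]}" by (auto simp: lists_eq_set)
    then show "finite (cls V2 E2 m2 ` lists C)" by simp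
  next
    case False
    define h where "h u = \<phi> (B.pf.emb (cls V2 E2 m2 u))" for u
    have car: "cls V2 E2 m2 u \<in> carrier B.G" if "u \<in> lists V2" for u using that by (simp add: carrier_coxeter)
    have lC: "u \<in> lists V2" if "u \<in> lists C" for u using that lists_mono[OF CV] by blast
    have hP: "h u \<in> carrier A.pf.P" if "u \<in> lists V2" for u
      unfolding h_def using car[OF that] B.pf.emb_carrier by simp
    have hm: "h (u @ w) = h u \<otimes>\<^bsub>A.pf.P\<^esub> h w" if "u \<in> lists V2" "w \<in> lists V2" for u w
      unfolding h_def mult_coxeter[OF that, symmetric] B.pf.emb_mult[OF car[OF that(1)] car[OF that(2)]]
      using car that B.pf.emb_carrier by (intro \<phi>.hom_mult) auto
    have h1: "h [] = \<one>\<^bsub>A.pf.P\<^esub>"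
      unfolding h_def using B.pf.emb_one \<phi>.hom_one by (simp add: one_coxeter)
    have heq: "h u = h u'" if "(u, u') \<in> cox_equiv V2 E2 m2" for u u'
      using that unfolding h_def cls_eq_iff[symmetric] by simp
    have hsq: "h [v] \<otimes>\<^bsub>A.pf.P\<^esub> h [v] = \<one>\<^bsub>A.pf.P\<^esub>" if "v \<in> C" for v
      using hm[of "[v]" "[v]"] heq[OF cox_equiv_square, of v] h1 that CV by auto
    have hpow: "(h [v] \<otimes>\<^bsub>A.pf.P\<^esub> h [w]) [^]\<^bsub>A.pf.P\<^esub> k = h (alt_word v w (2 * k))" if "v \<in> V2" "w \<in> V2" for v w k
    proof (induction k)
      case (Suc k)
      have "alt_word v w (2 * Suc k) = alt_word v w (2 * k) @ [v, w]"
      proof -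
        have "alt_word v w 2 = [v, w]" by (simp add: numeral_2_eq_2 alt_word_Suc alt_word_0)
        then show ?thesis using alt_word_add[of v w "2 * k" 2] by simp
      qed
      then show ?case
        using Suc hm[of "alt_word v w (2 * k)" "[v, w]"] hm[of "[v]" "[w]"] that alt_word_lists[OF that] by simp
    qed (simp add: h1 alt_word_0)
    have "\<exists>x\<in>carrier A.pf.P. \<exists>D. clique V1 E1 D \<and>
        (\<forall>c\<in>C. inv\<^bsub>A.pf.P\<^esub> x \<otimes>\<^bsub>A.pf.P\<^esub> h [c] \<otimes>\<^bsub>A.pf.P\<^esub> x \<in> A.pf.cl (A.par D))"
    proof (rule A.torsion_in_clique[OF FC order_refl finite_subset[OF CV B.finite_V] False])
      show "h [c] \<in> A.pf.cl (A.par V1)" if "c \<in> C" for c using A.cl_whole hP[of "[c]"] that CV by auto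
      show "\<exists>k>0. (h [c] \<otimes>\<^bsub>A.pf.P\<^esub> h [d]) [^]\<^bsub>A.pf.P\<^esub> (k::nat) = \<one>\<^bsub>A.pf.P\<^esub>" if cd: "c \<in> C" "d \<in> C" for c d
      proof (cases "c = d")
        case True
        then show ?thesis using hsq[OF cd(1)] by (intro exI[of _ 1]) simp
      next
        case False
        then have e: "{c, d} \<in> E2" "c \<in> V2" "d \<in> V2" using C cd CV unfolding clique_def by blast+
        have "(alt_word c d (2 * m2 {c, d}), []) \<in> cox_equiv V2 E2 m2"
          using cox_equiv_step[OF cox_step.br[of "[]" V2 "[]" c d E2 m2]] e by simp
        then have "(h [c] \<otimes>\<^bsub>A.pf.P\<^esub> h [d]) [^]\<^bsub>A.pf.P\<^esub> (m2 {c, d}) = \<one>\<^bsub>A.pf.P\<^esub>"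
          unfolding hpow[OF e(2,3)] using heq h1 by metis
        moreover have "m2 {c, d} > 0" using B.edge[OF e(2,3,1)] by simp
        ultimately show ?thesis by blast
      qed
    qed (rule hsq)
    then obtain x D where x: "x \<in> carrier A.pf.P" and D: "clique V1 E1 D" and
      mem: "\<And>c. c \<in> C \<Longrightarrow> inv\<^bsub>A.pf.P\<^esub> x \<otimes>\<^bsub>A.pf.P\<^esub> h [c] \<otimes>\<^bsub>A.pf.P\<^esub> x \<in> A.pf.cl (A.par D)" by blast
    have DV: "D \<subseteq> V1" using D by (simp add: clique_def)
    have "finite (A.par D)" using FC D special_parabolic_eq[OF DV, of E1 m1] unfolding FC_type_def A.par_def by metis
    then have fin: "finite (A.pf.cl (A.par D))"
      using A.pf.cl_finite[OF _ A.par_carrier[OF DV]] finite_subset by blast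
    note sub = A.par_subgroup[OF DV]
    have conj: "inv\<^bsub>A.pf.P\<^esub> x \<otimes>\<^bsub>A.pf.P\<^esub> h u \<otimes>\<^bsub>A.pf.P\<^esub> x \<in> A.pf.cl (A.par D)" if "u \<in> lists C" for u
      using that
    proof (induction u rule: rev_induct)
      case Nil
      have "A.pf.emb (cls V1 E1 m1 []) \<in> A.pf.cl (A.par D)" by (rule A.emb_in_cl[OF DV]) simp
      then show ?case using x h1 A.pf.emb_one by (simp add: one_coxeter)
    next
      case (snoc c u)
      have u: "u \<in> lists C" "c \<in> C" using snoc.prems by auto
      have "h (u @ [c]) = h u \<otimes>\<^bsub>A.pf.P\<^esub> h [c]" using hm[OF lC[OF u(1)], of "[c]"] u CV by auto
      moreover have "x \<otimes>\<^bsub>A.pf.P\<^esub> (inv\<^bsub>A.pf.P\<^esub> x \<otimes>\<^bsub>A.pf.P\<^esub> (h [c] \<otimes>\<^bsub>A.pf.P\<^esub> x)) = h [c] \<otimes>\<^bsub>A.pf.P\<^esub> x"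
        using x hP[of "[c]"] u CV by (auto simp: PA.m_assoc[symmetric])
      ultimately have "inv\<^bsub>A.pf.P\<^esub> x \<otimes>\<^bsub>A.pf.P\<^esub> h (u @ [c]) \<otimes>\<^bsub>A.pf.P\<^esub> x
          = (inv\<^bsub>A.pf.P\<^esub> x \<otimes>\<^bsub>A.pf.P\<^esub> h u \<otimes>\<^bsub>A.pf.P\<^esub> x) \<otimes>\<^bsub>A.pf.P\<^esub> (inv\<^bsub>A.pf.P\<^esub> x \<otimes>\<^bsub>A.pf.P\<^esub> h [c] \<otimes>\<^bsub>A.pf.P\<^esub> x)"
        using x hP[OF lC[OF u(1)]] hP[of "[c]"] u CV by (auto simp: PA.m_assoc)
      then show ?case using A.pf.cl_mult[OF sub snoc.IH[OF u(1)] mem[OF u(2)]] by simp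
    qed
    have "finite (h ` lists C)"
    proof (rule finite_subset)
      show "h ` lists C \<subseteq> (\<lambda>z. x \<otimes>\<^bsub>A.pf.P\<^esub> z \<otimes>\<^bsub>A.pf.P\<^esub> inv\<^bsub>A.pf.P\<^esub> x) ` A.pf.cl (A.par D)"
      proof
        fix y assume "y \<in> h ` lists C"
        then obtain u where u: "u \<in> lists C" "y = h u" by blast
        have "y = x \<otimes>\<^bsub>A.pf.P\<^esub> (inv\<^bsub>A.pf.P\<^esub> x \<otimes>\<^bsub>A.pf.P\<^esub> h u \<otimes>\<^bsub>A.pf.P\<^esub> x) \<otimes>\<^bsub>A.pf.P\<^esub> inv\<^bsub>A.pf.P\<^esub> x"
        proof -
          have "x \<otimes>\<^bsub>A.pf.P\<^esub> (inv\<^bsub>A.pf.P\<^esub> x \<otimes>\<^bsub>A.pf.P\<^esub> h u) = h u"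
            using x hP[OF lC[OF u(1)]] by (simp add: PA.m_assoc[symmetric])
          then show ?thesis unfolding u(2) using x hP[OF lC[OF u(1)]] by (simp add: PA.m_assoc)
        qed
        then show "y \<in> (\<lambda>z. x \<otimes>\<^bsub>A.pf.P\<^esub> z \<otimes>\<^bsub>A.pf.P\<^esub> inv\<^bsub>A.pf.P\<^esub> x) ` A.pf.cl (A.par D)" using conj[OF u(1)] by blast
      qed
      show "finite ((\<lambda>z. x \<otimes>\<^bsub>A.pf.P\<^esub> z \<otimes>\<^bsub>A.pf.P\<^esub> inv\<^bsub>A.pf.P\<^esub> x) ` A.pf.cl (A.par D))" using fin by (rule finite_imageI)
    qed
    moreover have "h ` lists C = (\<phi> \<circ> B.pf.emb) ` (cls V2 E2 m2 ` lists C)" unfolding h_def by (auto simp: image_image)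
    moreover have "inj_on (\<phi> \<circ> B.pf.emb) (cls V2 E2 m2 ` lists C)"
    proof (rule comp_inj_on)
      have sub: "cls V2 E2 m2 ` lists C \<subseteq> carrier B.G" using lC car by blast
      show "inj_on B.pf.emb (cls V2 E2 m2 ` lists C)" by (rule inj_on_subset[OF B.emb_inj sub])
      show "inj_on \<phi> (B.pf.emb ` cls V2 E2 m2 ` lists C)"
        by (rule inj_on_subset[OF inj]) (use sub B.pf.emb_carrier in blast)
    qed
    ultimately show "finite (cls V2 E2 m2 ` lists C)" using finite_imageD by metis
  qed
qed

lemma labelled_graph_coxeter: "labelled_graph V E m \<Longrightarrow> coxeter V E m"
  unfolding labelled_graph_def by unfold_locales (fastforce simp: doubleton_eq_iff)+

theorem theorem6p6:
  fixes V1 :: "'a set" and E1 :: "'a set set" and m1 :: "'a set \<Rightarrow> nat"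
    and V2 :: "'b set" and E2 :: "'b set set" and m2 :: "'b set \<Rightarrow> nat"
  assumes "labelled_graph V1 E1 m1" and "labelled_graph V2 E2 m2"
    and "profinite_completions_iso (coxeter_group V1 E1 m1) (coxeter_group V2 E2 m2)"
  shows "FC_type V1 E1 m1 \<longleftrightarrow> FC_type V2 E2 m2"
proof -
  interpret A: coxeter V1 E1 m1 by (rule labelled_graph_coxeter[OF assms(1)])
  interpret B: coxeter V2 E2 m2 by (rule labelled_graph_coxeter[OF assms(2)])
  obtain \<phi> where \<phi>: "\<phi> \<in> iso A.pf.P B.pf.P"
    using assms(3) unfolding profinite_completions_iso_def by blast
  \<comment> \<open>\<open>FC_transfer\<close> takes a map into the completion of the group known to
    be of FC type, so the two directions use \<phi> and its inverse.\<close>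
  have \<psi>: "inv_into (carrier A.pf.P) \<phi> \<in> iso B.pf.P A.pf.P"
    by (rule group.iso_set_sym[OF A.pf.group_P \<phi>])
  show ?thesis
    using FC_transfer[OF A.coxeter_axioms B.coxeter_axioms _, of "inv_into (carrier A.pf.P) \<phi>"]
      FC_transfer[OF B.coxeter_axioms A.coxeter_axioms _, of \<phi>] \<phi> \<psi>
    unfolding iso_def bij_betw_def by blast
qed

end
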